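(* Let $p>1$ and let $q:\mathbb{R}\to\mathbb{R}$ be $1$-periodic with $q\in L^1(0,1)$. For each $n\in\mathbb{N}$ let $\lambda_n$ be one of the rotational eigenvalues $\underline{\lambda}_n(q)$, $\overline{\lambda}_n(q)$ of $-\left(y'^{(p-1)}\right)'=(p-1)(\lambda-q(x))y^{(p-1)}$ (with periodic boundary conditions if $n$ is even and anti-periodic boundary conditions if $n$ is odd), let $y_n$ be a corresponding eigenfunction having exactly $n$ zeros in $[0,1)$, and let $\ell_j^{(n)}$, with $j=j_n(x)$, be the nodal length of $y_n$ at $x\in(0,1)$. Define, for $x\in(0,1)$ and $n\in\mathbb{N}$: (a) (periodic boundary conditions) $$F_{2n}(x)=p(2n\widehat{\pi})^p\left[2n\,\ell_{j_{2n}(x)}^{(2n)}-1\right]+\int_0^1 q(t)\,dt;$$ (b) (anti-periodic boundary conditions) $$F_{2n-1}(x)=p((2n-1)\widehat{\pi})^p\left[(2n-1)\,\ell_{j_{2n-1}(x)}^{(2n-1)}-1\right]+\int_0^1 q(t)\,dt.$$ Then, as $n\to\infty$, both $\{F_{2n}\}$ and $\{F_{2n-1}\}$ converge to $q$ pointwise almost everywhere on $(0,1)$ and in $L^1(0,1)$.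
   Context: For a real-valued $f$, $f^{(p-1)}:=|f|^{p-1}\operatorname{sgn} f$. A solution $y$ of $-\left(y'^{(p-1)}\right)'=(p-1)(\lambda-q(x))y^{(p-1)}$ is a function with $y$ and $y'^{(p-1)}$ locally absolutely continuous satisfying the equation a.e. Periodic boundary conditions: $y(0)=y(1)$, $y'(0)=y'(1)$. Anti-periodic boundary conditions: $y(0)=-y(1)$, $y'(0)=-y'(1)$. An eigenvalue is a real $\lambda$ for which a nontrivial solution (eigenfunction) satisfying the boundary conditions exists. $\widehat{\pi}:=\dfrac{2\pi}{p\sin(\pi/p)}$. Rotational eigenvalues: for $n\in\mathbb{N}$, $\underline{\lambda}_n(q)$ and $\overline{\lambda}_n(q)$ denote respectively the minimal and the maximal eigenvalue having an eigenfunction with exactly $n$ zeros in $[0,1)$, of the periodic problem if $n$ is even and of the anti-periodic problem if $n$ is odd. (It is known, by Zhang, that these exist and that $\overline{\lambda}_0<\underline{\lambda}_1\le\overline{\lambda}_1<\underline{\lambda}_2\le\overline{\lambda}_2<\cdots$.) Nodal data: let $0\le x_0^{(n)}<x_1^{(n)}<\dots<x_{n-1}^{(n)}<1$ be the zeros in $[0,1)$ of the eigenfunction $y_n$ associated with $\lambda_n$. Extending $y_n$ to $\mathbb{R}$ as a solution (it is periodic or anti-periodic with period $1$), its zeros are indexed by all integers $i$ via $x_{i+n}^{(n)}=x_i^{(n)}+1$. The nodal lengths are $\ell_i^{(n)}=x_{i+1}^{(n)}-x_i^{(n)}$, and $j_n(x)=\max\{i: x_i^{(n)}\le x\}$. 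*)

theory Defs
  imports "HOL-Analysis.Analysis"
begin

text \<open>The signed power \<open>f\<^sup>(\<^sup>r\<^sup>) = \<bar>f\<bar>\<^sup>r sgn f\<close>; it is used with \<open>r = p - 1\<close>.\<close>

definition spow :: "real \<Rightarrow> real \<Rightarrow> real" where
  "spow r u = \<bar>u\<bar> powr r * sgn u"

definition pi_hat :: "real \<Rightarrow> real" where
  "pi_hat p = 2 * pi / (p * sin (pi / p))"

text \<open>Absolute continuity of a function of a real variable (the library only has
  absolute continuity of measures).\<close>

definition abs_continuous_on :: "real set \<Rightarrow> (real \<Rightarrow> real) \<Rightarrow> bool" where
  "abs_continuous_on S f \<longleftrightarrow>
     (\<forall>\<epsilon>>0. \<exists>\<delta>>0. \<forall>(N::nat) (a::nat \<Rightarrow> real) (b::nat \<Rightarrow> real).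
        (\<forall>k<N. a k \<le> b k \<and> {a k..b k} \<subseteq> S) \<longrightarrow>
        disjoint_family_on (\<lambda>k. {a k<..<b k}) {..<N} \<longrightarrow>
        (\<Sum>k<N. b k - a k) < \<delta> \<longrightarrow>
        (\<Sum>k<N. \<bar>f (b k) - f (a k)\<bar>) < \<epsilon>)"

definition locally_abs_continuous :: "(real \<Rightarrow> real) \<Rightarrow> bool" where
  "locally_abs_continuous f \<longleftrightarrow> (\<forall>u v. abs_continuous_on {u..v} f)"

text \<open>Solutions on the whole real line. For \<open>p > 1\<close>, local absolute continuity (hence
  continuity) of \<open>y'\<^sup>(\<^sup>p\<^sup>-\<^sup>1\<^sup>)\<close> means that \<open>y'\<close> is continuous, so \<open>y\<close> is differentiable everywhere;
  differentiability is listed explicitly because \<^const>\<open>deriv\<close> is total.\<close>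

definition plap_solution :: "real \<Rightarrow> (real \<Rightarrow> real) \<Rightarrow> real \<Rightarrow> (real \<Rightarrow> real) \<Rightarrow> bool" where
  "plap_solution p q l y \<longleftrightarrow>
     locally_abs_continuous y \<and>
     (\<forall>x. y differentiable (at x)) \<and>
     locally_abs_continuous (\<lambda>x. spow (p - 1) (deriv y x)) \<and>
     (AE x in lebesgue.
        ((\<lambda>t. spow (p - 1) (deriv y t)) has_real_derivative
           - ((p - 1) * (l - q x) * spow (p - 1) (y x))) (at x))"

definition periodic_bc :: "(real \<Rightarrow> real) \<Rightarrow> bool" where
  "periodic_bc y \<longleftrightarrow> y 0 = y 1 \<and> deriv y 0 = deriv y 1"

definition antiperiodic_bc :: "(real \<Rightarrow> real) \<Rightarrow> bool" where
  "antiperiodic_bc y \<longleftrightarrow> y 0 = - y 1 \<and> deriv y 0 = - deriv y 1"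

definition zeros01 :: "(real \<Rightarrow> real) \<Rightarrow> real set" where
  "zeros01 y = {x \<in> {0..<1}. y x = 0}"

text \<open>Eigenfunction of the periodic (\<open>n\<close> even) or anti-periodic (\<open>n\<close> odd) problem with exactly
  \<open>n\<close> zeros in \<open>[0,1)\<close>.\<close>

definition rot_eigenfunction ::
    "real \<Rightarrow> (real \<Rightarrow> real) \<Rightarrow> nat \<Rightarrow> real \<Rightarrow> (real \<Rightarrow> real) \<Rightarrow> bool" where
  "rot_eigenfunction p q n l y \<longleftrightarrow>
     plap_solution p q l y \<and> (\<exists>x. y x \<noteq> 0) \<and>
     (if even n then periodic_bc y else antiperiodic_bc y) \<and>
     finite (zeros01 y) \<and> card (zeros01 y) = n"

definition rot_eigenvalues :: "real \<Rightarrow> (real \<Rightarrow> real) \<Rightarrow> nat \<Rightarrow> real set" where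
  "rot_eigenvalues p q n = {l. \<exists>y. rot_eigenfunction p q n l y}"

text \<open>\<open>l\<close> is the minimal, respectively the maximal, element of the set above.\<close>

definition is_lower_rot_eigenvalue :: "real \<Rightarrow> (real \<Rightarrow> real) \<Rightarrow> nat \<Rightarrow> real \<Rightarrow> bool" where
  "is_lower_rot_eigenvalue p q n l \<longleftrightarrow>
     l \<in> rot_eigenvalues p q n \<and> (\<forall>m\<in>rot_eigenvalues p q n. l \<le> m)"

definition is_upper_rot_eigenvalue :: "real \<Rightarrow> (real \<Rightarrow> real) \<Rightarrow> nat \<Rightarrow> real \<Rightarrow> bool" where
  "is_upper_rot_eigenvalue p q n l \<longleftrightarrow>
     l \<in> rot_eigenvalues p q n \<and> (\<forall>m\<in>rot_eigenvalues p q n. m \<le> l)"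

text \<open>The nodes \<open>x\<^sub>i\<close>, \<open>i \<in> \<int>\<close>: for \<open>0 \<le> i < n\<close> the zeros in \<open>[0,1)\<close> in increasing order, and
  \<open>x\<^sub>i\<^sub>+\<^sub>n = x\<^sub>i + 1\<close>. Meaningful for \<open>n = card (zeros01 y) \<ge> 1\<close>.\<close>

definition node :: "nat \<Rightarrow> (real \<Rightarrow> real) \<Rightarrow> int \<Rightarrow> real" where
  "node n y i =
     sorted_list_of_set (zeros01 y) ! nat (i mod int n) + real_of_int (i div int n)"

definition nodal_length :: "nat \<Rightarrow> (real \<Rightarrow> real) \<Rightarrow> int \<Rightarrow> real" where
  "nodal_length n y i = node n y (i + 1) - node n y i"

definition nodal_index :: "nat \<Rightarrow> (real \<Rightarrow> real) \<Rightarrow> real \<Rightarrow> int" where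
  "nodal_index n y x = (GREATEST i. node n y i \<le> x)"

text \<open>\<open>F\<^sub>n\<close>, common to even and odd \<open>n\<close>. The integral is taken over \<open>lebesgue\<close> since \<open>q\<close> need not
  be Borel measurable.\<close>

definition nodal_F ::
    "real \<Rightarrow> (real \<Rightarrow> real) \<Rightarrow> nat \<Rightarrow> (real \<Rightarrow> real) \<Rightarrow> real \<Rightarrow> real" where
  "nodal_F p q n y x =
     p * (real n * pi_hat p) powr p *
       (real n * nodal_length n y (nodal_index n y x) - 1)
     + (LINT t:{0..1}|lebesgue. q t)"

definition conv_ae01 :: "(nat \<Rightarrow> real \<Rightarrow> real) \<Rightarrow> (real \<Rightarrow> real) \<Rightarrow> bool" where
  "conv_ae01 f g \<longleftrightarrow>
     (AE x in lebesgue. x \<in> {0<..<1} \<longrightarrow> (\<lambda>n. f n x) \<longlonglongrightarrow> g x)"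

text \<open>Integrability is part of the definition because the Bochner integral of a non-integrable
  function is \<open>0\<close>.\<close>

definition conv_L1_01 :: "(nat \<Rightarrow> real \<Rightarrow> real) \<Rightarrow> (real \<Rightarrow> real) \<Rightarrow> bool" where
  "conv_L1_01 f g \<longleftrightarrow>
     g absolutely_integrable_on {0<..<1} \<and>
     (\<forall>n. f n absolutely_integrable_on {0<..<1}) \<and>
     (\<lambda>n. LINT x:{0<..<1}|lebesgue. \<bar>f n x - g x\<bar>) \<longlonglongrightarrow> 0"

end

theory Submission
  imports Defs "HOL-Real_Asymp.Real_Asymp"
begin

text \<open>The proof replaces the generalised sine and the Pruefer angle by the Riccati variable
  \<open>u = (y'/y)\<^sup>(\<^sup>p\<^sup>-\<^sup>1\<^sup>)\<close>, which satisfies \<open>u' = -(p - 1) (\<lambda> - q + \<bar>u\<bar>\<^sup>p\<^sup>')\<close> with \<open>p' = p / (p - 1)\<close> and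
  runs from \<open>\<infinity>\<close> to \<open>-\<infinity>\<close> over each nodal interval \<open>I\<close>. Put \<open>W = \<lambda> / (\<lambda> + \<bar>u\<bar>\<^sup>p\<^sup>')\<close>, which is the
  \<open>p\<close>-th power of the generalised sine of the angle. Integrating the derivatives of a generalised
  arctangent of \<open>u\<close> and of \<open>u / (\<lambda> + \<bar>u\<bar>\<^sup>p\<^sup>')\<close> over \<open>I\<close> gives the exact identities
  \<open>\<bar>I\<bar> = pi_hat \<lambda>\<^sup>-\<^sup>1\<^sup>/\<^sup>p + (1/\<lambda>) \<integral>\<^sub>I q W\<close> and \<open>\<integral>\<^sub>I (p W - 1) (1 - q W / \<lambda>) = 0\<close>.
  Summing the first one over a period shows that \<open>\<lambda>\<^sub>n\<close> is asymptotic to \<open>(n pi_hat)\<^sup>p\<close> and that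
  \<open>F\<^sub>n(x) = c\<^sub>n (n \<integral>\<^sub>I q p W - \<integral>\<^sub>0\<^sup>1 q p W) + \<integral>\<^sub>0\<^sup>1 q\<close> with \<open>c\<^sub>n = (n pi_hat)\<^sup>p / \<lambda>\<^sub>n \<rightarrow> 1\<close>, where \<open>I\<close> contains \<open>x\<close>.
  By the second one the weight \<open>p W\<close> has mean close to \<open>1\<close> on \<open>I\<close>, so the weighted averages
  converge to \<open>q\<close> at Lebesgue points and, by Scheffe's lemma, in \<open>L\<^sup>1\<close>.\<close>

text \<open>The factor \<open>(n pi_hat)\<close> to the power \<open>p\<close> in \<open>F\<close>
  magnifies every error in the nodal lengths, so an asymptotic expansion would need a remainder of
  smaller order than its reciprocal, although \<open>q\<close> is merely integrable. The exact
  identities leave no remainder: \<open>n\<close> times the length identity on one cell minus its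
  sum over the period cancels the \<open>pi_hat\<close> terms completely. The weight
  \<open>p W\<close> oscillates inside every cell and has no useful pointwise limit; only its mean
  counts, because \<open>q\<close> is nearly constant in the mean on a short cell around a Lebesgue
  point. That \<open>W\<close> has mean about \<open>1/p\<close> is an equipartition law: for
  \<open>q = 0\<close>, integrating the derivative of \<open>y\<close> times the signed power of
  \<open>y'\<close> over a nodal interval balances \<open>\<bar>y'\<bar>\<^sup>p\<close> against
  \<open>(p - 1) \<lambda> \<bar>y\<bar>\<^sup>p\<close>. The mesh error and \<open>n\<close> times
  the error of the mean are both of order \<open>n / \<lambda>\<^sub>n\<close>, that is
  \<open>n\<^sup>1\<^sup>-\<^sup>p\<close>, and vanish because \<open>p > 1\<close>. Two obstacles
  shape the analysis: \<open>u'\<close> exists only almost everywhere, so absolute continuity is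
  needed, and \<open>u\<close> is unbounded at the nodes, so it is integrated only through test
  functions with limits at both infinities.\<close>

section \<open>Absolutely continuous functions\<close>

text \<open>An interval of a tagged division contains its tag but need not start or end there, so
  the derivative estimate is applied on each side of \<open>x\<close> and the two errors are
  added.\<close>

lemma DERIV_straddle:
  fixes F :: "real \<Rightarrow> real"
  assumes "(F has_real_derivative g) (at x)" "e > 0"
  obtains d where "d > 0"
    "\<And>u v. u \<le> x \<Longrightarrow> x \<le> v \<Longrightarrow> u \<in> ball x d \<Longrightarrow> v \<in> ball x d \<Longrightarrow>
        \<bar>F v - F u - g * (v - u)\<bar> \<le> e * (v - u)"
proof -
  obtain d where d: "d > 0" "\<And>y. norm (y - x) < d \<Longrightarrow> norm (F y - F x - g * (y - x)) \<le> e * norm (y - x)"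
    using assms unfolding has_field_derivative_def has_derivative_at_alt by blast
  show ?thesis
  proof
    fix u v assume uv: "u \<le> x" "x \<le> v" "u \<in> ball x d" "v \<in> ball x d"
    have "\<bar>F v - F x - g * (v - x)\<bar> \<le> e * (v - x)" "\<bar>F u - F x - g * (u - x)\<bar> \<le> e * (x - u)"
      using d(2)[of v] d(2)[of u] uv by (auto simp: dist_real_def)
    then show "\<bar>F v - F u - g * (v - u)\<bar> \<le> e * (v - u)"
      by (auto simp: algebra_simps abs_le_iff)
  qed (use d in auto)
qed

text \<open>Reindexing by a bijection frees the definition from families numbered by naturals, so
  that it can be applied directly to a set of tagged pieces of a division.\<close>

lemma abs_continuous_on_finite:
  assumes ac: "abs_continuous_on S F" and "e > 0"
  shows "\<exists>d>0. \<forall>P. finite P \<longrightarrow> (\<forall>i\<in>P. l i \<le> r i \<and> {l i..r i} \<subseteq> S) \<longrightarrow>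
        disjoint_family_on (\<lambda>i. {l i<..<r i}) P \<longrightarrow> (\<Sum>i\<in>P. r i - l i) < d \<longrightarrow>
        (\<Sum>i\<in>P. \<bar>F (r i) - F (l i)\<bar>) < e"
proof -
  have "\<exists>d>0. \<forall>(N::nat) a b. (\<forall>k<N. a k \<le> b k \<and> {a k..b k} \<subseteq> S) \<longrightarrow>
        disjoint_family_on (\<lambda>k. {a k<..<b k}) {..<N} \<longrightarrow>
        (\<Sum>k<N. b k - a k) < d \<longrightarrow> (\<Sum>k<N. \<bar>F (b k) - F (a k)\<bar>) < e"
    using ac[unfolded abs_continuous_on_def, rule_format, OF \<open>e > 0\<close>] .
  then obtain d where d: "d > 0" and dN: "\<forall>(N::nat) a b. (\<forall>k<N. a k \<le> b k \<and> {a k..b k} \<subseteq> S) \<longrightarrow>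
        disjoint_family_on (\<lambda>k. {a k<..<b k}) {..<N} \<longrightarrow>
        (\<Sum>k<N. b k - a k) < d \<longrightarrow> (\<Sum>k<N. \<bar>F (b k) - F (a k)\<bar>) < e"
    by (elim exE conjE) (rule that)
  show ?thesis
  proof (intro exI[of _ d] conjI allI impI)
    fix P assume P: "finite P" "\<forall>i\<in>P. l i \<le> r i \<and> {l i..r i} \<subseteq> S"
      "disjoint_family_on (\<lambda>i. {l i<..<r i}) P" "(\<Sum>i\<in>P. r i - l i) < d"
    obtain h where h: "bij_betw h {..<card P} P"
      using ex_bij_betw_nat_finite[OF P(1)] by (auto simp: atLeast0LessThan)
    have hP: "h k \<in> P" if "k < card P" for k using h that by (auto simp: bij_betw_def)
    have "(\<Sum>k<card P. \<bar>F (r (h k)) - F (l (h k))\<bar>) < e"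
    proof (rule dN[rule_format])
      fix k assume "k < card P"
      then show "l (h k) \<le> r (h k) \<and> {l (h k)..r (h k)} \<subseteq> S"
        using P(2) hP by blast
    next
      show "disjoint_family_on (\<lambda>k. {l (h k)<..<r (h k)}) {..<card P}"
        unfolding disjoint_family_on_def
      proof (intro ballI impI)
        fix m n assume "m \<in> {..<card P}" "n \<in> {..<card P}" "m \<noteq> n"
        then have "h m \<in> P" "h n \<in> P" "h m \<noteq> h n"
          using h by (auto simp: bij_betw_def inj_on_def)
        then show "{l (h m)<..<r (h m)} \<inter> {l (h n)<..<r (h n)} = {}"
          using P(3) unfolding disjoint_family_on_def by blast
      qed
      show "(\<Sum>k<card P. r (h k) - l (h k)) < d"
        using sum.reindex_bij_betw[OF h, of "\<lambda>i. r i - l i"] P(4) by simp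
    qed
    then show "(\<Sum>i\<in>P. \<bar>F (r i) - F (l i)\<bar>) < e"
      using sum.reindex_bij_betw[OF h, of "\<lambda>i. \<bar>F (r i) - F (l i)\<bar>"] by simp
  qed (rule d)
qed

lemma sum_length_le_measure:
  fixes l r :: "'i \<Rightarrow> real"
  assumes "finite P" "\<And>i. i \<in> P \<Longrightarrow> l i \<le> r i \<and> {l i<..<r i} \<subseteq> U"
    "disjoint_family_on (\<lambda>i. {l i<..<r i}) P" "U \<in> lmeasurable"
  shows "(\<Sum>i\<in>P. r i - l i) \<le> measure lebesgue U"
proof -
  have "(\<Sum>i\<in>P. r i - l i) = (\<Sum>i\<in>P. measure lebesgue {l i<..<r i})"
    using assms(2) by (intro sum.cong) auto
  also have "\<dots> = measure lebesgue (\<Union>i\<in>P. {l i<..<r i})"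
    using assms by (intro measure_finite_Union[symmetric]) (auto simp: emeasure_lborel_Ioo)
  also have "\<dots> \<le> measure lebesgue U"
    using assms by (intro measure_mono_fmeasurable) auto
  finally show ?thesis .
qed

text \<open>In the gauge sum, tags outside the exceptional null set are handled by
  differentiability; the intervals tagged in the null set have small total length, so absolute
  continuity makes their contribution small.\<close>

lemma fundamental_theorem_of_calculus_abs_continuous:
  fixes F g :: "real \<Rightarrow> real"
  assumes ac: "abs_continuous_on {a..b} F" and ab: "a \<le> b"
    and ae: "AE x in lebesgue. x \<in> {a..b} \<longrightarrow> (F has_real_derivative g x) (at x)"
  shows "(g has_integral F b - F a) {a..b}"
proof -
  define N where "N = {x\<in>{a..b}. \<not> (F has_real_derivative g x) (at x)}"
  have "negligible N"
  proof -
    obtain M where M: "M \<in> null_sets lebesgue" "{x \<in> space lebesgue. \<not> (x \<in> {a..b} \<longrightarrow> (F has_real_derivative g x) (at x))} \<subseteq> M"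
      using ae by (auto simp: eventually_ae_filter)
    then have "N \<subseteq> M" by (auto simp: N_def)
    with M show ?thesis using negligible_iff_null_sets negligible_subset by blast
  qed
  \<comment> \<open>The values of \<open>g\<close> on \<open>N\<close> are arbitrary and could spoil
    the Riemann sums. They are replaced by 0 here and restored at the end, \<open>N\<close> being
    negligible.\<close>
  define g' where "g' x = (if x \<in> N then 0 else g x)" for x
  have "(g' has_integral F b - F a) (cbox a b)"
    unfolding has_integral
  proof (intro allI impI)
    fix e :: real assume "e > 0"
    \<comment> \<open>The extra 2 in the denominator keeps it positive when \<open>a = b\<close> and
      makes the bound by \<open>e / 2\<close> strict.\<close>
    define e' where "e' = e / (2 * (b - a) + 2)"
    have e': "e' > 0" "e' * (b - a) < e / 2"
      using \<open>e > 0\<close> ab by (auto simp: e'_def field_simps)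
    have "\<exists>d>0. \<forall>P. finite P \<longrightarrow> (\<forall>i::real \<times> real set\<in>P. Inf (snd i) \<le> Sup (snd i) \<and> {Inf (snd i)..Sup (snd i)} \<subseteq> {a..b}) \<longrightarrow>
        disjoint_family_on (\<lambda>i. {Inf (snd i)<..<Sup (snd i)}) P \<longrightarrow> (\<Sum>i\<in>P. Sup (snd i) - Inf (snd i)) < d \<longrightarrow>
        (\<Sum>i\<in>P. \<bar>F (Sup (snd i)) - F (Inf (snd i))\<bar>) < e / 2"
      by (rule abs_continuous_on_finite[OF ac]) (use \<open>e > 0\<close> in simp)
    then obtain d where d: "d > 0" and dP: "\<forall>P. finite P \<longrightarrow> (\<forall>i::real \<times> real set\<in>P. Inf (snd i) \<le> Sup (snd i) \<and> {Inf (snd i)..Sup (snd i)} \<subseteq> {a..b}) \<longrightarrow>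
        disjoint_family_on (\<lambda>i. {Inf (snd i)<..<Sup (snd i)}) P \<longrightarrow> (\<Sum>i\<in>P. Sup (snd i) - Inf (snd i)) < d \<longrightarrow>
        (\<Sum>i\<in>P. \<bar>F (Sup (snd i)) - F (Inf (snd i))\<bar>) < e / 2"
      by (elim exE conjE) (rule that)
    have Nleb: "N \<in> sets lebesgue" and "emeasure lebesgue N = 0"
      using \<open>negligible N\<close> by (auto simp: negligible_iff_null_sets)
    obtain U where U: "open U" "N \<subseteq> U" "U - N \<in> lmeasurable" "emeasure lebesgue (U - N) < ennreal d"
      using sets_lebesgue_outer_open[OF Nleb \<open>d > 0\<close>] by metis
    have "U = (U - N) \<union> N" using U by auto
    then have Um: "U \<in> lmeasurable" 
      using U(3) \<open>negligible N\<close> negligible_imp_measurable by (metis fmeasurable.Un)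
    have "measure lebesgue U = measure lebesgue (U - N)"
      using \<open>negligible N\<close> U
      by (simp add: measure_Diff_null_set negligible_iff_null_sets)
    also have "\<dots> < d"
      using U(3,4) \<open>d > 0\<close> by (simp add: emeasure_eq_measure2 ennreal_less_iff)
    finally have Ud: "measure lebesgue U < d" .
    have "\<exists>\<gamma>. \<forall>x. open (\<gamma> x) \<and> x \<in> \<gamma> x \<and> (x \<in> N \<longrightarrow> \<gamma> x \<subseteq> U) \<and>
      (x \<in> {a..b} - N \<longrightarrow> (\<forall>u v. u \<le> x \<longrightarrow> x \<le> v \<longrightarrow> u \<in> \<gamma> x \<longrightarrow> v \<in> \<gamma> x \<longrightarrow>
        \<bar>F v - F u - g x * (v - u)\<bar> \<le> e' * (v - u)))"
    proof (rule choice, rule allI)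
      fix x
      consider "x \<in> N" | "x \<notin> {a..b}" | "x \<in> {a..b} - N" by blast
      then show "\<exists>A. open A \<and> x \<in> A \<and> (x \<in> N \<longrightarrow> A \<subseteq> U) \<and>
        (x \<in> {a..b} - N \<longrightarrow> (\<forall>u v. u \<le> x \<longrightarrow> x \<le> v \<longrightarrow> u \<in> A \<longrightarrow> v \<in> A \<longrightarrow>
          \<bar>F v - F u - g x * (v - u)\<bar> \<le> e' * (v - u)))"
      proof cases
        case 1 with U show ?thesis by blast
      next
        case 2 then have "x \<notin> N" unfolding N_def by blast
        with 2 show ?thesis by (intro exI[of _ UNIV]) auto
      next
        case 3
        then have "(F has_real_derivative g x) (at x)" by (auto simp: N_def)
        from DERIV_straddle[OF this e'(1)] obtain r where "r > 0" "\<And>u v. u \<le> x \<Longrightarrow> x \<le> v \<Longrightarrow> u \<in> ball x r \<Longrightarrow> v \<in> ball x r \<Longrightarrow>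
          \<bar>F v - F u - g x * (v - u)\<bar> \<le> e' * (v - u)" by blast
        with 3 show ?thesis by (intro exI[of _ "ball x r"]) auto
      qed
    qed
    then obtain \<gamma> where \<gamma>0: "\<forall>x. open (\<gamma> x) \<and> x \<in> \<gamma> x \<and> (x \<in> N \<longrightarrow> \<gamma> x \<subseteq> U) \<and>
      (x \<in> {a..b} - N \<longrightarrow> (\<forall>u v. u \<le> x \<longrightarrow> x \<le> v \<longrightarrow> u \<in> \<gamma> x \<longrightarrow> v \<in> \<gamma> x \<longrightarrow>
        \<bar>F v - F u - g x * (v - u)\<bar> \<le> e' * (v - u)))"
      by (rule exE)
    have \<gamma>: "open (\<gamma> x)" "x \<in> \<gamma> x" "x \<in> N \<Longrightarrow> \<gamma> x \<subseteq> U" for x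
      using \<gamma>0[THEN spec, of x] by simp_all
    have \<gamma>4: "\<bar>F v - F u - g x * (v - u)\<bar> \<le> e' * (v - u)"
      if "x \<in> {a..b} - N" "u \<le> x" "x \<le> v" "u \<in> \<gamma> x" "v \<in> \<gamma> x" for x u v
      using \<gamma>0[THEN spec, of x] that by blast
    have gg: "gauge \<gamma>" using \<gamma> by (auto simp: gauge_def)
    have fine: "norm ((\<Sum>(x, k)\<in>D. measure lborel k *\<^sub>R g' x) - (F b - F a)) < e"
      if D: "D tagged_division_of cbox a b" "\<gamma> fine D" for D
    proof -
      note Dd = tagged_division_ofD[OF D(1)]
      have fin: "finite D" by fact
      have shape: "\<exists>u v. i = (fst i, {u..v}) \<and> u \<le> fst i \<and> fst i \<le> v \<and> {u..v} \<subseteq> {a..b} \<and> Inf (snd i) = u \<and> Sup (snd i) = v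
             \<and> u \<in> \<gamma> (fst i) \<and> v \<in> \<gamma> (fst i) \<and> {u..v} \<subseteq> \<gamma> (fst i)" if "i \<in> D" for i
      proof -
        obtain x K where i: "i = (x, K)" by force
        with that obtain u v where K: "K = {u..v}" using Dd(4) by (metis cbox_interval)
        moreover have "x \<in> K" "K \<subseteq> {a..b}" using Dd(2,3) that i by auto
        moreover have "K \<subseteq> \<gamma> x" using D(2) that i by (auto simp: fine_def)
        ultimately show ?thesis using i by (auto intro!: exI[of _ u] exI[of _ v])
      qed
      define P where "P = {i\<in>D. fst i \<in> N}"
      have disj: "disjoint_family_on (\<lambda>i. {Inf (snd i)<..<Sup (snd i)}) D"
        unfolding disjoint_family_on_def
      proof (intro ballI impI)
        fix i j assume ij: "i \<in> D" "j \<in> D" "i \<noteq> j"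
        have "interior (snd i) \<inter> interior (snd j) = {}"
          using Dd(5)[of "fst i" "snd i" "fst j" "snd j"] ij by auto
        moreover obtain u v u' v' where "snd i = {u..v}" "snd j = {u'..v'}" "Inf (snd i) = u" "Sup (snd i) = v" "Inf (snd j) = u'" "Sup (snd j) = v'"
          using shape[OF ij(1)] shape[OF ij(2)] by (metis snd_conv)
        ultimately show "{Inf (snd i)<..<Sup (snd i)} \<inter> {Inf (snd j)<..<Sup (snd j)} = {}"
          by (simp add: interior_atLeastAtMost_real)
      qed
      have P: "finite P" "P \<subseteq> D" using fin by (auto simp: P_def)
      have disjP: "disjoint_family_on (\<lambda>i. {Inf (snd i)<..<Sup (snd i)}) P"
        using disj P(2) by (rule disjoint_family_on_mono[rotated])
      have bad: "(\<Sum>i\<in>P. \<bar>F (Sup (snd i)) - F (Inf (snd i))\<bar>) < e / 2"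
      proof (rule dP[rule_format, OF P(1) _ disjP])
        fix i assume "i \<in> P"
        then show "Inf (snd i) \<le> Sup (snd i) \<and> {Inf (snd i)..Sup (snd i)} \<subseteq> {a..b}"
          using shape[of i] P by auto
      next
        have "(\<Sum>i\<in>P. Sup (snd i) - Inf (snd i)) \<le> measure lebesgue U"
        proof (rule sum_length_le_measure[OF P(1) _ disjP Um])
          fix i assume i: "i \<in> P"
          then obtain u v where uv: "u \<le> v" "{u..v} \<subseteq> \<gamma> (fst i)" "Inf (snd i) = u" "Sup (snd i) = v"
            using shape[of i] P by force
          moreover have "\<gamma> (fst i) \<subseteq> U" using \<gamma>(3) i by (auto simp: P_def)
          ultimately show "Inf (snd i) \<le> Sup (snd i) \<and> {Inf (snd i)<..<Sup (snd i)} \<subseteq> U"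
            by (auto simp: subset_iff)
        qed
        with Ud show "(\<Sum>i\<in>P. Sup (snd i) - Inf (snd i)) < d" by simp
      qed
      have good: "(\<Sum>i\<in>D - P. \<bar>F (Sup (snd i)) - F (Inf (snd i)) - measure lborel (snd i) * g (fst i)\<bar>) \<le> e' * (b - a)"
      proof -
        have "(\<Sum>i\<in>D - P. \<bar>F (Sup (snd i)) - F (Inf (snd i)) - measure lborel (snd i) * g (fst i)\<bar>) \<le> (\<Sum>i\<in>D - P. e' * (Sup (snd i) - Inf (snd i)))"
        proof (rule sum_mono)
          fix i assume i: "i \<in> D - P"
          then obtain u v where uv: "i = (fst i, {u..v})" "u \<le> fst i" "fst i \<le> v" "{u..v} \<subseteq> {a..b}" "Inf (snd i) = u" "Sup (snd i) = v"
             "u \<in> \<gamma> (fst i)" "v \<in> \<gamma> (fst i)"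
            using shape[of i] by auto
          have "fst i \<in> {a..b} - N" using i uv by (auto simp: P_def)
          from \<gamma>4[OF this uv(2,3,7,8)] have "\<bar>F v - F u - g (fst i) * (v - u)\<bar> \<le> e' * (v - u)" .
          moreover have "measure lborel (snd i) = v - u" using uv by (metis content_real order_trans snd_conv)
          ultimately show "\<bar>F (Sup (snd i)) - F (Inf (snd i)) - measure lborel (snd i) * g (fst i)\<bar> \<le> e' * (Sup (snd i) - Inf (snd i))"
            using uv by (simp add: mult.commute)
        qed
        also have "\<dots> = e' * (\<Sum>i\<in>D - P. (Sup (snd i) - Inf (snd i)))" by (simp add: sum_distrib_left)
        also have "(\<Sum>i\<in>D - P. (Sup (snd i) - Inf (snd i))) \<le> measure lebesgue {a..b}"
        proof (rule sum_length_le_measure)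
          show "disjoint_family_on (\<lambda>i. {Inf (snd i)<..<Sup (snd i)}) (D - P)"
            by (rule disjoint_family_on_mono[OF _ disj]) auto
          fix i assume "i \<in> D - P"
          then show "Inf (snd i) \<le> Sup (snd i) \<and> {Inf (snd i)<..<Sup (snd i)} \<subseteq> {a..b}"
            using shape[of i] by (auto simp: subset_iff)
        qed (use fin in auto)
        also have "measure lebesgue {a..b} = b - a" using ab by simp
        finally show ?thesis using e' by simp
      qed
      have "(\<Sum>(x, k)\<in>D. measure lborel k *\<^sub>R g' x) - (F b - F a) =
         (\<Sum>i\<in>D. measure lborel (snd i) * g' (fst i) - (F (Sup (snd i)) - F (Inf (snd i))))"
        using additive_tagged_division_1[OF ab, of D F] D(1) by (simp add: sum_subtractf case_prod_beta)
      also have "\<dots> = (\<Sum>i\<in>P. - (F (Sup (snd i)) - F (Inf (snd i)))) +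
          (\<Sum>i\<in>D-P. measure lborel (snd i) * g (fst i) - (F (Sup (snd i)) - F (Inf (snd i))))"
      proof -
        have "(\<Sum>i\<in>D-P. measure lborel (snd i) * g' (fst i) - (F (Sup (snd i)) - F (Inf (snd i)))) =
          (\<Sum>i\<in>D-P. measure lborel (snd i) * g (fst i) - (F (Sup (snd i)) - F (Inf (snd i))))"
          by (rule sum.cong) (auto simp: P_def g'_def)
        moreover have "(\<Sum>i\<in>P. measure lborel (snd i) * g' (fst i) - (F (Sup (snd i)) - F (Inf (snd i)))) =
          (\<Sum>i\<in>P. - (F (Sup (snd i)) - F (Inf (snd i))))"
          by (rule sum.cong) (auto simp: P_def g'_def)
        ultimately show ?thesis
          using sum.subset_diff[OF P(2) fin, of "\<lambda>i. measure lborel (snd i) * g' (fst i) - (F (Sup (snd i)) - F (Inf (snd i)))"] by simp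
      qed
      finally have eq: "(\<Sum>(x, k)\<in>D. measure lborel k *\<^sub>R g' x) - (F b - F a) =
         (\<Sum>i\<in>P. - (F (Sup (snd i)) - F (Inf (snd i)))) +
          (\<Sum>i\<in>D-P. measure lborel (snd i) * g (fst i) - (F (Sup (snd i)) - F (Inf (snd i))))" .
      have le1: "\<bar>\<Sum>i\<in>P. - (F (Sup (snd i)) - F (Inf (snd i)))\<bar> \<le> (\<Sum>i\<in>P. \<bar>F (Sup (snd i)) - F (Inf (snd i))\<bar>)"
        using sum_abs[of "\<lambda>i. - (F (Sup (snd i)) - F (Inf (snd i)))" P] by (simp add: abs_minus_commute)
      have le2: "\<bar>\<Sum>i\<in>D-P. measure lborel (snd i) * g (fst i) - (F (Sup (snd i)) - F (Inf (snd i)))\<bar> \<le> (\<Sum>i\<in>D-P. \<bar>F (Sup (snd i)) - F (Inf (snd i)) - measure lborel (snd i) * g (fst i)\<bar>)"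
        using sum_abs[of "\<lambda>i. measure lborel (snd i) * g (fst i) - (F (Sup (snd i)) - F (Inf (snd i)))" "D-P"] by (simp add: abs_minus_commute)
      have comb: "\<bar>B + C\<bar> < e" if "\<bar>B\<bar> \<le> x" "\<bar>C\<bar> \<le> y" "x < e / 2" "y \<le> e' * (b - a)" for B C x y
        using that e'(2) by linarith
      show ?thesis unfolding eq real_norm_def by (rule comb[OF le1 le2 bad good])
    qed
    show "\<exists>\<gamma>. gauge \<gamma> \<and> (\<forall>D. D tagged_division_of cbox a b \<and> \<gamma> fine D \<longrightarrow>
        norm ((\<Sum>(x, k)\<in>D. measure lborel k *\<^sub>R g' x) - (F b - F a)) < e)" using gg fine by (intro exI[of _ \<gamma>]) simp
  qed
  then have "(g' has_integral F b - F a) {a..b}" by simp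
  then show ?thesis
    by (rule has_integral_spike[OF \<open>negligible N\<close>, rotated]) (auto simp: g'_def)
qed

text \<open>Serves to carry absolute continuity from
  \<open>y'\<^sup>(\<^sup>p\<^sup>-\<^sup>1\<^sup>)\<close>, where it is given, to functions of the
  Riccati variable. \<open>A\<close> and \<open>B\<close> may have any sign; the proof enlarges them
  to numbers that are at least 1 and can be divided by.\<close>

lemma abs_continuous_on_dominated:
  fixes F z :: "real \<Rightarrow> real"
  assumes z: "abs_continuous_on S z"
    and F: "\<And>s t. s \<in> S \<Longrightarrow> t \<in> S \<Longrightarrow> s \<le> t \<Longrightarrow> \<bar>F t - F s\<bar> \<le> A * \<bar>z t - z s\<bar> + B * (t - s)"
  shows "abs_continuous_on S F"
  unfolding abs_continuous_on_def
proof (intro allI impI)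
  fix e :: real assume "e > 0"
  define A' B' where "A' = \<bar>A\<bar> + 1" and "B' = \<bar>B\<bar> + 1"
  have pos: "A' > 0" "B' > 0" by (auto simp: A'_def B'_def)
  have "e / (2 * A') > 0" using \<open>e > 0\<close> pos by simp
  from z[unfolded abs_continuous_on_def, rule_format, OF this]
  obtain d where d: "d > 0" and dN: "\<forall>(N::nat) a b. (\<forall>k<N. a k \<le> b k \<and> {a k..b k} \<subseteq> S) \<longrightarrow>
        disjoint_family_on (\<lambda>k. {a k<..<b k}) {..<N} \<longrightarrow>
        (\<Sum>k<N. b k - a k) < d \<longrightarrow> (\<Sum>k<N. \<bar>z (b k) - z (a k)\<bar>) < e / (2 * A')"
    by (elim exE conjE) (rule that)
  show "\<exists>\<delta>>0. \<forall>N a b. (\<forall>k<N::nat. a k \<le> b k \<and> {a k..b k} \<subseteq> S) \<longrightarrow>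
      disjoint_family_on (\<lambda>k. {a k<..<b k}) {..<N} \<longrightarrow>
      (\<Sum>k<N. b k - a k) < \<delta> \<longrightarrow> (\<Sum>k<N. \<bar>F (b k) - F (a k)\<bar>) < e"
  proof (intro exI[of _ "min d (e / (2 * B'))"] conjI allI impI)
    show "min d (e / (2 * B')) > 0" using d pos \<open>e > 0\<close> by auto
  next
    fix N :: nat and a b :: "nat \<Rightarrow> real"
    assume h: "\<forall>k<N. a k \<le> b k \<and> {a k..b k} \<subseteq> S" "disjoint_family_on (\<lambda>k. {a k<..<b k}) {..<N}"
      "(\<Sum>k<N. b k - a k) < min d (e / (2 * B'))"
    have "(\<Sum>k<N. \<bar>F (b k) - F (a k)\<bar>) \<le> (\<Sum>k<N. A' * \<bar>z (b k) - z (a k)\<bar> + B' * (b k - a k))"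
    proof (rule sum_mono)
      fix k assume "k \<in> {..<N}"
      then have k: "a k \<le> b k" "{a k..b k} \<subseteq> S" using h(1) by auto
      then have "\<bar>F (b k) - F (a k)\<bar> \<le> A * \<bar>z (b k) - z (a k)\<bar> + B * (b k - a k)"
        by (intro F) auto
      also have "\<dots> \<le> A' * \<bar>z (b k) - z (a k)\<bar> + B' * (b k - a k)"
        using k by (intro add_mono mult_right_mono) (auto simp: A'_def B'_def)
      finally show "\<bar>F (b k) - F (a k)\<bar> \<le> A' * \<bar>z (b k) - z (a k)\<bar> + B' * (b k - a k)" .
    qed
    also have "\<dots> = A' * (\<Sum>k<N. \<bar>z (b k) - z (a k)\<bar>) + B' * (\<Sum>k<N. b k - a k)"
      by (simp add: sum.distrib sum_distrib_left)
    also have "\<dots> < A' * (e / (2 * A')) + B' * (e / (2 * B'))"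
      using pos dN[rule_format, OF h(1)[rule_format] h(2)] h(3) by (intro add_strict_mono mult_strict_left_mono) auto
    also have "\<dots> = e" using pos by simp
    finally show "(\<Sum>k<N. \<bar>F (b k) - F (a k)\<bar>) < e" .
  qed
qed

lemma abs_continuous_on_imp_continuous_on:
  assumes "abs_continuous_on {a..b} F"
  shows "continuous_on {a..b} F"
  unfolding continuous_on_iff
proof (intro ballI allI impI)
  fix x e :: real assume x: "x \<in> {a..b}" and e: "e > 0"
  from assms[unfolded abs_continuous_on_def, rule_format, OF e]
  obtain d where "d > 0" and dN: "\<forall>(N::nat) l r. (\<forall>k<N. l k \<le> r k \<and> {l k..r k} \<subseteq> {a..b}) \<longrightarrow>
        disjoint_family_on (\<lambda>k. {l k<..<r k}) {..<N} \<longrightarrow>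
        (\<Sum>k<N. r k - l k) < d \<longrightarrow> (\<Sum>k<N. \<bar>F (r k) - F (l k)\<bar>) < e"
    by (elim exE conjE) (rule that)
  have "dist (F t) (F x) < e" if t: "t \<in> {a..b}" "dist t x < d" for t
  proof -
    have "(\<Sum>k<1::nat. \<bar>F (max t x) - F (min t x)\<bar>) < e"
      using t x by (intro dN[rule_format]) (auto simp: dist_real_def disjoint_family_on_def)
    then show ?thesis
      by (cases "t \<le> x") (auto simp: dist_real_def max_def min_def abs_minus_commute)
  qed
  with \<open>d > 0\<close> show "\<exists>d>0. \<forall>x'\<in>{a..b}. dist x' x < d \<longrightarrow> dist (F x') (F x) < e" by blast
qed

section \<open>Lebesgue points\<close>

text \<open>No maximal function is used. By Henstock's lemma the errors
  \<open>\<bar>f x * (v - u) - integral {u..v} f\<bar>\<close> over a fine partial division add up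
  to little, while every bad interval contributes more than \<open>e * (v - u)\<close>. Disjoint bad
  intervals therefore have small total length, and Vitali's covering lemma recovers the whole set at
  the cost of a factor 5, which explains the bound \<open>\<epsilon> * e / 5\<close>. The intervals
  need not be centred at \<open>x\<close>, as suits nodal cells.\<close>

lemma negligible_not_differentiation_point:
  fixes f :: "real \<Rightarrow> real"
  assumes f: "f integrable_on {a..b}" and e: "e > 0"
  shows "negligible {x\<in>{a<..<b}. \<forall>d>0. \<exists>u v. u \<le> x \<and> x \<le> v \<and> u < v \<and> v - u < d \<and>
            \<bar>integral {u..v} f - f x * (v - u)\<bar> > e * (v - u)}" (is "negligible ?E")
  unfolding negligible_outer_le
proof (intro allI impI)
  fix \<epsilon> :: real assume "\<epsilon> > 0"
  then have pos: "\<epsilon> * e / 5 > 0" using e by simp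
  have f': "f integrable_on cbox a b" using f by simp
  obtain \<gamma> where "gauge \<gamma>" and \<gamma>: "\<And>p. \<lbrakk>p tagged_partial_division_of (cbox a b); \<gamma> fine p\<rbrakk> \<Longrightarrow>
             sum (\<lambda>(x,k). norm(measure lborel k *\<^sub>R f x - integral k f)) p < \<epsilon> * e / 5"
    using Henstock_lemma[OF f' pos] by blast
  \<comment> \<open>Each bad interval keeps its tag \<open>x\<close> for the division;
    \<open>v - u < 1\<close> bounds the radii, as Vitali's lemma requires.\<close>
  define I where "I = {(x,u,v). u \<le> x \<and> x \<le> v \<and> u < v \<and> v - u < 1 \<and> {u..v} \<subseteq> \<gamma> x \<and> {u..v} \<subseteq> {a..b} \<and>
            \<bar>integral {u..v} f - f x * (v - u)\<bar> > e * (v - u)}"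
  define c r where "c = (\<lambda>(x::real,u,v). (u + v) / 2 :: real)" and "r = (\<lambda>(x::real,u,v). (v - u) / 2 :: real)"
  have ball: "cball (c i) (r i) = {fst (snd i)..snd (snd i)}" for i
    by (cases i) (auto simp: c_def r_def cball_eq_atLeastAtMost field_simps)
  have cov: "?E \<subseteq> (\<Union>i\<in>I. cball (c i) (r i))"
  proof
    fix x assume x: "x \<in> ?E"
    have "open (\<gamma> x \<inter> {a<..<b})" "x \<in> \<gamma> x \<inter> {a<..<b}"
      using \<open>gauge \<gamma>\<close> x by (auto simp: gauge_def)
    then obtain d where d: "d > 0" "ball x d \<subseteq> \<gamma> x \<inter> {a<..<b}"
      by (meson openE)
    have "min d 1 > 0" using d by simp
    then obtain u v where uv: "u \<le> x" "x \<le> v" "u < v" "v - u < min d 1" "\<bar>integral {u..v} f - f x * (v - u)\<bar> > e * (v - u)"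
      using x by blast
    have "{u..v} \<subseteq> ball x d" using uv by (auto simp: dist_real_def)
    then have "{u..v} \<subseteq> \<gamma> x \<inter> {a<..<b}" using d by blast
    then have "{u..v} \<subseteq> \<gamma> x" "{u..v} \<subseteq> {a..b}" by (auto simp del: atLeastatMost_subset_iff)
    then have "(x,u,v) \<in> I" using uv unfolding I_def by auto
    moreover have "x \<in> cball (c (x,u,v)) (r (x,u,v))" using uv by (simp add: ball)
    ultimately show "x \<in> (\<Union>i\<in>I. cball (c i) (r i))" by blast
  qed
  have rI: "0 < r i \<and> r i \<le> 1" if "i \<in> I" for i
    using that by (auto simp: I_def r_def)
  obtain C where C: "countable C" "C \<subseteq> I"
     "pairwise (\<lambda>i j. disjnt (cball (c i) (r i)) (cball (c j) (r j))) C"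
     "?E \<subseteq> (\<Union>i\<in>C. cball (c i) (5 * r i))"
    using Vitali_covering_lemma_cballs[OF cov rI] by blast
  \<comment> \<open>Henstock's lemma speaks of finite divisions, so finite subfamilies are estimated
    first; the bound does not depend on the subfamily and passes to the countable union.\<close>
  have bound: "measure lebesgue (\<Union>i\<in>C'. cball (c i) (5 * r i)) \<le> \<epsilon>" if C': "C' \<subseteq> C" "finite C'" for C'
  proof -
    define h where "h = (\<lambda>i::real\<times>real\<times>real. (fst i, {fst (snd i)..snd (snd i)}))"
    have uv: "fst (snd i) < snd (snd i)" "fst (snd i) \<le> fst i" "fst i \<le> snd (snd i)" "{fst (snd i)..snd (snd i)} \<subseteq> \<gamma> (fst i)" "{fst (snd i)..snd (snd i)} \<subseteq> {a..b}"
        "\<bar>integral {fst (snd i)..snd (snd i)} f - f (fst i) * (snd (snd i) - fst (snd i))\<bar> > e * (snd (snd i) - fst (snd i))"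
        if "i \<in> C'" for i
    proof -
      have "i \<in> I" using that C'(1) C(2) by blast
      then show "fst (snd i) < snd (snd i)" "fst (snd i) \<le> fst i" "fst i \<le> snd (snd i)" "{fst (snd i)..snd (snd i)} \<subseteq> \<gamma> (fst i)" "{fst (snd i)..snd (snd i)} \<subseteq> {a..b}"
        "\<bar>integral {fst (snd i)..snd (snd i)} f - f (fst i) * (snd (snd i) - fst (snd i))\<bar> > e * (snd (snd i) - fst (snd i))"
        unfolding I_def split_beta mem_Collect_eq by blast+
    qed
    have inj: "inj_on h C'"
    proof (rule inj_onI)
      fix i j assume "i \<in> C'" "j \<in> C'" "h i = h j"
      then have "fst i = fst j" "fst (snd i) = fst (snd j) \<and> snd (snd i) = snd (snd j)"
        using uv(1)[of i] uv(1)[of j] by (auto simp: h_def Icc_eq_Icc)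
      then show "i = j" by (simp add: prod_eq_iff)
    qed
    have "sum (\<lambda>(x,k). norm(measure lborel k *\<^sub>R f x - integral k f)) (h ` C') < \<epsilon> * e / 5"
    proof (rule \<gamma>)
      show "h ` C' tagged_partial_division_of cbox a b"
        unfolding tagged_partial_division_of_def
      proof (intro conjI allI impI)
        fix x K assume "(x, K) \<in> h ` C'"
        then obtain i where i: "i \<in> C'" "x = fst i" "K = {fst (snd i)..snd (snd i)}" by (auto simp: h_def)
        show "x \<in> K" "K \<subseteq> cbox a b" using uv[OF i(1)] i by auto
        show "\<exists>a b. K = cbox a b" using i by (metis cbox_interval)
      next
        fix x K x' K' assume *: "(x, K) \<in> h ` C' \<and> (x', K') \<in> h ` C' \<and> (x, K) \<noteq> (x', K')"
        then obtain i j where i: "i \<in> C'" "x = fst i" "K = {fst (snd i)..snd (snd i)}"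
           and j: "j \<in> C'" "x' = fst j" "K' = {fst (snd j)..snd (snd j)}"
          unfolding h_def image_iff prod.inject by blast
        have "i \<noteq> j" using * i j by auto
        then have "disjnt (cball (c i) (r i)) (cball (c j) (r j))"
          using C(3) i(1) j(1) C'(1) by (auto simp: pairwise_def)
        then have "K \<inter> K' = {}" unfolding ball i(3) j(3) disjnt_def .
        then show "interior K \<inter> interior K' = {}" using interior_subset by blast
      qed (use C' in simp)
      show "\<gamma> fine h ` C'" using uv by (auto simp: fine_def h_def)
    qed
    also have "sum (\<lambda>(x,k). norm(measure lborel k *\<^sub>R f x - integral k f)) (h ` C') =
       (\<Sum>i\<in>C'. \<bar>(snd (snd i) - fst (snd i)) * f (fst i) - integral {fst (snd i)..snd (snd i)} f\<bar>)"
    proof (subst sum.reindex[OF inj], rule sum.cong)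
      fix i assume "i \<in> C'"
      then show "((\<lambda>(x,k). norm (measure lborel k *\<^sub>R f x - integral k f)) \<circ> h) i =
          \<bar>(snd (snd i) - fst (snd i)) * f (fst i) - integral {fst (snd i)..snd (snd i)} f\<bar>"
        using uv(1)[of i] by (simp add: h_def)
    qed simp
    finally have "(\<Sum>i\<in>C'. \<bar>(snd (snd i) - fst (snd i)) * f (fst i) - integral {fst (snd i)..snd (snd i)} f\<bar>) < \<epsilon> * e / 5" .
    moreover have "(\<Sum>i\<in>C'. e * (snd (snd i) - fst (snd i))) \<le> (\<Sum>i\<in>C'. \<bar>(snd (snd i) - fst (snd i)) * f (fst i) - integral {fst (snd i)..snd (snd i)} f\<bar>)"
      using uv(6) by (intro sum_mono) (auto simp: abs_minus_commute mult.commute less_imp_le)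
    ultimately have "(\<Sum>i\<in>C'. e * (snd (snd i) - fst (snd i))) < \<epsilon> * e / 5"
      by (rule order.strict_trans1[rotated])
    then have "e * (\<Sum>i\<in>C'. snd (snd i) - fst (snd i)) < e * (\<epsilon> / 5)"
      by (simp only: sum_distrib_left) (simp add: mult.commute)
    then have len: "(\<Sum>i\<in>C'. snd (snd i) - fst (snd i)) \<le> \<epsilon> / 5" using e by simp
    have "measure lebesgue (\<Union>i\<in>C'. cball (c i) (5 * r i)) \<le> (\<Sum>i\<in>C'. measure lebesgue (cball (c i) (5 * r i)))"
      by (rule measure_UNION_le[OF C'(2)]) auto
    also have "\<dots> = (\<Sum>i\<in>C'. 5 * (snd (snd i) - fst (snd i)))"
    proof (rule sum.cong)
      fix i assume "i \<in> C'"
      then show "measure lebesgue (cball (c i) (5 * r i)) = 5 * (snd (snd i) - fst (snd i))"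
        using uv(1)[of i] by (cases i) (simp add: cball_eq_atLeastAtMost r_def c_def field_simps)
    qed simp
    also have "\<dots> = 5 * (\<Sum>i\<in>C'. snd (snd i) - fst (snd i))" by (simp only: sum_distrib_left)
    also have "\<dots> \<le> \<epsilon>" using len by simp
    finally show ?thesis .
  qed
  show "\<exists>T. ?E \<subseteq> T \<and> T \<in> lmeasurable \<and> measure lebesgue T \<le> \<epsilon>"
  proof (intro exI conjI)
    show "(\<Union>i\<in>C. cball (c i) (5 * r i)) \<in> lmeasurable"
      by (rule fmeasurable_UN_bound[OF C(1) _ bound]) auto
    show "measure lebesgue (\<Union>i\<in>C. cball (c i) (5 * r i)) \<le> \<epsilon>"
      by (rule measure_UN_bound[OF C(1) _ bound]) auto
  qed (rule C(4))
qed

definition differentiation_point :: "(real \<Rightarrow> real) \<Rightarrow> real \<Rightarrow> bool" where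
  "differentiation_point f x \<longleftrightarrow> (\<forall>e>0. \<exists>d>0. \<forall>u v. u \<le> x \<longrightarrow> x \<le> v \<longrightarrow> u < v \<longrightarrow> v - u < d \<longrightarrow>
      \<bar>integral {u..v} f - f x * (v - u)\<bar> \<le> e * (v - u))"

lemma AE_differentiation_point:
  assumes "f integrable_on {a..b}"
  shows "AE x in lebesgue. x \<in> {a<..<b} \<longrightarrow> differentiation_point f x"
proof -
  define E where "E e = {x\<in>{a<..<b}. \<forall>d>0. \<exists>u v. u \<le> x \<and> x \<le> v \<and> u < v \<and> v - u < d \<and>
            \<bar>integral {u..v} f - f x * (v - u)\<bar> > e * (v - u)}" for e
  have "negligible (\<Union>n. E (1 / real (Suc n)))"
    unfolding E_def by (intro negligible_Union_nat negligible_not_differentiation_point[OF assms]) simp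
  then have "AE x in lebesgue. x \<notin> (\<Union>n. E (1 / real (Suc n)))"
    by (intro AE_not_in) (simp add: negligible_iff_null_sets)
  then show ?thesis
  proof eventually_elim
    case (elim x)
    show ?case
      unfolding differentiation_point_def
    proof (intro allI impI)
      fix e :: real assume x: "x \<in> {a<..<b}" and "e > 0"
      then obtain n where n: "1 / real (Suc n) < e" using nat_approx_posE by blast
      have "x \<notin> E (1 / real (Suc n))" using elim by auto
      then obtain d where d: "d > 0" "\<And>u v. u \<le> x \<Longrightarrow> x \<le> v \<Longrightarrow> u < v \<Longrightarrow> v - u < d \<Longrightarrow>
          \<bar>integral {u..v} f - f x * (v - u)\<bar> \<le> 1 / real (Suc n) * (v - u)"
        using x unfolding E_def mem_Collect_eq by (meson not_le)
      show "\<exists>d>0. \<forall>u v. u \<le> x \<longrightarrow> x \<le> v \<longrightarrow> u < v \<longrightarrow> v - u < d \<longrightarrow>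
          \<bar>integral {u..v} f - f x * (v - u)\<bar> \<le> e * (v - u)"
      proof (intro exI[of _ d] conjI allI impI d(1))
        fix u v assume uv: "u \<le> x" "x \<le> v" "u < v" "v - u < d"
        have "1 / real (Suc n) * (v - u) \<le> e * (v - u)"
          using n uv by (intro mult_right_mono) auto
        with d(2)[OF uv] show "\<bar>integral {u..v} f - f x * (v - u)\<bar> \<le> e * (v - u)" by linarith
      qed
    qed
  qed
qed

text \<open>Applying the differentiation theorem to \<open>\<bar>f - r\<bar>\<close> for all rational \<open>r\<close> gives Lebesgue points.\<close>

lemma AE_lebesgue_point:
  fixes f :: "real \<Rightarrow> real"
  assumes f: "f absolutely_integrable_on {a..b}"
  shows "AE x in lebesgue. x \<in> {a<..<b} \<longrightarrow> (\<forall>e>0. \<exists>d>0. \<forall>u v. u \<le> x \<longrightarrow> x \<le> v \<longrightarrow> u < v \<longrightarrow> v - u < d \<longrightarrow>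
      integral {u..v} (\<lambda>t. \<bar>f t - f x\<bar>) \<le> e * (v - u))"
proof -
  have int: "(\<lambda>t. \<bar>f t - r\<bar>) integrable_on {a..b}" for r
  proof -
    have "(\<lambda>t. f t - r) absolutely_integrable_on {a..b}"
      by (intro set_integral_diff f) auto
    then show ?thesis by (simp add: absolutely_integrable_on_def)
  qed
  have "AE x in lebesgue. \<forall>r\<in>\<rat>. x \<in> {a<..<b} \<longrightarrow> differentiation_point (\<lambda>t. \<bar>f t - r\<bar>) x"
    by (subst AE_ball_countable[OF countable_rat]) (intro ballI AE_differentiation_point int)
  then show ?thesis
  proof eventually_elim
    case (elim x)
    show ?case
    proof (intro allI impI)
      fix e :: real assume x: "x \<in> {a<..<b}" and e: "e > 0"
      then obtain r where r: "r \<in> \<rat>" "f x < r" "r < f x + e / 3"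
        using Rats_dense_in_real[of "f x" "f x + e / 3"] by auto
      have dp: "differentiation_point (\<lambda>t. \<bar>f t - r\<bar>) x" using elim x r by blast
      have "e / 3 > 0" using e by simp
      from dp[unfolded differentiation_point_def, THEN spec, THEN mp, OF this]
      obtain d where d: "d > 0" "\<forall>u v. u \<le> x \<longrightarrow> x \<le> v \<longrightarrow> u < v \<longrightarrow> v - u < d \<longrightarrow>
          \<bar>integral {u..v} (\<lambda>t. \<bar>f t - r\<bar>) - \<bar>f x - r\<bar> * (v - u)\<bar> \<le> e / 3 * (v - u)"
        by (elim exE conjE) (rule that)
      define d' where "d' = min d (min (x - a) (b - x))"
      have "integral {u..v} (\<lambda>t. \<bar>f t - f x\<bar>) \<le> e * (v - u)"
        if uv: "u \<le> x" "x \<le> v" "u < v" "v - u < d'" for u v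
      proof -
        have "{u..v} \<subseteq> {a..b}" using uv by (auto simp: d'_def)
        then have int': "(\<lambda>t. \<bar>f t - r\<bar>) integrable_on {u..v}" for r
          using int integrable_on_subinterval by blast
        \<comment> \<open>The three thirds of \<open>e\<close> come from replacing
          \<open>f x\<close> by \<open>r\<close> in the integrand, from the differentiation error of
          \<open>\<bar>f t - r\<bar>\<close>, and from the value \<open>\<bar>f x - r\<bar>\<close>
          itself.\<close>
        have "integral {u..v} (\<lambda>t. \<bar>f t - f x\<bar>) \<le> integral {u..v} (\<lambda>t. \<bar>f t - r\<bar> + e / 3)"
          using r by (intro integral_le integrable_add int' integrable_on_const) auto
        also have "\<dots> = integral {u..v} (\<lambda>t. \<bar>f t - r\<bar>) + e / 3 * (v - u)"
          using uv by (subst integral_add) (auto intro: int')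
        also have "\<dots> \<le> \<bar>f x - r\<bar> * (v - u) + e / 3 * (v - u) + e / 3 * (v - u)"
          using d(2)[rule_format, OF uv(1-3)] uv(4) unfolding d'_def by linarith
        also have "\<bar>f x - r\<bar> * (v - u) \<le> e / 3 * (v - u)"
          using r uv by (intro mult_right_mono) auto
        finally show ?thesis by (simp add: field_simps)
      qed
      moreover have "d' > 0" using d x by (simp add: d'_def)
      ultimately show "\<exists>d>0. \<forall>u v. u \<le> x \<longrightarrow> x \<le> v \<longrightarrow> u < v \<longrightarrow> v - u < d \<longrightarrow>
        integral {u..v} (\<lambda>t. \<bar>f t - f x\<bar>) \<le> e * (v - u)" by blast
    qed
  qed
qed

section \<open>The Riccati variable\<close>

lemma spow_0 [simp]: "spow r 0 = 0"
  by (simp add: spow_def)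

lemma spow_eq_0_iff [simp]: "spow r u = 0 \<longleftrightarrow> u = 0"
  by (auto simp: spow_def sgn_0_0)

lemma abs_spow: "\<bar>spow r u\<bar> = \<bar>u\<bar> powr r"
  by (auto simp: spow_def abs_mult sgn_real_def)

lemma sgn_spow [simp]: "sgn (spow r u) = sgn u"
  by (cases "u = 0") (simp_all add: spow_def sgn_mult)

lemma spow_spow: "spow s (spow r u) = spow (r * s) u"
  by (simp add: spow_def[of s] abs_spow powr_powr) (simp add: spow_def)

lemma spow_1 [simp]: "spow 1 u = u"
  by (auto simp: spow_def abs_mult_sgn)

lemma spow_divide: "spow r (a / b) = spow r a / spow r b"
proof -
  have "\<bar>a / b\<bar> powr r = \<bar>a\<bar> powr r / \<bar>b\<bar> powr r" by (simp only: abs_divide powr_divide abs_ge_zero)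
  moreover have "sgn (a / b) = sgn a / sgn b" by (simp only: sgn_divide)
  ultimately show ?thesis unfolding spow_def by (simp only: times_divide_times_eq)
qed

lemma spow_uminus: "spow (- r) u = inverse (spow r u)"
  by (auto simp: spow_def powr_minus sgn_real_def)

lemma DERIV_spow:
  assumes "u \<noteq> 0"
  shows "(spow r has_real_derivative r * \<bar>u\<bar> powr (r - 1)) (at u)"
proof (cases "u > 0")
  case True
  have "((\<lambda>x. x powr r) has_real_derivative r * u powr (r - 1)) (at u)"
    using True by (rule has_real_derivative_powr)
  then show ?thesis
    using True by (subst DERIV_cong_ev[OF refl _ refl, of _ "\<lambda>x. x powr r"])
      (auto simp: spow_def intro!: eventually_mono[OF eventually_gt_at_top] eventually_nhds_in_open[of "{0<..}", THEN eventually_mono])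
next
  case False
  then have u: "u < 0" using assms by simp
  have "((\<lambda>x. - ((- x) powr r)) has_real_derivative r * (-u) powr (r - 1)) (at u)"
    using u by (auto intro!: derivative_eq_intros)
  then show ?thesis
    using u by (subst DERIV_cong_ev[OF refl _ refl, of _ "\<lambda>x. - ((- x) powr r)"])
      (auto simp: spow_def intro!: eventually_nhds_in_open[of "{..<0}", THEN eventually_mono])
qed

lemma spow_mono: "r \<ge> 0 \<Longrightarrow> u \<le> v \<Longrightarrow> spow r u \<le> spow r v"
  by (auto simp: spow_def sgn_real_def intro!: powr_mono2)
    (smt (verit) powr_ge_zero)+

lemma continuous_on_spow [continuous_intros]:
  assumes "r > 0" "continuous_on S f"
  shows "continuous_on S (\<lambda>x. spow r (f x))"
proof -
  have "isCont (spow r) u" for u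
  proof (cases "u = 0")
    case True
    have "((\<lambda>x. \<bar>x\<bar> powr r) \<longlongrightarrow> \<bar>0::real\<bar> powr r) (at 0)"
      using \<open>r > 0\<close> by (intro tendsto_powr' tendsto_intros) auto
    then have "((\<lambda>x. \<bar>spow r x\<bar>) \<longlongrightarrow> 0) (at 0)"
      by (simp add: abs_spow)
    then show ?thesis
      using True by (simp add: isCont_def tendsto_rabs_zero_iff)
  qed (use DERIV_spow DERIV_isCont in blast)
  then have "continuous_on UNIV (spow r)" by (simp add: continuous_on_eq_continuous_at)
  then show ?thesis
    using continuous_on_compose2 assms(2) by (metis subset_UNIV)
qed

text \<open>At a zero of \<open>y\<close> division by zero makes the value 0. This is harmless: such
  points are isolated ends of nodal cells, where only one-sided limits matter.\<close>

definition riccati :: "real \<Rightarrow> (real \<Rightarrow> real) \<Rightarrow> real \<Rightarrow> real" where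
  "riccati p y t = spow (p - 1) (deriv y t / y t)"

locale plap =
  fixes p :: real and q :: "real \<Rightarrow> real" and l :: real and y :: "real \<Rightarrow> real"
  assumes p: "p > 1" and sol: "plap_solution p q l y"
    and q: "q absolutely_integrable_on {0..1}"
begin

abbreviation "p' \<equiv> p / (p - 1)"
abbreviation "u \<equiv> riccati p y"

lemma deriv_y: "(y has_real_derivative deriv y t) (at t)"
  using sol by (simp add: plap_solution_def DERIV_deriv_iff_real_differentiable)

lemma continuous_y: "continuous_on S y"
  using deriv_y DERIV_isCont continuous_at_imp_continuous_on by blast

text \<open>Continuity is known for the signed power of \<open>y'\<close> only; the inverse signed
  power, with exponent \<open>1 / (p - 1)\<close>, transfers it to \<open>y'\<close>.\<close>

lemma continuous_deriv_y: "continuous_on {a..b} (deriv y)"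
proof -
  have c: "continuous_on {a..b} (\<lambda>t. spow (p - 1) (deriv y t))"
    using sol abs_continuous_on_imp_continuous_on
    by (auto simp: plap_solution_def locally_abs_continuous_def)
  have "continuous_on {a..b} (\<lambda>t. spow (1 / (p - 1)) (spow (p - 1) (deriv y t)))"
    using p by (intro continuous_on_spow[OF _ c]) simp
  moreover have "spow (1 / (p - 1)) (spow (p - 1) x) = x" for x
    using p by (simp add: spow_spow)
  ultimately show ?thesis by simp
qed

lemma isCont_deriv_y: "isCont (deriv y) t"
  using continuous_deriv_y[of "t - 1" "t + 1"] continuous_on_interior[of "{t - 1..t + 1}" "deriv y" t]
  by (simp add: interior_atLeastAtMost_real)

lemma abs_riccati: "\<bar>u t\<bar> powr p' = \<bar>deriv y t / y t\<bar> powr p"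
  using p by (simp add: riccati_def abs_spow powr_powr)

lemma spow_riccati: "spow (1 / (p - 1)) (u t) = deriv y t / y t"
  using p by (simp add: riccati_def spow_spow)

text \<open>Away from zeros of \<open>y\<close>, \<open>u\<close> is the product of
  \<open>z = y'\<^sup>(\<^sup>p\<^sup>-\<^sup>1\<^sup>)\<close>, which is absolutely continuous, and
  of a signed power \<open>w\<close> of \<open>y\<close>, which is continuously differentiable and
  hence Lipschitz on a compact interval. The product rule for increments gives the estimate, in the
  form that \<open>abs_continuous_on_dominated\<close> takes.\<close>

lemma abs_continuous_riccati:
  assumes ab: "a \<le> b" and nz: "\<And>t. t \<in> {a..b} \<Longrightarrow> y t \<noteq> 0"
  obtains A B where "\<And>s t. s \<in> {a..b} \<Longrightarrow> t \<in> {a..b} \<Longrightarrow> s \<le> t \<Longrightarrow>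
     \<bar>u t - u s\<bar> \<le> A * \<bar>spow (p - 1) (deriv y t) - spow (p - 1) (deriv y s)\<bar> + B * (t - s)"
proof -
  define z where "z t = spow (p - 1) (deriv y t)" for t
  define w where "w t = spow (-(p - 1)) (y t)" for t
  have u_eq: "u t = z t * w t" for t
    unfolding riccati_def spow_divide z_def w_def spow_uminus by (rule divide_inverse)
  have cz: "continuous_on {a..b} z"
    unfolding z_def using p by (intro continuous_intros continuous_deriv_y) auto
  have dw: "(w has_real_derivative -(p - 1) * \<bar>y t\<bar> powr (-p) * deriv y t) (at t)" if "t \<in> {a..b}" for t
    using DERIV_chain2[OF DERIV_spow[OF nz[OF that], of "-(p-1)"] deriv_y] by (simp add: w_def[abs_def])
  have cw: "continuous_on {a..b} w"
    using dw DERIV_isCont continuous_at_imp_continuous_on by blast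
  have cdw: "continuous_on {a..b} (\<lambda>t. -(p - 1) * \<bar>y t\<bar> powr (-p) * deriv y t)"
    using nz by (intro continuous_intros continuous_y continuous_deriv_y) auto
  have bdd: "\<exists>B. \<forall>t\<in>{a..b}. \<bar>f t\<bar> \<le> B" if "continuous_on {a..b} f" for f :: "real \<Rightarrow> real"
  proof -
    have "bounded (f ` {a..b})" using compact_continuous_image[OF that] compact_imp_bounded by blast
    then show ?thesis by (auto simp: bounded_iff)
  qed
  obtain M1 M2 M3 where M: "\<forall>t\<in>{a..b}. \<bar>z t\<bar> \<le> M1" "\<forall>t\<in>{a..b}. \<bar>w t\<bar> \<le> M2"
     "\<forall>t\<in>{a..b}. \<bar>-(p - 1) * \<bar>y t\<bar> powr (-p) * deriv y t\<bar> \<le> M3"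
    using bdd[OF cz] bdd[OF cw] bdd[OF cdw] by blast
  show ?thesis
  proof (rule that)
    fix s t assume st: "s \<in> {a..b}" "t \<in> {a..b}" "s \<le> t"
    have "M1 \<ge> 0" "M2 \<ge> 0" using M(1,2) st(1) abs_ge_zero order_trans by blast+
    have "norm (w t - w s) \<le> M3 * norm (t - s)"
    proof (rule field_differentiable_bound[of "{a..b}" w])
      show "(w has_field_derivative -(p - 1) * \<bar>y x\<bar> powr (-p) * deriv y x) (at x within {a..b})" if "x \<in> {a..b}" for x
        using dw[OF that] by (rule has_field_derivative_at_within)
      show "norm (-(p - 1) * \<bar>y x\<bar> powr (-p) * deriv y x) \<le> M3" if "x \<in> {a..b}" for x
        using M(3) that by simp
    qed (use st in auto)
    then have 1: "\<bar>w t - w s\<bar> \<le> M3 * (t - s)" using st by simp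
    have "u t - u s = w t * (z t - z s) + z s * (w t - w s)" by (simp add: u_eq algebra_simps)
    then have "\<bar>u t - u s\<bar> \<le> \<bar>w t\<bar> * \<bar>z t - z s\<bar> + \<bar>z s\<bar> * \<bar>w t - w s\<bar>"
      by (metis abs_mult abs_triangle_ineq)
    also have "\<dots> \<le> M2 * \<bar>z t - z s\<bar> + M1 * (M3 * (t - s))"
      using M st 1 \<open>M1 \<ge> 0\<close> \<open>M2 \<ge> 0\<close> by (intro add_mono mult_mono mult_right_mono) auto
    finally show "\<bar>u t - u s\<bar> \<le> M2 * \<bar>spow (p - 1) (deriv y t) - spow (p - 1) (deriv y s)\<bar> + (M1 * M3) * (t - s)"
      by (simp add: z_def)
  qed
qed

lemma deriv_riccati:
  assumes "y t \<noteq> 0"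
    and "((\<lambda>t. spow (p - 1) (deriv y t)) has_real_derivative
           - ((p - 1) * (l - q t) * spow (p - 1) (y t))) (at t)"
  shows "(u has_real_derivative -(p - 1) * (l - q t + \<bar>u t\<bar> powr p')) (at t)"
proof -
  have "(u has_real_derivative (- ((p - 1) * (l - q t) * spow (p - 1) (y t)) * spow (p - 1) (y t) -
       spow (p - 1) (deriv y t) * ((p - 1) * \<bar>y t\<bar> powr (p - 1 - 1) * deriv y t)) / (spow (p - 1) (y t) * spow (p - 1) (y t))) (at t)"
    unfolding riccati_def[abs_def] spow_divide
    using assms by (intro DERIV_divide DERIV_chain2[OF DERIV_spow deriv_y]) auto
  also have "(- ((p - 1) * (l - q t) * spow (p - 1) (y t)) * spow (p - 1) (y t) -
       spow (p - 1) (deriv y t) * ((p - 1) * \<bar>y t\<bar> powr (p - 1 - 1) * deriv y t)) / (spow (p - 1) (y t) * spow (p - 1) (y t))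
     = - (p - 1) * (l - q t + (spow (p - 1) (deriv y t) * deriv y t) * \<bar>y t\<bar> powr (p - 1 - 1) / (spow (p - 1) (y t) * spow (p - 1) (y t)))"
    using assms(1) by (simp add: field_simps)
  also have "spow (p - 1) (deriv y t) * deriv y t = \<bar>deriv y t\<bar> powr p"
  proof -
    have "spow (p - 1) (deriv y t) * deriv y t = \<bar>deriv y t\<bar> powr (p - 1) * \<bar>deriv y t\<bar>"
      by (auto simp: spow_def sgn_real_def)
    also have "\<dots> = \<bar>deriv y t\<bar> powr p"
      using powr_mult_base[of "\<bar>deriv y t\<bar>" "p - 1"] by (simp add: mult.commute)
    finally show ?thesis .
  qed
  also have "spow (p - 1) (y t) * spow (p - 1) (y t) = \<bar>y t\<bar> powr (p - 1 - 1) * \<bar>y t\<bar> powr p"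
  proof -
    have "spow (p - 1) (y t) * spow (p - 1) (y t) = \<bar>y t\<bar> powr (p - 1) * \<bar>y t\<bar> powr (p - 1)"
      using assms(1) by (auto simp: spow_def sgn_real_def)
    also have "\<dots> = \<bar>y t\<bar> powr (p - 1 - 1) * \<bar>y t\<bar> powr p"
      by (simp flip: powr_add)
    finally show ?thesis .
  qed
  also have "\<bar>deriv y t\<bar> powr p * \<bar>y t\<bar> powr (p - 1 - 1) / (\<bar>y t\<bar> powr (p - 1 - 1) * \<bar>y t\<bar> powr p) = \<bar>u t\<bar> powr p'"
    using assms(1) by (simp add: abs_riccati powr_divide)
  finally show ?thesis .
qed

text \<open>A test function \<open>K\<close> with bounded derivative is Lipschitz, so
  \<open>K (u t)\<close> inherits absolute continuity and the fundamental theorem applies although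
  the Riccati equation holds only almost everywhere.\<close>

lemma has_integral_riccati:
  assumes ab: "a \<le> b" and nz: "\<And>t. t \<in> {a..b} \<Longrightarrow> y t \<noteq> 0"
    and K: "\<And>s. (K has_real_derivative k s) (at s)" and k: "\<And>s. \<bar>k s\<bar> \<le> B"
  shows "((\<lambda>t. -(p - 1) * k (u t) * (l - q t + \<bar>u t\<bar> powr p')) has_integral K (u b) - K (u a)) {a..b}"
proof -
  obtain A1 A2 where A: "\<And>s t. s \<in> {a..b} \<Longrightarrow> t \<in> {a..b} \<Longrightarrow> s \<le> t \<Longrightarrow>
     \<bar>u t - u s\<bar> \<le> A1 * \<bar>spow (p - 1) (deriv y t) - spow (p - 1) (deriv y s)\<bar> + A2 * (t - s)"
    using abs_continuous_riccati[OF ab nz] by metis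
  have Klip: "\<bar>K s - K r\<bar> \<le> B * \<bar>s - r\<bar>" for s r
    using field_differentiable_bound[of UNIV K k B s r] K k by simp
  have "B \<ge> 0" using k[of 0] by simp
  have "abs_continuous_on {a..b} (\<lambda>t. K (u t))"
  proof (rule abs_continuous_on_dominated)
    show "abs_continuous_on {a..b} (\<lambda>t. spow (p - 1) (deriv y t))"
      using sol by (auto simp: plap_solution_def locally_abs_continuous_def)
    fix s t assume st: "s \<in> {a..b}" "t \<in> {a..b}" "s \<le> t"
    have "\<bar>K (u t) - K (u s)\<bar> \<le> B * \<bar>u t - u s\<bar>" by (rule Klip)
    also have "\<dots> \<le> B * (A1 * \<bar>spow (p - 1) (deriv y t) - spow (p - 1) (deriv y s)\<bar> + A2 * (t - s))"
      using A[OF st] \<open>B \<ge> 0\<close> by (rule mult_left_mono)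
    finally show "\<bar>K (u t) - K (u s)\<bar> \<le> (B * A1) * \<bar>spow (p - 1) (deriv y t) - spow (p - 1) (deriv y s)\<bar> + (B * A2) * (t - s)"
      by (simp add: algebra_simps)
  qed
  moreover have "AE t in lebesgue. t \<in> {a..b} \<longrightarrow>
      ((\<lambda>t. K (u t)) has_real_derivative -(p - 1) * k (u t) * (l - q t + \<bar>u t\<bar> powr p')) (at t)"
  proof -
    have "AE t in lebesgue. ((\<lambda>t. spow (p - 1) (deriv y t)) has_real_derivative
           - ((p - 1) * (l - q t) * spow (p - 1) (y t))) (at t)"
      using sol by (simp add: plap_solution_def)
    then show ?thesis
    proof eventually_elim
      case (elim t)
      show ?case
      proof
        assume "t \<in> {a..b}"
        then have "(u has_real_derivative -(p - 1) * (l - q t + \<bar>u t\<bar> powr p')) (at t)"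
          using deriv_riccati elim nz by blast
        from DERIV_chain2[OF K this] show "((\<lambda>t. K (u t)) has_real_derivative -(p - 1) * k (u t) * (l - q t + \<bar>u t\<bar> powr p')) (at t)"
          by (simp add: mult_ac)
      qed
    qed
  qed
  ultimately show ?thesis
    by (rule fundamental_theorem_of_calculus_abs_continuous[OF _ ab, where F = "\<lambda>t. K (u t)"])
qed

end

text \<open>Applied with \<open>L = ln \<bar>y\<bar>\<close> at a zero \<open>a\<close> of \<open>y\<close>: if \<open>u\<close> were bounded above near \<open>a\<close>, then \<open>L\<close> would
  be bounded below there; and a single large value of \<open>u\<close> spreads to the left because \<open>u\<close> is
  almost decreasing. This avoids uniqueness for the initial value problem at zeros of \<open>y\<close>.\<close>

lemma filterlim_at_top_at_right_of_log_derivative: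
  fixes u L \<phi> :: "real \<Rightarrow> real"
  assumes ab: "a < b"
    and decr: "\<And>s t. a < s \<Longrightarrow> s \<le> t \<Longrightarrow> t < b \<Longrightarrow> u t \<le> u s + C"
    and dL: "\<And>t. a < t \<Longrightarrow> t < b \<Longrightarrow> (L has_real_derivative \<phi> (u t)) (at t)"
    and \<phi>: "mono \<phi>" and L: "filterlim L at_bot (at_right a)"
  shows "filterlim u at_top (at_right a)"
  unfolding filterlim_at_top
proof
  fix Z :: real
  \<comment> \<open>A single value above \<open>Z + C\<close> suffices, since moving to the left
    costs at most \<open>C\<close>.\<close>
  have "\<exists>t. a < t \<and> t < b \<and> u t > Z + C"
  proof (rule ccontr)
    assume "\<not> ?thesis"
    then have le: "u t \<le> Z + C" if "a < t" "t < b" for t using that by force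
    define c where "c = (a + b) / 2"
    have c: "a < c" "c < b" using ab by (auto simp: c_def)
    define m where "m = \<phi> (Z + C)"
    have low: "L s \<ge> L c - \<bar>m\<bar> * (b - a)" if s: "a < s" "s < c" for s
    proof -
      obtain z where z: "s < z" "z < c" "L c - L s = (c - s) * \<phi> (u z)"
        using MVT2[OF s(2), of L "\<lambda>t. \<phi> (u t)"] dL s c by force
      have "\<phi> (u z) \<le> m" unfolding m_def using le[of z] z s c by (intro monoD[OF \<phi>]) auto
      then have "(c - s) * \<phi> (u z) \<le> (c - s) * \<bar>m\<bar>" using s by (intro mult_left_mono) auto
      also have "\<dots> \<le> (b - a) * \<bar>m\<bar>" using s c by (intro mult_right_mono) auto
      finally show ?thesis using z(3) by (simp add: mult.commute)
    qed
    have "eventually (\<lambda>s. L s < L c - \<bar>m\<bar> * (b - a)) (at_right a)"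
      using L by (simp add: filterlim_at_bot_dense)
    moreover have "eventually (\<lambda>s. s \<in> {a<..<c}) (at_right a)"
      by (rule eventually_at_right_real[OF c(1)])
    ultimately have "eventually (\<lambda>s. False) (at_right a)"
      by eventually_elim (use low in fastforce)
    then show False by simp
  qed
  then obtain t where t: "a < t" "t < b" "u t > Z + C" by blast
  have "eventually (\<lambda>s. s \<in> {a<..<t}) (at_right a)"
    by (rule eventually_at_right_real[OF t(1)])
  then show "eventually (\<lambda>s. Z \<le> u s) (at_right a)"
    by eventually_elim (use decr[of _ t] t in force)
qed

text \<open>The reflection \<open>x \<mapsto> - x\<close>, together with a change of sign of
  \<open>u\<close>, preserves almost-decrease and the monotonicity of \<open>\<phi>\<close>, and so
  reduces this to the previous case.\<close>

lemma filterlim_at_bot_at_left_of_log_derivative: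
  fixes u L \<phi> :: "real \<Rightarrow> real"
  assumes ab: "a < b"
    and decr: "\<And>s t. a < s \<Longrightarrow> s \<le> t \<Longrightarrow> t < b \<Longrightarrow> u t \<le> u s + C"
    and dL: "\<And>t. a < t \<Longrightarrow> t < b \<Longrightarrow> (L has_real_derivative \<phi> (u t)) (at t)"
    and \<phi>: "mono \<phi>" and L: "filterlim L at_bot (at_left b)"
  shows "filterlim u at_bot (at_left b)"
proof -
  have "filterlim (\<lambda>x. - u (- x)) at_top (at_right (- b))"
  proof (rule filterlim_at_top_at_right_of_log_derivative)
    show "-b < -a" using ab by simp
    show "- u (- t) \<le> - u (- s) + C" if "-b < s" "s \<le> t" "t < -a" for s t
      using decr[of "-t" "-s"] that by simp
    show "((\<lambda>x. L (- x)) has_real_derivative (\<lambda>s. - \<phi> (- s)) (- u (- t))) (at t)" if "-b < t" "t < -a" for t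
    proof -
      have "(L has_real_derivative \<phi> (u (- t))) (at (- t))" using dL that by simp
      then show ?thesis by (auto simp: DERIV_mirror intro!: derivative_eq_intros)
    qed
    show "mono (\<lambda>s. - \<phi> (- s))" using \<phi> by (simp add: mono_def)
    show "filterlim (\<lambda>x. L (- x)) at_bot (at_right (- b))"
      using L by (simp add: filterlim_at_left_to_right)
  qed
  then show ?thesis
    by (simp add: filterlim_at_left_to_right filterlim_uminus_at_bot)
qed

section \<open>Limits of the Riccati variable at zeros of \<open>y\<close>, and integrals up to the
  zeros\<close>

context plap
begin

text \<open>\<open>ln ((y t)\<^sup>2) / 2\<close> is \<open>ln \<bar>y t\<bar>\<close>, written
  without an absolute value that would have to be differentiated. Its derivative
  \<open>y' / y\<close> is an increasing function of \<open>u\<close>.\<close>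

lemma deriv_ln_y:
  assumes "y t \<noteq> 0"
  shows "((\<lambda>t. ln ((y t)\<^sup>2) / 2) has_real_derivative spow (1 / (p - 1)) (u t)) (at t)"
proof -
  have "((\<lambda>t. (y t)\<^sup>2) has_real_derivative 2 * y t * deriv y t) (at t)"
    by (auto intro!: derivative_eq_intros deriv_y)
  moreover have "(y t)\<^sup>2 > 0" using assms by simp
  ultimately have "((\<lambda>t. ln ((y t)\<^sup>2)) has_real_derivative 1 / (y t)\<^sup>2 * (2 * y t * deriv y t)) (at t)"
    using DERIV_chain2[where f = ln and g = "\<lambda>t. (y t)\<^sup>2", OF DERIV_ln_divide] by blast
  from DERIV_cdivide[OF this, of 2] show ?thesis
    unfolding spow_riccati using assms by (simp add: power2_eq_square)
qed

lemma ln_y_at_bot: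
  assumes "y a = 0" and nz: "eventually (\<lambda>t. y t \<noteq> 0) F" and F: "F \<le> nhds a"
  shows "filterlim (\<lambda>t. ln ((y t)\<^sup>2) / 2) at_bot F"
proof -
  have "(y \<longlongrightarrow> y a) (nhds a)"
    using DERIV_isCont[OF deriv_y, of a] unfolding isCont_def tendsto_at_iff_tendsto_nhds .
  from tendsto_power[OF tendsto_mono[OF F this], of 2] have "((\<lambda>t. (y t)\<^sup>2) \<longlongrightarrow> 0) F"
    using assms(1) by simp
  then have "filterlim (\<lambda>t. (y t)\<^sup>2) (at_right 0) F"
    unfolding filterlim_at using nz by (auto elim: eventually_mono)
  then have "filterlim (\<lambda>t. ln ((y t)\<^sup>2)) at_bot F"
    using filterlim_compose[OF ln_at_0] by blast
  then have "filterlim (\<lambda>t. (1/2) * ln ((y t)\<^sup>2)) at_bot F"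
    by (subst filterlim_tendsto_pos_mult_at_bot_iff[OF tendsto_const]) auto
  then show ?thesis by (simp add: mult.commute)
qed

text \<open>In the Riccati equation the term with \<open>\<bar>u\<bar> powr p'\<close> only lowers
  \<open>u\<close>; all growth comes from \<open>l\<close> and \<open>q\<close>, whose contribution
  over the unit interval is bounded. The equation for \<open>u\<close> itself is the case of the
  identity test function.\<close>

lemma riccati_almost_decreasing:
  assumes st: "0 \<le> s" "s \<le> t" "t \<le> 1" and nz: "\<And>x. x \<in> {s..t} \<Longrightarrow> y x \<noteq> 0"
  shows "u t \<le> u s + (p - 1) * (\<bar>l\<bar> + integral {0..1} (\<lambda>x. \<bar>q x\<bar>))"
proof -
  have "((\<lambda>x. -(p - 1) * 1 * (l - q x + \<bar>u x\<bar> powr p')) has_integral u t - u s) {s..t}"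
    by (rule has_integral_riccati[where B = 1 and K = "\<lambda>x. x"]) (use st nz in auto)
  moreover have int: "(\<lambda>x. \<bar>q x\<bar>) integrable_on {s..t}"
  proof -
    have "(\<lambda>x. \<bar>q x\<bar>) integrable_on {0..1}" using q by (simp add: absolutely_integrable_on_def)
    then show ?thesis by (rule integrable_on_subinterval) (use st in auto)
  qed
  have "((\<lambda>x. (p - 1) * (\<bar>l\<bar> + \<bar>q x\<bar>)) has_integral (p - 1) * ((t - s) * \<bar>l\<bar> + integral {s..t} (\<lambda>x. \<bar>q x\<bar>))) {s..t}"
    using has_integral_const_real[of "\<bar>l\<bar>" s t] st
    by (intro has_integral_mult_right has_integral_add integrable_integral int) auto
  ultimately have "u t - u s \<le> (p - 1) * ((t - s) * \<bar>l\<bar> + integral {s..t} (\<lambda>x. \<bar>q x\<bar>))"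
  proof (rule has_integral_le)
    fix x assume "x \<in> {s..t}"
    have "- (l - q x + \<bar>u x\<bar> powr p') \<le> \<bar>l\<bar> + \<bar>q x\<bar>"
      using powr_ge_zero[of "\<bar>u x\<bar>" p'] by linarith
    then have "(p - 1) * (- (l - q x + \<bar>u x\<bar> powr p')) \<le> (p - 1) * (\<bar>l\<bar> + \<bar>q x\<bar>)"
      using p by (intro mult_left_mono) auto
    then show "-(p - 1) * 1 * (l - q x + \<bar>u x\<bar> powr p') \<le> (p - 1) * (\<bar>l\<bar> + \<bar>q x\<bar>)"
      by (simp add: algebra_simps)
  qed
  also have "\<dots> \<le> (p - 1) * (\<bar>l\<bar> + integral {0..1} (\<lambda>x. \<bar>q x\<bar>))"
  proof -
    have "(t - s) * \<bar>l\<bar> \<le> 1 * \<bar>l\<bar>" using st by (intro mult_right_mono) auto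
    moreover have "integral {s..t} (\<lambda>x. \<bar>q x\<bar>) \<le> integral {0..1} (\<lambda>x. \<bar>q x\<bar>)"
      using q st int by (intro integral_subset_le) (auto simp: absolutely_integrable_on_def)
    ultimately show ?thesis using p by (intro mult_left_mono) auto
  qed
  finally show ?thesis by simp
qed

lemma riccati_at_right:
  assumes ab: "0 \<le> a" "a < b" "b \<le> 1" and nz: "\<And>x. x \<in> {a<..<b} \<Longrightarrow> y x \<noteq> 0" and "y a = 0"
  shows "filterlim u at_top (at_right a)"
proof (rule filterlim_at_top_at_right_of_log_derivative)
  show "a < b" by fact
  show "u t \<le> u s + (p - 1) * (\<bar>l\<bar> + integral {0..1} (\<lambda>x. \<bar>q x\<bar>))" if "a < s" "s \<le> t" "t < b" for s t
    using that ab nz by (intro riccati_almost_decreasing) auto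
  show "((\<lambda>t. ln ((y t)\<^sup>2) / 2) has_real_derivative spow (1 / (p - 1)) (u t)) (at t)" if "a < t" "t < b" for t
    using that nz by (intro deriv_ln_y) auto
  show "mono (spow (1 / (p - 1)))" using p by (intro monoI spow_mono) auto
  show "filterlim (\<lambda>t. ln ((y t)\<^sup>2) / 2) at_bot (at_right a)"
    using \<open>y a = 0\<close>
  proof (rule ln_y_at_bot)
    show "eventually (\<lambda>t. y t \<noteq> 0) (at_right a)"
      using eventually_at_right_real[OF \<open>a < b\<close>] by eventually_elim (rule nz)
  qed (simp add: at_within_def)
qed

lemma riccati_at_left:
  assumes ab: "0 \<le> a" "a < b" "b \<le> 1" and nz: "\<And>x. x \<in> {a<..<b} \<Longrightarrow> y x \<noteq> 0" and "y b = 0"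
  shows "filterlim u at_bot (at_left b)"
proof (rule filterlim_at_bot_at_left_of_log_derivative)
  show "a < b" by fact
  show "u t \<le> u s + (p - 1) * (\<bar>l\<bar> + integral {0..1} (\<lambda>x. \<bar>q x\<bar>))" if "a < s" "s \<le> t" "t < b" for s t
    using that ab nz by (intro riccati_almost_decreasing) auto
  show "((\<lambda>t. ln ((y t)\<^sup>2) / 2) has_real_derivative spow (1 / (p - 1)) (u t)) (at t)" if "a < t" "t < b" for t
    using that nz by (intro deriv_ln_y) auto
  show "mono (spow (1 / (p - 1)))" using p by (intro monoI spow_mono) auto
  show "filterlim (\<lambda>t. ln ((y t)\<^sup>2) / 2) at_bot (at_left b)"
    using \<open>y b = 0\<close>
  proof (rule ln_y_at_bot)
    show "eventually (\<lambda>t. y t \<noteq> 0) (at_left b)"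
      using eventually_at_left_real[OF \<open>a < b\<close>] by eventually_elim (rule nz)
  qed (simp add: at_within_def)
qed

lemma borel_measurable_riccati [measurable]: "u \<in> borel_measurable borel"
proof -
  have [measurable]: "deriv y \<in> borel_measurable borel"
    by (intro borel_measurable_continuous_onI continuous_at_imp_continuous_on) (auto intro: isCont_deriv_y)
  have [measurable]: "y \<in> borel_measurable borel"
    by (intro borel_measurable_continuous_onI continuous_y)
  have [measurable]: "spow (p - 1) \<in> borel_measurable borel"
    using p by (intro borel_measurable_continuous_onI continuous_on_spow) auto
  show ?thesis unfolding riccati_def[abs_def] by measurable
qed

text \<open>The second bound on \<open>k\<close> absorbs the blow-up of
  \<open>\<bar>u\<bar> powr p'\<close> at the ends: the integrand is dominated by
  \<open>B * \<bar>l\<bar> + B * \<bar>q t\<bar> + B\<close>. The open interval is then exhausted by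
  compact ones. Since only limits of \<open>K (u t)\<close> are assumed, the ends may be nodes or
  regular points.\<close>

lemma integral_riccati:
  assumes ab: "0 \<le> a" "a < b" "b \<le> 1" and nz: "\<And>x. x \<in> {a<..<b} \<Longrightarrow> y x \<noteq> 0"
    and K: "\<And>s. (K has_real_derivative k s) (at s)" and k: "\<And>s. \<bar>k s\<bar> \<le> B" "\<And>s. \<bar>k s\<bar> * \<bar>s\<bar> powr p' \<le> B"
    and [measurable]: "k \<in> borel_measurable borel"
    and lim: "((\<lambda>t. K (u t)) \<longlongrightarrow> A1) (at_right a)" "((\<lambda>t. K (u t)) \<longlongrightarrow> A2) (at_left b)"
  shows "set_integrable lebesgue {a<..<b} (\<lambda>t. k (u t) * (l - q t + \<bar>u t\<bar> powr p'))" (is ?int)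
    and "(LINT t:{a<..<b}|lebesgue. k (u t) * (l - q t + \<bar>u t\<bar> powr p')) = (A1 - A2) / (p - 1)" (is ?eq)
proof -
  let ?g = "\<lambda>t. k (u t) * (l - q t + \<bar>u t\<bar> powr p')"
  have qi: "set_integrable lebesgue {a<..<b} q"
    using q by (rule set_integrable_subset) (use ab in auto)
  have qm: "(\<lambda>t. indicator {a<..<b} t * q t) \<in> borel_measurable lebesgue"
    using qi unfolding set_integrable_def by (auto dest: borel_measurable_integrable)
  have leb: "f \<in> borel_measurable lebesgue" if "f \<in> borel_measurable borel" for f :: "real \<Rightarrow> real"
    using measurable_completion[of f lborel borel] that by simp
  have km: "(\<lambda>t. k (u t)) \<in> borel_measurable lebesgue"
    "(\<lambda>t. indicator {a<..<b} t * (k (u t) * (l + \<bar>u t\<bar> powr p'))) \<in> borel_measurable lebesgue"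
    by (rule leb, measurable)+
  show ?int
  proof (rule set_integrable_bound)
    show "set_integrable lebesgue {a<..<b} (\<lambda>t. B * \<bar>l\<bar> + B * \<bar>q t\<bar> + B)"
      using qi by (intro set_integral_add set_integrable_mult_right set_integrable_abs
          absolutely_integrable_on_const) auto
    have "(\<lambda>t. indicator {a<..<b} t * (k (u t) * (l + \<bar>u t\<bar> powr p')) - k (u t) * (indicator {a<..<b} t * q t)) \<in> borel_measurable lebesgue"
      by (intro borel_measurable_diff borel_measurable_times km qm)
    then show "set_borel_measurable lebesgue {a<..<b} ?g"
      unfolding set_borel_measurable_def by (simp add: algebra_simps)
    have "\<bar>?g t\<bar> \<le> B * \<bar>l\<bar> + B * \<bar>q t\<bar> + B" for t
    proof -
      have "\<bar>?g t\<bar> = \<bar>k (u t) * l - k (u t) * q t + k (u t) * \<bar>u t\<bar> powr p'\<bar>"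
        by (simp add: algebra_simps)
      also have "\<dots> \<le> \<bar>k (u t) * l\<bar> + \<bar>k (u t) * q t\<bar> + \<bar>k (u t) * \<bar>u t\<bar> powr p'\<bar>"
        by linarith
      also have "\<dots> = \<bar>k (u t)\<bar> * \<bar>l\<bar> + \<bar>k (u t)\<bar> * \<bar>q t\<bar> + \<bar>k (u t)\<bar> * \<bar>u t\<bar> powr p'"
        by (simp add: abs_mult)
      also have "\<dots> \<le> B * \<bar>l\<bar> + B * \<bar>q t\<bar> + B"
        using k by (intro add_mono mult_right_mono) auto
      finally show ?thesis .
    qed
    then show "AE t in lebesgue. t \<in> {a<..<b} \<longrightarrow> norm (?g t) \<le> norm (B * \<bar>l\<bar> + B * \<bar>q t\<bar> + B)"
      by (intro AE_I2) (auto intro: order_trans[OF _ abs_ge_self])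
  qed
  \<comment> \<open>With \<open>real n + 2\<close> in the denominator both cuts remove at most half
    of the interval, so \<open>c n \<le> d n\<close> already for \<open>n = 0\<close>.\<close>
  define c d where "c n = a + (b - a) / (real n + 2)" and "d n = b - (b - a) / (real n + 2)" for n :: nat
  have cd: "a < c n" "c n \<le> d n" "d n < b" for n
  proof -
    have gen: "a < a + e \<and> a + e \<le> b - e \<and> b - e < b" if "0 < e" "e \<le> (b - a) / 2" for e
      using that by simp
    have "(b - a) / (real n + 2) \<le> (b - a) / 2"
      by (rule divide_left_mono) (use ab in auto)
    moreover have "(b - a) / (real n + 2) > 0" using ab by simp
    ultimately show "a < c n" "c n \<le> d n" "d n < b"
      unfolding c_def d_def using gen by blast+
  qed
  have cd_sub: "{c n..d n} \<subseteq> {a<..<b}" for n using cd[of n] by auto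
  have lim0: "(\<lambda>n. (b - a) / (real n + 2)) \<longlonglongrightarrow> 0" by real_asymp
  have climit: "c \<longlonglongrightarrow> a" "d \<longlonglongrightarrow> b"
    using tendsto_add[OF tendsto_const lim0, of a] tendsto_diff[OF tendsto_const lim0, of b]
    by (simp_all add: c_def[abs_def] d_def[abs_def])
  have "(\<lambda>n. LINT t:{c n..d n}|lebesgue. ?g t) \<longlonglongrightarrow> (LINT t:(\<Union>n. {c n..d n})|lebesgue. ?g t)"
  proof (rule set_integral_cont_up)
    have mono: "(b - a) / (real n + 2) \<le> (b - a) / (real m + 2)" if "m \<le> n" for m n
      using that ab by (intro divide_left_mono) auto
    show "incseq (\<lambda>n. {c n..d n})"
      unfolding incseq_def
    proof (intro allI impI)
      fix m n :: nat assume "m \<le> n"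
      from mono[OF this] show "{c m..d m} \<subseteq> {c n..d n}" by (simp add: c_def d_def)
    qed
    show "set_integrable lebesgue (\<Union>n. {c n..d n}) ?g"
      using \<open>?int\<close>
    proof (rule set_integrable_subset)
      show "(\<Union>n. {c n..d n}) \<subseteq> {a<..<b}"
        by (rule UN_least) (rule cd_sub)
    qed auto
  qed auto
  moreover have "(\<Union>n. {c n..d n}) = {a<..<b}"
  proof -
    have "\<exists>n. x \<in> {c n..d n}" if "x \<in> {a<..<b}" for x
    proof -
      have "eventually (\<lambda>n. c n < x) sequentially" "eventually (\<lambda>n. d n > x) sequentially"
        using order_tendstoD(2)[OF climit(1)] order_tendstoD(1)[OF climit(2)] that by auto
      then have "eventually (\<lambda>n. x \<in> {c n..d n}) sequentially" by eventually_elim auto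
      then show ?thesis using eventually_happens by fastforce
    qed
    then show ?thesis using cd_sub by blast
  qed
  moreover have "(LINT t:{c n..d n}|lebesgue. ?g t) = (K (u (c n)) - K (u (d n))) / (p - 1)" for n
  proof -
    have si: "set_integrable lebesgue {c n..d n} ?g"
      using \<open>?int\<close> by (rule set_integrable_subset) (use cd[of n] in auto)
    have "((\<lambda>t. -(p - 1) * k (u t) * (l - q t + \<bar>u t\<bar> powr p')) has_integral K (u (d n)) - K (u (c n))) {c n..d n}"
      by (rule has_integral_riccati[OF _ _ K k(1)]) (use cd[of n] nz in auto)
    from has_integral_mult_right[OF this, of "- 1 / (p - 1)"]
    have "(?g has_integral (- 1 / (p - 1)) * (K (u (d n)) - K (u (c n)))) {c n..d n}"
      by (rule has_integral_eq[rotated]) (use p in \<open>simp add: field_simps\<close>)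
    moreover have "(?g has_integral (LINT t:{c n..d n}|lebesgue. ?g t)) {c n..d n}"
      using si by (rule has_integral_set_lebesgue)
    ultimately have "(LINT t:{c n..d n}|lebesgue. ?g t) = (- 1 / (p - 1)) * (K (u (d n)) - K (u (c n)))"
      using has_integral_unique by blast
    also have "\<dots> = (K (u (c n)) - K (u (d n))) / (p - 1)" using p by (simp add: field_simps)
    finally show ?thesis .
  qed
  moreover have "(\<lambda>n. (K (u (c n)) - K (u (d n))) / (p - 1)) \<longlonglongrightarrow> (A1 - A2) / (p - 1)"
  proof -
    have "c n \<noteq> a" "d n \<noteq> b" for n using cd[of n] by auto
    then have "filterlim c (at_right a) sequentially" "filterlim d (at_left b) sequentially"
      using climit cd by (auto simp: filterlim_at)
    then show ?thesis
      using lim p by (intro tendsto_intros) (auto intro: filterlim_compose)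
  qed
  ultimately show ?eq using LIMSEQ_unique by force
qed

end

section \<open>The generalised arctangent\<close>

lemma DERIV_inverse_one_plus_abs_powr_antiderivative:
  fixes r :: real
  assumes "r > 1"
  obtains K where "\<And>s. (K has_real_derivative 1 / (1 + \<bar>s\<bar> powr r)) (at s)"
proof -
  have "isCont (\<lambda>s. 1 / (1 + \<bar>s\<bar> powr r)) s" for s
  proof -
    have "1 + \<bar>s\<bar> powr r \<noteq> 0" using powr_ge_zero[of "\<bar>s\<bar>" r] by linarith
    moreover have "isCont (\<lambda>s. \<bar>s\<bar> powr r) s"
      using assms by (intro isCont_def[THEN iffD2] tendsto_powr' tendsto_intros) auto
    ultimately show ?thesis by (intro isCont_divide isCont_add continuous_const) auto
  qed
  then show ?thesis
    using einterval_antiderivative[of "-\<infinity>" "\<infinity>" "\<lambda>s. 1 / (1 + \<bar>s\<bar> powr r)"] that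
    by (auto simp: has_real_derivative_iff_has_vector_derivative)
qed

lemma Beta_reflection:
  fixes x :: real
  assumes "0 < x" "x < 1"
  shows "Beta (1 - x) x = pi / sin (pi * x)"
proof -
  have "complex_of_real (Gamma x * Gamma (1 - x)) = complex_of_real (pi / sin (pi * x))"
    using Gamma_reflection_complex[of "complex_of_real x"]
    by (simp flip: Gamma_complex_of_real sin_of_real)
  then have "Gamma x * Gamma (1 - x) = pi / sin (pi * x)"
    by (simp only: of_real_eq_iff)
  then show ?thesis by (simp add: Beta_def mult.commute)
qed

text \<open>The substitution \<open>t = 1 / (1 + s\<^sup>r)\<close> turns the improper integral of \<open>1 / (1 + s\<^sup>r)\<close> over
  \<open>(0, \<infinity>)\<close> into \<open>Beta (1 - 1/r) (1/r) / r\<close>.\<close>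

lemma antiderivative_limit_at_top:
  fixes r :: real
  assumes r: "r > 1" and K: "\<And>s. (K has_real_derivative 1 / (1 + \<bar>s\<bar> powr r)) (at s)"
  shows "(K \<longlongrightarrow> K 0 + pi / (r * sin (pi / r))) at_top"
proof -
  \<comment> \<open>\<open>\<phi>\<close> is the inverse of the substitution:
    \<open>t = 1 / (1 + s powr r)\<close> gives back \<open>s = \<phi> t\<close>, with
    \<open>\<phi> 1 = 0\<close>. The function \<open>\<beta>\<close> is the Beta integrand that
    results.\<close>
  define \<phi> where "\<phi> t = ((1 - t) / t) powr (1 / r)" for t :: real
  define \<beta> where "\<beta> t = t powr ((1 - 1 / r) - 1) * (1 - t) powr (1 / r - 1)" for t :: real
  have r': "0 < 1 / r" "1 / r < 1" using r by auto
  have \<beta>: "(\<beta> has_integral pi / sin (pi / r)) {0..1}"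
    using has_integral_Beta_real[of "1 - 1 / r" "1 / r"] Beta_reflection[OF r'] r'
    by (simp add: \<beta>_def[abs_def])
  have contK: "continuous_on S K" for S
    using K DERIV_isCont continuous_at_imp_continuous_on by blast
  have K\<phi>: "K (\<phi> \<epsilon>) = K 0 + (1 / r) * integral {\<epsilon>..1} \<beta>" if \<epsilon>: "0 < \<epsilon>" "\<epsilon> < 1" for \<epsilon>
  proof -
    have "((\<lambda>t. - (1 / r) * \<beta> t) has_integral K (\<phi> 1) - K (\<phi> \<epsilon>)) {\<epsilon>..1}"
    \<comment> \<open>Differentiability is available in the interior only: \<open>1 / r < 1\<close>,
      so the derivative of \<open>\<phi>\<close> is infinite at \<open>t = 1\<close>.\<close>
    proof (rule fundamental_theorem_of_calculus_interior)
      show "\<epsilon> \<le> 1" using \<epsilon> by simp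
      have "continuous_on {\<epsilon>..1} (\<lambda>t. (1 - t) / t)"
        using \<epsilon> by (intro continuous_intros) auto
      then have "continuous_on {\<epsilon>..1} \<phi>"
        unfolding \<phi>_def by (rule continuous_on_powr'[OF _ continuous_on_const]) (use \<epsilon> r' in auto)
      then show "continuous_on {\<epsilon>..1} (\<lambda>t. K (\<phi> t))"
        using continuous_on_compose2[OF contK] by blast
      fix t assume t: "t \<in> {\<epsilon><..<1}"
      define b where "b = (1 - t) / t"
      have b: "b > 0" "1 + b = 1 / t" using t \<epsilon> by (auto simp: b_def field_simps)
      have "((\<lambda>t. (1 - t) / t) has_real_derivative - 1 / t\<^sup>2) (at t)"
        using t \<epsilon> by (auto intro!: derivative_eq_intros simp: power2_eq_square field_simps)
      moreover have "((\<lambda>x. x powr (1 / r)) has_real_derivative (1 / r) * b powr (1 / r - 1)) (at ((1 - t) / t))"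
        unfolding b_def[symmetric] by (rule has_real_derivative_powr[OF b(1)])
      ultimately have "(\<phi> has_real_derivative (1 / r) * b powr (1 / r - 1) * (- 1 / t\<^sup>2)) (at t)"
        unfolding \<phi>_def[abs_def]
        using DERIV_chain2[where f = "\<lambda>x. x powr (1 / r)" and g = "\<lambda>t. (1 - t) / t"] by blast
      from DERIV_chain2[OF K this] have "((\<lambda>t. K (\<phi> t)) has_real_derivative
          1 / (1 + \<bar>\<phi> t\<bar> powr r) * ((1 / r) * b powr (1 / r - 1) * (- 1 / t\<^sup>2))) (at t)" .
      also have "\<bar>\<phi> t\<bar> powr r = b"
        using b(1) r by (simp add: \<phi>_def b_def[symmetric] powr_powr)
      also have "1 / (1 + b) * ((1 / r) * b powr (1 / r - 1) * (- 1 / t\<^sup>2)) = - (1 / r) * \<beta> t"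
      proof -
        have "b powr (1 / r - 1) = (1 - t) powr (1 / r - 1) / t powr (1 / r - 1)"
          using t \<epsilon> by (simp add: b_def powr_divide)
        moreover have "t powr (1 / r - 1) * \<beta> t * t = (1 - t) powr (1 / r - 1)"
        proof -
          have "t powr (1 / r - 1) * t powr ((1 - 1 / r) - 1) * t = t powr ((1 / r - 1) + ((1 - 1 / r) - 1) + 1)"
            using t \<epsilon> by (simp add: powr_add powr_diff powr_minus field_simps)
          also have "\<dots> = 1" using t \<epsilon> by simp
          finally show ?thesis by (simp add: \<beta>_def mult_ac)
        qed
        moreover have "t powr (1 / r - 1) > 0" using t \<epsilon> by simp
        ultimately have "b powr (1 / r - 1) = \<beta> t * t"
          by (metis mult.assoc nonzero_mult_div_cancel_left order_less_irrefl)
        then show ?thesis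
          unfolding b(2) using t \<epsilon> r by (simp add: field_simps power2_eq_square)
      qed
      finally show "((\<lambda>t. K (\<phi> t)) has_vector_derivative - (1 / r) * \<beta> t) (at t)"
        by (simp add: has_real_derivative_iff_has_vector_derivative)
    qed
    moreover have "((\<lambda>t. - (1 / r) * \<beta> t) has_integral - (1 / r) * integral {\<epsilon>..1} \<beta>) {\<epsilon>..1}"
    proof (intro has_integral_mult_right integrable_integral)
      show "\<beta> integrable_on {\<epsilon>..1}"
        by (rule integrable_on_subinterval[OF has_integral_integrable[OF \<beta>]]) (use \<epsilon> in auto)
    qed
    ultimately have "K (\<phi> 1) - K (\<phi> \<epsilon>) = - (1 / r) * integral {\<epsilon>..1} \<beta>"
      by (rule has_integral_unique)
    then show ?thesis by (simp add: \<phi>_def)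
  qed
  have "continuous_on {0..1} (\<lambda>x. integral {x..1} \<beta>)"
    using \<beta> by (intro indefinite_integral_continuous_1') auto
  then have "((\<lambda>x. integral {x..1} \<beta>) \<longlongrightarrow> integral {0..1} \<beta>) (at 0 within {0..1})"
    by (auto simp: continuous_on_def)
  then have lim: "((\<lambda>x. integral {x..1} \<beta>) \<longlongrightarrow> pi / sin (pi / r)) (at_right 0)"
    using \<beta> by (simp add: integral_unique at_within_Icc_at_right)
  have \<tau>: "filterlim (\<lambda>s. 1 / (1 + s powr r)) (at_right 0) at_top"
  proof -
    have "r > 0" using r by simp
    then show ?thesis by real_asymp
  qed
  have "((\<lambda>s. K 0 + (1 / r) * integral {1 / (1 + s powr r)..1} \<beta>) \<longlongrightarrow> K 0 + (1 / r) * (pi / sin (pi / r))) at_top"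
    by (intro tendsto_intros filterlim_compose[OF lim \<tau>])
  moreover have "eventually (\<lambda>s. K 0 + (1 / r) * integral {1 / (1 + s powr r)..1} \<beta> = K s) at_top"
    using eventually_gt_at_top[of 0]
  proof eventually_elim
    case (elim s)
    define w where "w = 1 + s powr r"
    have w: "w > 1" using elim by (simp add: w_def)
    then have "(1 - 1 / w) / (1 / w) = w - 1" by (simp add: field_simps)
    also have "w - 1 = s powr r" by (simp add: w_def)
    finally have "(1 - 1 / w) / (1 / w) = s powr r" .
    then have "\<phi> (1 / w) = s"
      using elim r by (simp add: \<phi>_def powr_powr)
    moreover have "K (\<phi> (1 / w)) = K 0 + (1 / r) * integral {1 / w..1} \<beta>"
      by (rule K\<phi>) (use w in auto)
    ultimately show ?case unfolding w_def by simp
  qed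
  ultimately show ?thesis using Lim_transform_eventually by fastforce
qed

text \<open>\<open>K\<close> is, up to a factor, the generalised arctangent; its total variation produces \<open>pi_hat\<close>.\<close>

lemma generalized_arctan:
  fixes p \<mu> :: real
  assumes p: "p > 1" and \<mu>: "\<mu> > 0"
  obtains K A B where "\<And>s. (K has_real_derivative 1 / (\<mu> + \<bar>s\<bar> powr (p / (p - 1)))) (at s)"
    "(K \<longlongrightarrow> A) at_top" "(K \<longlongrightarrow> B) at_bot" "A - B = (p - 1) * pi_hat p * \<mu> powr (- 1 / p)"
proof -
  define r where "r = p / (p - 1)"
  have r: "r > 1" using p by (simp add: r_def)
  obtain K1 where K1: "\<And>s. (K1 has_real_derivative 1 / (1 + \<bar>s\<bar> powr r)) (at s)"
    using DERIV_inverse_one_plus_abs_powr_antiderivative[OF r] by blast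
  define c where "c = pi / (r * sin (pi / r))"
  have top: "(K1 \<longlongrightarrow> K1 0 + c) at_top"
    unfolding c_def by (rule antiderivative_limit_at_top[OF r K1])
  \<comment> \<open>\<open>K1 - K1 0\<close> is odd because its derivative is even, so the limit at
    \<open>-\<infinity>\<close> follows from the one at \<open>\<infinity>\<close>.\<close>
  have odd: "K1 (- s) = 2 * K1 0 - K1 s" for s
  proof -
    have "((\<lambda>s. K1 (- s) + K1 s) has_real_derivative 0) (at s)" for s
      using K1[of s] K1[of "- s"] by (auto simp: DERIV_mirror intro!: derivative_eq_intros)
    then have "(K1 (- s) + K1 s) = (K1 (- 0) + K1 0)"
      using DERIV_isconst_all[of "\<lambda>s. K1 (- s) + K1 s" s 0] by blast
    then show ?thesis by simp
  qed
  have bot: "(K1 \<longlongrightarrow> K1 0 - c) at_bot"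
  proof -
    have "((\<lambda>s. 2 * K1 0 - K1 s) \<longlongrightarrow> 2 * K1 0 - (K1 0 + c)) at_top"
      by (intro tendsto_intros top)
    then show ?thesis by (simp add: filterlim_at_bot_mirror odd)
  qed
  \<comment> \<open>Scaling to \<open>\<mu> = 1\<close>: \<open>m\<close> normalises
    \<open>\<bar>s\<bar> powr r / \<mu>\<close>, and since \<open>1 / p + 1 / r = 1\<close> the
    prefactor times \<open>m\<close> is exactly \<open>1 / \<mu>\<close>.\<close>
  define m where "m = \<mu> powr (- 1 / r)"
  have m: "m > 0" using \<mu> by (simp add: m_def)
  define K where "K s = \<mu> powr (- 1 / p) * K1 (m * s)" for s
  have "(K has_real_derivative 1 / (\<mu> + \<bar>s\<bar> powr r)) (at s)" for s
  proof -
    have "((\<lambda>s. m * s) has_real_derivative m) (at s)" by (auto intro!: derivative_eq_intros)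
    from DERIV_cmult[OF DERIV_chain2[OF K1 this], of "\<mu> powr (- 1 / p)"]
    have "(K has_real_derivative \<mu> powr (- 1 / p) * (1 / (1 + \<bar>m * s\<bar> powr r) * m)) (at s)"
      by (simp add: K_def[abs_def])
    also have "\<bar>m * s\<bar> powr r = \<bar>s\<bar> powr r / \<mu>"
    proof -
      have "m powr r = 1 / \<mu>" unfolding m_def powr_powr using \<mu> r by (simp add: powr_minus_divide)
      then show ?thesis using m by (simp add: abs_mult powr_mult)
    qed
    also have "\<mu> powr (- 1 / p) * (1 / (1 + \<bar>s\<bar> powr r / \<mu>) * m) = 1 / (\<mu> + \<bar>s\<bar> powr r)"
    proof -
      have "\<mu> powr (- 1 / p) * m = \<mu> powr (- 1 / p + - 1 / r)" unfolding m_def by (rule powr_add[symmetric])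
      also have "- 1 / p + - 1 / r = - 1" using p by (simp add: r_def field_simps)
      finally have "\<mu> powr (- 1 / p) * m = 1 / \<mu>" using \<mu> by (simp add: powr_minus_divide)
      moreover have "\<mu> + \<bar>s\<bar> powr r > 0" using \<mu> by (simp add: add_pos_nonneg)
      ultimately show ?thesis using \<mu> by (simp add: field_simps)
    qed
    finally show ?thesis .
  qed
  moreover have "(K \<longlongrightarrow> \<mu> powr (- 1 / p) * (K1 0 + c)) at_top"
    unfolding K_def using m
    by (intro tendsto_intros filterlim_compose[OF top] filterlim_tendsto_pos_mult_at_top[OF tendsto_const] filterlim_ident)
  moreover have "(K \<longlongrightarrow> \<mu> powr (- 1 / p) * (K1 0 - c)) at_bot"
    unfolding K_def using m
    by (intro tendsto_intros filterlim_compose[OF bot])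
      (simp add: filterlim_tendsto_pos_mult_at_bot[OF tendsto_const] filterlim_ident)
  moreover have "\<mu> powr (- 1 / p) * (K1 0 + c) - \<mu> powr (- 1 / p) * (K1 0 - c) = (p - 1) * pi_hat p * \<mu> powr (- 1 / p)"
  proof -
    \<comment> \<open>Conjugate exponents have supplementary angles, so their sines agree; this
      turns the Beta value for \<open>r\<close> into \<open>pi_hat p\<close>.\<close>
    have "pi / r = pi - pi / p" using p by (simp add: r_def field_simps)
    then have "c = pi / (r * sin (pi / p))" by (simp add: c_def)
    then have "2 * c = (p - 1) * pi_hat p" using p by (simp add: pi_hat_def r_def)
    then show ?thesis by (simp add: algebra_simps) (metis mult.assoc mult.commute mult_2 distrib_right)
  qed
  ultimately show ?thesis using that unfolding r_def by blast
qed

section \<open>The test function behind the mean value of the weight\<close>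

lemma DERIV_abs_powr:
  fixes s r :: real
  assumes "s \<noteq> 0"
  shows "((\<lambda>s. \<bar>s\<bar> powr r) has_real_derivative r * \<bar>s\<bar> powr r / s) (at s)"
proof (cases "s > 0")
  case True
  have "((\<lambda>s. s powr r) has_real_derivative r * \<bar>s\<bar> powr r / s) (at s)"
    using has_real_derivative_powr[OF True, of r] True by (simp add: powr_diff)
  then show ?thesis
    by (rule has_field_derivative_transform_within_open[of _ _ _ "{0<..}"]) (use True in auto)
next
  case False
  then have s: "- s > 0" using assms by simp
  have "((\<lambda>s. (- s) powr r) has_real_derivative r * \<bar>s\<bar> powr r / s) (at s)"
    using has_real_derivative_powr[OF s, of r] s by (simp add: DERIV_mirror powr_diff)
  then show ?thesis
    by (rule has_field_derivative_transform_within_open[of _ _ _ "{..<0}"]) (use s in auto)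
qed

text \<open>The derivative of \<open>s / (\<mu> + \<bar>s\<bar> powr r)\<close>. For
  \<open>r = p'\<close> and \<open>s = u\<close> that function is \<open>y\<close> times the signed
  power of \<open>y'\<close>, divided by
  \<open>\<mu> \<bar>y\<bar>\<^sup>p + \<bar>y'\<bar>\<^sup>p\<close>, which vanishes at both ends
  of a nodal interval.\<close>

definition cutoff_deriv :: "real \<Rightarrow> real \<Rightarrow> real \<Rightarrow> real" where
  "cutoff_deriv \<mu> r s = 1 / (\<mu> + \<bar>s\<bar> powr r) - r * \<bar>s\<bar> powr r / (\<mu> + \<bar>s\<bar> powr r)\<^sup>2"

lemma DERIV_cutoff:
  fixes r \<mu> :: real
  assumes r: "r > 1" and \<mu>: "\<mu> > 0"
  shows "((\<lambda>s. s / (\<mu> + \<bar>s\<bar> powr r)) has_real_derivative cutoff_deriv \<mu> r s) (at s)"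
proof (cases "s = 0")
  case True
  have "isCont (\<lambda>s. 1 / (\<mu> + \<bar>s\<bar> powr r)) 0"
    using r \<mu> unfolding isCont_def by (intro tendsto_divide tendsto_add tendsto_const tendsto_powr' tendsto_rabs tendsto_ident_at) auto
  then show ?thesis
    \<comment> \<open>At 0 the power rule for \<open>\<bar>s\<bar> powr r\<close> is not at hand;
      Caratheodory's criterion applies since the function is \<open>s\<close> times a factor
      continuous at 0.\<close>
    unfolding CARAT_DERIV using True r by (intro exI[of _ "\<lambda>s. 1 / (\<mu> + \<bar>s\<bar> powr r)"]) (auto simp: cutoff_deriv_def)
next
  case False
  define w where "w = \<mu> + \<bar>s\<bar> powr r"
  have w: "w > 0" using \<mu> by (simp add: w_def add_pos_nonneg)
  have "((\<lambda>s. s / (\<mu> + \<bar>s\<bar> powr r)) has_real_derivative (1 * w - s * (0 + r * \<bar>s\<bar> powr r / s)) / (w * w)) (at s)"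
    unfolding w_def using w False
    by (intro DERIV_divide DERIV_add DERIV_abs_powr DERIV_ident DERIV_const) (auto simp: w_def)
  also have "(1 * w - s * (0 + r * \<bar>s\<bar> powr r / s)) / (w * w) = cutoff_deriv \<mu> r s"
    using w False unfolding cutoff_deriv_def w_def[symmetric] by (simp add: field_simps power2_eq_square)
  finally show ?thesis .
qed

lemma cutoff_tendsto_0:
  fixes r \<mu> :: real
  assumes r: "r > 1" and \<mu>: "\<mu> > 0" and F: "filterlim abs at_top F"
  shows "((\<lambda>s. s / (\<mu> + \<bar>s\<bar> powr r)) \<longlongrightarrow> 0) F"
proof (rule Lim_null_comparison)
  show "((\<lambda>s. \<bar>s\<bar> powr (1 - r)) \<longlongrightarrow> 0) F"
    using r by (intro tendsto_neg_powr F) auto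
  show "eventually (\<lambda>s. norm (s / (\<mu> + \<bar>s\<bar> powr r)) \<le> \<bar>s\<bar> powr (1 - r)) F"
  proof (rule always_eventually, rule allI)
    fix s :: real
    show "norm (s / (\<mu> + \<bar>s\<bar> powr r)) \<le> \<bar>s\<bar> powr (1 - r)"
    proof (cases "s = 0")
      case False
      then have "norm (s / (\<mu> + \<bar>s\<bar> powr r)) \<le> \<bar>s\<bar> / (\<bar>s\<bar> powr r)"
        using \<mu> by (simp add: abs_divide add_pos_pos) (intro divide_left_mono, auto simp: add_pos_pos)
      then show ?thesis using False by (simp add: powr_diff)
    qed simp
  qed
qed

section \<open>Nodal cells\<close>

text \<open>The last cell is the nodal interval from the last node to the first node of the next period,
  taken modulo \<open>1\<close>.\<close>

definition nodal_cell :: "nat \<Rightarrow> (real \<Rightarrow> real) \<Rightarrow> nat \<Rightarrow> real set" where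
  "nodal_cell n y i = (let s = sorted_list_of_set (zeros01 y) in
     if i + 1 < n then {s ! i..<s ! (i + 1)} else {0..<s ! 0} \<union> {s ! (n - 1)..<1})"

lemma int_strict_mono_from_succ:
  fixes f :: "int \<Rightarrow> 'a :: order"
  assumes "\<And>i. f i < f (i + 1)" "i < j"
  shows "f i < f j"
  using assms(2)
proof (induction j rule: int_gr_induct)
  case (step k)
  then show ?case using assms(1) less_trans by blast
qed (rule assms(1))

locale nodes =
  fixes n :: nat and y :: "real \<Rightarrow> real"
  assumes n: "n \<ge> 1" and fin: "finite (zeros01 y)" and card: "card (zeros01 y) = n"
begin

definition "s = sorted_list_of_set (zeros01 y)"

lemma length_s: "length s = n"
  using card by (simp add: s_def)

lemma s_less: "i < j \<Longrightarrow> j < n \<Longrightarrow> s ! i < s ! j"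
  using sorted_wrt_nth_less[of "(<)" s i j] length_s by (simp add: s_def)

lemma s_le: "i \<le> j \<Longrightarrow> j < n \<Longrightarrow> s ! i \<le> s ! j"
  using s_less[of i j] by (cases "i = j") auto

lemma s_zero: "i < n \<Longrightarrow> s ! i \<in> {0..<1} \<and> y (s ! i) = 0"
proof -
  assume "i < n"
  then have "s ! i \<in> set s" using length_s by simp
  also have "set s = zeros01 y" using fin by (simp add: s_def)
  finally show ?thesis by (simp add: zeros01_def)
qed

lemma zero_nth: "x \<in> {0..<1} \<Longrightarrow> y x = 0 \<Longrightarrow> \<exists>i<n. x = s ! i"
proof -
  assume "x \<in> {0..<1}" "y x = 0"
  then have "x \<in> set s" using fin by (simp add: s_def zeros01_def)
  then show ?thesis using length_s by (auto simp: in_set_conv_nth)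
qed

lemma cell_eq: "nodal_cell n y i = (if i + 1 < n then {s ! i..<s ! (i + 1)} else {0..<s ! 0} \<union> {s ! (n - 1)..<1})"
  by (simp add: nodal_cell_def s_def Let_def)

lemma nonzero_between:
  assumes "i + 1 < n" "x \<in> {s ! i<..<s ! (i + 1)}"
  shows "y x \<noteq> 0"
proof
  assume "y x = 0"
  moreover have "x \<in> {0..<1}" using assms s_zero[of i] s_zero[of "i + 1"] by auto
  ultimately obtain k where k: "k < n" "x = s ! k" using zero_nth by blast
  show False
  proof (cases "k \<le> i")
    case True then show ?thesis using s_le[of k i] assms k by simp
  next
    case False then show ?thesis using s_le[of "i + 1" k] assms k by simp
  qed
qed

lemma nonzero_before: "x \<in> {0..<s ! 0} \<Longrightarrow> y x \<noteq> 0"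
proof
  assume x: "x \<in> {0..<s ! 0}" "y x = 0"
  then have "x \<in> {0..<1}" using s_zero[of 0] n by auto
  then obtain k where "k < n" "x = s ! k" using zero_nth x by blast
  then show False using s_le[of 0 k] x by simp
qed

lemma nonzero_after: "x \<in> {s ! (n - 1)<..<1} \<Longrightarrow> y x \<noteq> 0"
proof
  assume x: "x \<in> {s ! (n - 1)<..<1}" "y x = 0"
  then have "x \<in> {0..<1}" using s_zero[of "n - 1"] n by auto
  then obtain k where "k < n" "x = s ! k" using zero_nth x by blast
  moreover from this have "k \<le> n - 1" by simp
  ultimately show False using s_le[of k "n - 1"] x n by simp
qed

lemma cell_subset: "i < n \<Longrightarrow> nodal_cell n y i \<subseteq> {0..<1}"
  using s_zero[of i] s_zero[of "i + 1"] s_zero[of 0] s_zero[of "n - 1"] n by (auto simp: cell_eq)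

lemma cell_sets [measurable]: "nodal_cell n y i \<in> sets borel"
  by (auto simp: cell_eq)

lemma cell_union: "(\<Union>i<n. nodal_cell n y i) = {0..<1}"
proof
  show "{0..<1} \<subseteq> (\<Union>i<n. nodal_cell n y i)"
  proof
    fix x :: real assume x: "x \<in> {0..<1}"
    show "x \<in> (\<Union>i<n. nodal_cell n y i)"
    proof (cases "x < s ! 0 \<or> s ! (n - 1) \<le> x")
      case True
      then have "x \<in> nodal_cell n y (n - 1)" using x n by (auto simp: cell_eq)
      then show ?thesis using n by (intro UN_I[of "n - 1"]) auto
    next
      case False
      define I where "I = {i. i < n \<and> s ! i \<le> x}"
      define i where "i = Max I"
      have "finite I" by (simp add: I_def)
      moreover have "0 \<in> I" using False n by (simp add: I_def)
      ultimately have i: "i \<in> I" "\<And>j. j \<in> I \<Longrightarrow> j \<le> i" unfolding i_def by (auto intro: Max_in)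
      have "i \<noteq> n - 1" using i False by (auto simp: I_def)
      then have i1: "i + 1 < n" using i by (auto simp: I_def)
      have "i + 1 \<notin> I" using i(2)[of "i + 1"] by auto
      then have "x \<in> nodal_cell n y i" using i i1 by (auto simp: cell_eq I_def)
      then show ?thesis using i1 by (intro UN_I[of i]) auto
    qed
  qed
  show "(\<Union>i<n. nodal_cell n y i) \<subseteq> {0..<1}"
    using cell_subset by blast
qed

lemma cell_disjoint: "disjoint_family_on (nodal_cell n y) {..<n}"
proof -
  have *: "nodal_cell n y i \<inter> nodal_cell n y j = {}" if "i < j" "j < n" for i j
  proof (cases "j + 1 < n")
    case True
    then show ?thesis using that s_le[of "i + 1" j] by (auto simp: cell_eq)
  next
    case False
    then have "j = n - 1" using that by simp
    then show ?thesis using that s_le[of "i + 1" "n - 1"] s_le[of 0 i] by (auto simp: cell_eq)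
  qed
  show ?thesis
    unfolding disjoint_family_on_def
  proof (intro ballI impI)
    fix i j assume "i \<in> {..<n}" "j \<in> {..<n}" "i \<noteq> j"
    then show "nodal_cell n y i \<inter> nodal_cell n y j = {}"
      using *[of i j] *[of j i] by (cases "i < j") auto
  qed
qed

section \<open>Nodes indexed by the integers and the nodal length at a point\<close>

lemma node_eq: "node n y i = s ! nat (i mod int n) + real_of_int (i div int n)"
  by (simp add: node_def s_def)

lemma node_nat: "i < n \<Longrightarrow> node n y (int i) = s ! i"
  by (simp add: node_eq)

lemma node_n: "node n y (int n) = s ! 0 + 1"
  using n by (simp add: node_eq)

lemma node_minus_1: "node n y (-1) = s ! (n - 1) - 1"
proof -
  have "(-1) mod int n = int n - 1" using n by (simp add: zmod_minus1)
  moreover have "(-1) div int n = -1" using n by (simp add: div_eq_minus1)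
  moreover have "nat (int n - 1) = n - 1" by simp
  ultimately show ?thesis by (simp add: node_eq)
qed

lemma node_less_succ: "node n y i < node n y (i + 1)"
proof -
  define m where "m = i mod int n"
  have m: "0 \<le> m" "m < int n" using n by (simp_all add: m_def)
  have i: "i = (i div int n) * int n + m" by (simp add: m_def)
  show ?thesis
  proof (cases "m + 1 < int n")
    case True
    have "(i + 1) mod int n = m + 1" "(i + 1) div int n = i div int n"
    proof -
      have "i + 1 = (m + 1) + (i div int n) * int n" using i by simp
      then show "(i + 1) mod int n = m + 1" "(i + 1) div int n = i div int n"
        using True m n by (metis mod_mult_self1 mod_pos_pos_trivial add_nonneg_nonneg zero_le_one)
          (metis \<open>i + 1 = (m + 1) + (i div int n) * int n\<close> True m(1) add_nonneg_nonneg div_mult_self1 div_pos_pos_trivial add.commute add_0 less_irrefl not_less zero_le_one le_less_trans)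
    qed
    then show ?thesis using True m s_less[of "nat m" "nat (m + 1)"]
      by (simp add: node_eq m_def[symmetric])
  next
    case False
    then have mn: "m + 1 = int n" using m by simp
    have "i + 1 = (i div int n + 1) * int n" using i mn by (simp add: algebra_simps)
    then have "(i + 1) mod int n = 0" "(i + 1) div int n = i div int n + 1"
      using n by (metis mod_mult_self2_is_0, metis nonzero_mult_div_cancel_right of_nat_0_eq_iff not_one_le_zero)
    moreover have "nat m < n" using m by linarith
    ultimately show ?thesis using s_zero[of "nat m"] s_zero[of 0] n
      by (simp add: node_eq m_def[symmetric])
  qed
qed

lemma node_less: "i < j \<Longrightarrow> node n y i < node n y j"
  using int_strict_mono_from_succ[of "node n y"] node_less_succ by blast

lemma nodal_index_eqI:
  assumes "node n y k \<le> x" "x < node n y (k + 1)"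
  shows "nodal_index n y x = k"
  unfolding nodal_index_def
proof (rule Greatest_equality)
  show "node n y k \<le> x" by fact
  fix j assume "node n y j \<le> x"
  then have "node n y j < node n y (k + 1)" using assms(2) by simp
  then have "\<not> k + 1 < j" "j \<noteq> k + 1" using node_less[of "k + 1" j] by auto
  then show "j \<le> k" by linarith
qed

text \<open>Only the last cell needs care. Its points before the first node have index
  \<open>-1\<close>, those from the last node on have index \<open>n - 1\<close>. Both nodal
  intervals, being translates by a period, have length \<open>s ! 0 + 1 - s ! (n - 1)\<close>, which
  is the total measure of the two pieces.\<close>

lemma nodal_length_cell:
  assumes "i < n" "x \<in> nodal_cell n y i"
  shows "nodal_length n y (nodal_index n y x) = measure lebesgue (nodal_cell n y i)"
proof (cases "i + 1 < n")
  case True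
  have ni: "node n y (int i + 1) = s ! (i + 1)"
    using node_nat[of "i + 1"] True by (simp add: add.commute)
  have "nodal_index n y x = int i"
    using assms True ni by (intro nodal_index_eqI) (auto simp: node_nat[of i] cell_eq)
  then show ?thesis
    using True s_le[of i "i + 1"] ni by (simp add: nodal_length_def node_nat cell_eq)
next
  case False
  have z: "0 \<le> s ! 0" "s ! 0 \<le> s ! (n - 1)" "s ! (n - 1) < 1"
    using s_zero[of 0] s_zero[of "n - 1"] s_le[of 0 "n - 1"] n by auto
  have x: "x \<in> {0..<s ! 0} \<union> {s ! (n - 1)..<1}" using assms False by (simp add: cell_eq)
  have "measure lebesgue (nodal_cell n y i) = measure lebesgue {0..<s ! 0} + measure lebesgue {s ! (n - 1)..<1}"
    using False z by (simp add: cell_eq) (subst measure_Union, auto)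
  also have "\<dots> = s ! 0 + 1 - s ! (n - 1)" using z by simp
  finally have len: "measure lebesgue (nodal_cell n y i) = s ! 0 + 1 - s ! (n - 1)" .
  have n1: "int n - 1 = int (n - 1)" using n by simp
  show ?thesis
  proof (cases "x < s ! 0")
    case True
    then have "nodal_index n y x = -1"
      using x z node_nat[of 0] n by (intro nodal_index_eqI) (auto simp: node_minus_1)
    then show ?thesis using len node_nat[of 0] n by (simp add: nodal_length_def node_minus_1)
  next
    case False
    have "node n y (int n - 1) = s ! (n - 1)"
      unfolding n1 by (rule node_nat) (use n in simp)
    moreover have "node n y (int n - 1 + 1) = s ! 0 + 1" using node_n by simp
    ultimately have e: "node n y (int n - 1) = s ! (n - 1)" "node n y (int n - 1 + 1) = s ! 0 + 1" .
    have "nodal_index n y x = int n - 1"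
      using x z False by (intro nodal_index_eqI) (auto simp: e(1) node_n)
    then show ?thesis using len by (simp add: nodal_length_def e(1) node_n)
  qed
qed

end

lemma set_integral_Ico_Ioo:
  fixes g :: "real \<Rightarrow> real"
  assumes g: "set_integrable lebesgue {a<..<b} g"
  shows "set_integrable lebesgue {a..<b} g"
    and "(LINT t:{a..<b}|lebesgue. g t) = (LINT t:{a<..<b}|lebesgue. g t)"
proof -
  have neg: "negligible {x \<in> {a..<b} - {a<..<b}. g x \<noteq> 0}" "negligible {x \<in> {a<..<b} - {a..<b}. g x \<noteq> 0}"
    by (rule negligible_subset[of "{a}"]; auto)+
  show g': "set_integrable lebesgue {a..<b} g"
    using g absolutely_integrable_spike_set_eq[OF neg] by simp
  show "(LINT t:{a..<b}|lebesgue. g t) = (LINT t:{a<..<b}|lebesgue. g t)"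
    using integral_spike_set[OF neg] set_lebesgue_integral_eq_integral(2)[OF g] set_lebesgue_integral_eq_integral(2)[OF g']
    by simp
qed

section \<open>Integral identities over a nodal cell\<close>

locale rot =
  fixes p :: real and q :: "real \<Rightarrow> real" and n :: nat and l :: real and y :: "real \<Rightarrow> real"
  assumes p_gt_1: "p > 1" and n_ge_1: "n \<ge> 1" and rot: "rot_eigenfunction p q n l y"
    and q_int: "q absolutely_integrable_on {0..1}"

sublocale rot \<subseteq> plap p q l y
  using p_gt_1 rot q_int by unfold_locales (auto simp: rot_eigenfunction_def)

sublocale rot \<subseteq> nodes n y
  using n_ge_1 rot by unfold_locales (auto simp: rot_eigenfunction_def)

context rot
begin

text \<open>Anti-periodicity changes the sign of \<open>y\<close> and \<open>y'\<close> together and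
  leaves their quotient alone, so \<open>u\<close> is periodic under either boundary condition. From
  here on the parity of \<open>n\<close> is invisible.\<close>

lemma boundary: "y 0 = 0 \<longleftrightarrow> y 1 = 0" "u 0 = u 1"
  using rot by (auto simp: rot_eigenfunction_def periodic_bc_def antiperiodic_bc_def riccati_def split: if_splits)

lemma isCont_riccati:
  assumes "y t \<noteq> 0"
  shows "isCont u t"
proof -
  have "isCont y t" using deriv_y DERIV_isCont by blast
  with isCont_deriv_y have c: "isCont (\<lambda>t. deriv y t / y t) t" using assms by (intro isCont_divide)
  have "continuous_on UNIV (spow (p - 1))" using p by (intro continuous_on_spow) auto
  then have "isCont (spow (p - 1)) (deriv y t / y t)" by (simp add: continuous_on_eq_continuous_at)
  from isCont_o2[OF c this] show ?thesis by (simp add: riccati_def[abs_def])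
qed

text \<open>Over an ordinary cell \<open>u\<close> runs from \<open>\<infinity>\<close> to
  \<open>-\<infinity>\<close>, which gives \<open>A - A'\<close>. The last cell consists of two
  pieces that meet at the period boundary; they contribute \<open>K (u 0) - A'\<close> and
  \<open>A - K (u 1)\<close>, and the inner values cancel because \<open>u 0 = u 1\<close>.\<close>

lemma cell_integral:
  assumes K: "\<And>s. (K has_real_derivative k s) (at s)" and k: "\<And>s. \<bar>k s\<bar> \<le> B" "\<And>s. \<bar>k s\<bar> * \<bar>s\<bar> powr p' \<le> B"
    and km: "k \<in> borel_measurable borel"
    and lim: "(K \<longlongrightarrow> A) at_top" "(K \<longlongrightarrow> A') at_bot" and i: "i < n"
  shows "set_integrable lebesgue (nodal_cell n y i) (\<lambda>t. k (u t) * (l - q t + \<bar>u t\<bar> powr p'))" (is "set_integrable _ _ ?g")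
    and "(LINT t:nodal_cell n y i|lebesgue. k (u t) * (l - q t + \<bar>u t\<bar> powr p')) = (A - A') / (p - 1)"
proof -
  note int = integral_riccati[OF _ _ _ _ K k km]
  have KC: "isCont K s" for s using K DERIV_isCont by blast
  have Ku: "((\<lambda>t. K (u t)) \<longlongrightarrow> K (u t0)) (at t0 within S)" if "y t0 \<noteq> 0" for t0 S
  proof -
    have "isCont (\<lambda>t. K (u t)) t0" using isCont_o2[OF isCont_riccati[OF that] KC] .
    then show ?thesis using continuous_at_imp_continuous_at_within continuous_within by blast
  qed
  have "set_integrable lebesgue (nodal_cell n y i) ?g \<and> (LINT t:nodal_cell n y i|lebesgue. ?g t) = (A - A') / (p - 1)"
  proof (cases "i + 1 < n")
    case True
    define a b where "a = s ! i" and "b = s ! (i + 1)"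
    have ab: "0 \<le> a" "a < b" "b \<le> 1" "y a = 0" "y b = 0"
      using s_zero[of i] s_zero[of "i + 1"] s_less[of i "i + 1"] True by (auto simp: a_def b_def)
    have nz: "y x \<noteq> 0" if "x \<in> {a<..<b}" for x using nonzero_between[OF True] that by (simp add: a_def b_def)
    have "((\<lambda>t. K (u t)) \<longlongrightarrow> A) (at_right a)" "((\<lambda>t. K (u t)) \<longlongrightarrow> A') (at_left b)"
      using filterlim_compose[OF lim(1) riccati_at_right[OF ab(1-3) nz ab(4)]]
        filterlim_compose[OF lim(2) riccati_at_left[OF ab(1-3) nz ab(5)]] by auto
    note I = int[OF ab(1-3) nz this]
    show ?thesis
      using set_integral_Ico_Ioo[OF I(1)] I(2) True by (simp add: cell_eq a_def b_def)
  next
    case False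
    define c d where "c = s ! 0" and "d = s ! (n - 1)"
    have cd: "0 \<le> c" "c \<le> d" "d < 1" "y c = 0" "y d = 0"
      using s_zero[of 0] s_zero[of "n - 1"] s_le[of 0 "n - 1"] n_ge_1 by (auto simp: c_def d_def)
    have nz0: "y x \<noteq> 0" if "x \<in> {0..<c}" for x using nonzero_before that by (simp add: c_def)
    have nz1: "y x \<noteq> 0" if "x \<in> {d<..<1}" for x using nonzero_after that by (simp add: d_def)
    have cell: "nodal_cell n y i = {0..<c} \<union> {d..<1}" using False by (simp add: cell_eq c_def d_def)
    have d0: "0 \<le> d" using cd by simp
    have limd: "((\<lambda>t. K (u t)) \<longlongrightarrow> A) (at_right d)"
      using filterlim_compose[OF lim(1) riccati_at_right[OF d0 cd(3) order_refl nz1 cd(5)]] by simp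
    show ?thesis
    \<comment> \<open>If 0 is a node, then so is 1: the left piece is empty and \<open>u\<close>
      tends to \<open>-\<infinity>\<close> at 1.\<close>
    proof (cases "c = 0")
      case True
      then have "y 1 = 0" using cd(4) boundary by simp
      have "((\<lambda>t. K (u t)) \<longlongrightarrow> A') (at_left 1)"
        using filterlim_compose[OF lim(2) riccati_at_left[OF d0 cd(3) order_refl nz1 \<open>y 1 = 0\<close>]] by simp
      note I = int[OF d0 cd(3) order_refl nz1 limd this]
      show ?thesis
        using set_integral_Ico_Ioo[OF I(1)] I(2) True by (simp add: cell)
    next
      case False
      then have c: "0 < c" using cd by simp
      then have "y 0 \<noteq> 0" using nz0[of 0] by simp
      then have "y 1 \<noteq> 0" using boundary by simp
      have nz0': "y x \<noteq> 0" if "x \<in> {0<..<c}" for x using nz0 that by simp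
      have c1: "c \<le> 1" using cd by simp
      have "((\<lambda>t. K (u t)) \<longlongrightarrow> A') (at_left c)"
        using filterlim_compose[OF lim(2) riccati_at_left[OF order_refl c c1 nz0' cd(4)]] by simp
      note I0 = int[OF order_refl c c1 nz0' Ku[OF \<open>y 0 \<noteq> 0\<close>] this]
      note I1 = int[OF d0 cd(3) order_refl nz1 limd Ku[OF \<open>y 1 \<noteq> 0\<close>]]
      note J0 = set_integral_Ico_Ioo[OF I0(1)]
      note J1 = set_integral_Ico_Ioo[OF I1(1)]
      have "set_integrable lebesgue (nodal_cell n y i) ?g"
        unfolding cell using J0(1) J1(1) by (rule set_integrable_Un) auto
      moreover have "(LINT t:nodal_cell n y i|lebesgue. ?g t) = (LINT t:{0..<c}|lebesgue. ?g t) + (LINT t:{d..<1}|lebesgue. ?g t)"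
        unfolding cell using J0(1) J1(1) cd by (intro set_integral_Un) auto
      moreover have "\<dots> = (K (u 0) - A') / (p - 1) + (A - K (u 1)) / (p - 1)"
        using J0(2) J1(2) I0(2) I1(2) by simp
      moreover have "\<dots> = (A - A') / (p - 1)" by (simp add: boundary(2) add_divide_distrib diff_divide_distrib)
      ultimately show ?thesis by simp
    qed
  qed
  then show "set_integrable lebesgue (nodal_cell n y i) ?g" "(LINT t:nodal_cell n y i|lebesgue. ?g t) = (A - A') / (p - 1)"
    by auto
qed

text \<open>The parameter \<open>\<mu>\<close> is kept apart from the eigenvalue \<open>l\<close>,
  because the identity with an arbitrary \<open>\<mu> > 0\<close> serves to show that
  \<open>l\<close> is large; afterwards \<open>\<mu> = l\<close>.\<close>

definition W :: "real \<Rightarrow> real \<Rightarrow> real" where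
  "W \<mu> t = \<mu> / (\<mu> + \<bar>u t\<bar> powr p')"

lemma W_bounds: "\<mu> > 0 \<Longrightarrow> 0 \<le> W \<mu> t \<and> W \<mu> t \<le> 1"
  by (simp add: W_def add_pos_nonneg)

lemma borel_measurable_W [measurable]: "W \<mu> \<in> borel_measurable borel"
  unfolding W_def[abs_def] by measurable

text \<open>With \<open>D = \<mu> + \<bar>u t\<bar> powr p'\<close>, the Riccati expression
  \<open>l - q t + (D - \<mu>)\<close> divided by \<open>D\<close> splits off the constant 1, whose
  integral is the length of the cell. For \<open>\<mu> = l\<close> only the term with
  \<open>q\<close> is left beside it.\<close>

lemma cell_integral_arctan:
  assumes \<mu>: "\<mu> > 0" and i: "i < n"
  shows "set_integrable lebesgue (nodal_cell n y i) (\<lambda>t. 1 + (l - \<mu> - q t) / \<mu> * W \<mu> t)"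
    and "(LINT t:nodal_cell n y i|lebesgue. 1 + (l - \<mu> - q t) / \<mu> * W \<mu> t) = pi_hat p * \<mu> powr (- 1 / p)"
proof -
  obtain K A A' where K: "\<And>s. (K has_real_derivative 1 / (\<mu> + \<bar>s\<bar> powr p')) (at s)"
    "(K \<longlongrightarrow> A) at_top" "(K \<longlongrightarrow> A') at_bot" "A - A' = (p - 1) * pi_hat p * \<mu> powr (- 1 / p)"
    using generalized_arctan[OF p \<mu>] by blast
  have pos: "\<mu> + \<bar>s\<bar> powr p' > 0" for s using \<mu> by (simp add: add_pos_nonneg)
  have b1: "\<bar>1 / (\<mu> + \<bar>s\<bar> powr p')\<bar> \<le> 1 / \<mu> + 1" for s
  proof -
    have "1 / (\<mu> + \<bar>s\<bar> powr p') \<le> 1 / \<mu>" using \<mu> by (intro divide_left_mono) (auto intro: mult_pos_pos pos)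
    then show ?thesis using pos[of s] by simp
  qed
  have b2: "\<bar>1 / (\<mu> + \<bar>s\<bar> powr p')\<bar> * \<bar>s\<bar> powr p' \<le> 1 / \<mu> + 1" for s
  proof -
    have "\<bar>1 / (\<mu> + \<bar>s\<bar> powr p')\<bar> * \<bar>s\<bar> powr p' = \<bar>s\<bar> powr p' / (\<mu> + \<bar>s\<bar> powr p')"
      using pos[of s] by simp
    also have "\<dots> \<le> 1" using \<mu> pos[of s] by simp
    finally show ?thesis using \<mu> by (smt (verit) divide_pos_pos)
  qed
  have m: "(\<lambda>s. 1 / (\<mu> + \<bar>s\<bar> powr p')) \<in> borel_measurable borel" by measurable
  note I = cell_integral[OF K(1) b1 b2 m K(2,3) i]
  have eq: "1 / (\<mu> + \<bar>u t\<bar> powr p') * (l - q t + \<bar>u t\<bar> powr p') = 1 + (l - \<mu> - q t) / \<mu> * W \<mu> t" for t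
  proof -
    have "1 / D * (l - q t + (D - \<mu>)) = 1 + (l - \<mu> - q t) / \<mu> * (\<mu> / D)" if "D > 0" for D
      using \<mu> that by (simp add: field_simps)
    from this[OF pos[of "u t"]] show ?thesis by (simp add: W_def)
  qed
  show "set_integrable lebesgue (nodal_cell n y i) (\<lambda>t. 1 + (l - \<mu> - q t) / \<mu> * W \<mu> t)"
    using I(1) unfolding eq .
  show "(LINT t:nodal_cell n y i|lebesgue. 1 + (l - \<mu> - q t) / \<mu> * W \<mu> t) = pi_hat p * \<mu> powr (- 1 / p)"
    using I(2) K(4) p unfolding eq by simp
qed

text \<open>The boundary terms vanish since the test function tends to 0 at both infinities. This is
  the equipartition law, with \<open>q\<close> entering as a correction of relative size
  \<open>1 / l\<close>.\<close>

lemma cell_integral_cutoff: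
  assumes l: "l > 0" and i: "i < n"
  shows "set_integrable lebesgue (nodal_cell n y i) (\<lambda>t. (p * W l t - 1) * (1 - q t * W l t / l))"
    and "(LINT t:nodal_cell n y i|lebesgue. (p * W l t - 1) * (1 - q t * W l t / l)) = 0"
proof -
  have p1: "p' > 1" using p by simp
  let ?H = "\<lambda>s. s / (l + \<bar>s\<bar> powr p')"
  have pos: "l + \<bar>s\<bar> powr p' > 0" for s using l by (simp add: add_pos_nonneg)
  \<comment> \<open>\<open>w\<close> and \<open>v\<close> are the shares of \<open>l\<close> and of
    \<open>\<bar>s\<bar> powr p'\<close> in their sum. Since \<open>w + v = 1\<close>, the factor
    \<open>1 - p' * v\<close> of the derivative equals \<open>(p * w - 1) / (p - 1)\<close>.\<close>
  define w v where "w s = l / (l + \<bar>s\<bar> powr p')" and "v s = \<bar>s\<bar> powr p' / (l + \<bar>s\<bar> powr p')" for s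
  have wv: "0 \<le> w s" "0 \<le> v s" "w s + v s = 1" for s
    using pos[of s] l by (simp_all add: w_def v_def add_divide_distrib[symmetric])
  have cd: "cutoff_deriv l p' s = w s * (1 - p' * v s) / l" for s
  proof -
    have "1 / D - r * x / D\<^sup>2 = l / D * (1 - r * (x / D)) / l" if "D > 0" for D r x
      using l that by (simp add: field_simps power2_eq_square)
    from this[OF pos[of s]] show ?thesis unfolding cutoff_deriv_def w_def v_def .
  qed
  have wl: "w s \<le> 1" "v s \<le> 1" for s using wv[of s] by auto
  have b: "\<bar>1 - p' * v s\<bar> \<le> 1 + p'" for s
  proof -
    have "p' * v s \<le> p' * 1" using p1 wl by (intro mult_left_mono) auto
    moreover have "0 \<le> p' * v s" using p1 wv by (intro mult_nonneg_nonneg) auto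
    ultimately show ?thesis using p1 by (auto simp: abs_le_iff)
  qed
  define B where "B = (1 + p') / l + (1 + p')"
  have b1: "\<bar>cutoff_deriv l p' s\<bar> \<le> B" for s
  proof -
    have "w s * \<bar>1 - p' * v s\<bar> \<le> 1 * (1 + p')" using wl wv b by (intro mult_mono) auto
    then have "\<bar>cutoff_deriv l p' s\<bar> \<le> (1 + p') / l"
      unfolding cd using l wv(1)[of s] by (simp add: abs_mult divide_right_mono)
    then show ?thesis using p1 by (simp add: B_def)
  qed
  have b2: "\<bar>cutoff_deriv l p' s\<bar> * \<bar>s\<bar> powr p' \<le> B" for s
  proof -
    have "w s * \<bar>s\<bar> powr p' / l = v s" using l by (simp add: w_def v_def)
    then have "\<bar>cutoff_deriv l p' s\<bar> * \<bar>s\<bar> powr p' = v s * \<bar>1 - p' * v s\<bar>"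
      unfolding cd using l wv(1)[of s] by (simp add: abs_mult) (metis mult.commute mult.assoc times_divide_eq_left)
    also have "\<dots> \<le> 1 * (1 + p')" using wl wv b by (intro mult_mono) auto
    finally show ?thesis using p1 l by (simp add: B_def) (smt (verit) divide_nonneg_pos)
  qed
  have m: "cutoff_deriv l p' \<in> borel_measurable borel"
    unfolding cutoff_deriv_def[abs_def] by measurable
  have lim: "(?H \<longlongrightarrow> 0) at_top" "(?H \<longlongrightarrow> 0) at_bot"
    by (rule cutoff_tendsto_0[OF p1 l], real_asymp)+
  note I = cell_integral[OF DERIV_cutoff[OF p1 l] b1 b2 m lim i]
  have eq: "cutoff_deriv l p' (u t) * (l - q t + \<bar>u t\<bar> powr p') = (p * W l t - 1) * (1 - q t * W l t / l) / (p - 1)" for t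
  proof -
    have W: "W l t = w (u t)" "v (u t) = 1 - w (u t)" using wv(3)[of "u t"] by (auto simp: W_def w_def)
    have Y: "w (u t) * (l - q t + \<bar>u t\<bar> powr p') / l = 1 - q t * w (u t) / l"
    proof -
      have "l / D * (l - q t + (D - l)) / l = 1 - q t * (l / D) / l" if "D > 0" for D
        using l that by (simp add: field_simps)
      from this[OF pos[of "u t"]] show ?thesis by (simp add: w_def)
    qed
    have "a * b / l * x = b * (a * x / l)" for a b x :: real by simp
    then have "cutoff_deriv l p' (u t) * (l - q t + \<bar>u t\<bar> powr p') = (1 - p' * (1 - w (u t))) * (1 - q t * w (u t) / l)"
      unfolding cd W(2) Y[symmetric] .
    also have "1 - p' * (1 - w (u t)) = (p * w (u t) - 1) / (p - 1)"
      using p by (simp add: field_simps)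
    finally show ?thesis by (simp add: W(1))
  qed
  have "set_integrable lebesgue (nodal_cell n y i) (\<lambda>t. (p - 1) * ((p * W l t - 1) * (1 - q t * W l t / l) / (p - 1)))"
    using I(1) unfolding eq by (rule set_integrable_mult_right)
  then show "set_integrable lebesgue (nodal_cell n y i) (\<lambda>t. (p * W l t - 1) * (1 - q t * W l t / l))"
    using p by simp
  have "(LINT t:nodal_cell n y i|lebesgue. (p * W l t - 1) * (1 - q t * W l t / l) / (p - 1)) = 0"
    using I(2) unfolding eq by simp
  then show "(LINT t:nodal_cell n y i|lebesgue. (p * W l t - 1) * (1 - q t * W l t / l)) = 0"
    using p by simp
qed

end

section \<open>Weighted averages over shrinking cells\<close>

lemma borel_imp_lebesgue_measurable:
  fixes f :: "real \<Rightarrow> real"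
  shows "f \<in> borel_measurable borel \<Longrightarrow> f \<in> borel_measurable lebesgue"
  by (rule measurable_completion) simp

lemma set_integrable_mult_bounded:
  fixes f w :: "real \<Rightarrow> real"
  assumes f: "set_integrable lebesgue A f" and w: "w \<in> borel_measurable borel" "\<And>t. \<bar>w t\<bar> \<le> C"
  shows "set_integrable lebesgue A (\<lambda>t. f t * w t)"
proof (rule set_integrable_bound)
  show "set_integrable lebesgue A (\<lambda>t. C * \<bar>f t\<bar>)"
    using f by (intro set_integrable_mult_right set_integrable_abs)
  have "(\<lambda>t. indicator A t * f t) \<in> borel_measurable lebesgue"
    using f unfolding set_integrable_def by (auto dest: borel_measurable_integrable)
  then have "(\<lambda>t. (indicator A t * f t) * w t) \<in> borel_measurable lebesgue"
    using borel_imp_lebesgue_measurable[OF w(1)] by (rule borel_measurable_times)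
  then show "set_borel_measurable lebesgue A (\<lambda>t. f t * w t)"
    by (simp add: set_borel_measurable_def mult.assoc)
  have "\<bar>f t * w t\<bar> \<le> \<bar>C * \<bar>f t\<bar>\<bar>" for t
  proof -
    have "\<bar>f t\<bar> * \<bar>w t\<bar> \<le> \<bar>f t\<bar> * C" using w(2) by (intro mult_left_mono) auto
    then have "\<bar>f t * w t\<bar> \<le> C * \<bar>f t\<bar>" by (simp only: abs_mult mult.commute)
    then show ?thesis by (rule order_trans[OF _ abs_ge_self])
  qed
  then show "AE t in lebesgue. t \<in> A \<longrightarrow> norm (f t * w t) \<le> norm (C * \<bar>f t\<bar>)"
    by (intro AE_I2) auto
qed

lemma abs_set_integral_mult_le:
  fixes f w :: "real \<Rightarrow> real"
  assumes f: "set_integrable lebesgue A f" and w: "w \<in> borel_measurable borel" "\<And>t. \<bar>w t\<bar> \<le> C"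
  shows "\<bar>LINT t:A|lebesgue. f t * w t\<bar> \<le> C * (LINT t:A|lebesgue. \<bar>f t\<bar>)"
proof -
  have "\<bar>LINT t:A|lebesgue. f t * w t\<bar> \<le> (LINT t:A|lebesgue. \<bar>f t * w t\<bar>)"
    using set_integral_norm_bound[OF set_integrable_mult_bounded[OF f w]] by simp
  also have "\<dots> \<le> (LINT t:A|lebesgue. C * \<bar>f t\<bar>)"
  proof (rule set_integral_mono)
    show "set_integrable lebesgue A (\<lambda>t. \<bar>f t * w t\<bar>)"
      by (intro set_integrable_abs set_integrable_mult_bounded[OF f w])
    show "set_integrable lebesgue A (\<lambda>t. C * \<bar>f t\<bar>)"
      using f by (intro set_integrable_mult_right set_integrable_abs)
    show "\<bar>f t * w t\<bar> \<le> C * \<bar>f t\<bar>" for t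
      using mult_left_mono[OF w(2), of "\<bar>f t\<bar>" t] by (simp add: abs_mult mult.commute)
  qed
  finally show ?thesis by simp
qed

text \<open>The normalisation is by \<open>real n\<close>, not by the measure of the cell, because
  this is the form in which the averages occur in \<open>nodal_F\<close>. The discrepancy is
  controlled by the mesh condition below.\<close>

definition cell_avg :: "(nat \<Rightarrow> nat \<Rightarrow> real set) \<Rightarrow> (real \<Rightarrow> real) \<Rightarrow> (nat \<Rightarrow> real \<Rightarrow> real) \<Rightarrow> nat \<Rightarrow> real \<Rightarrow> real" where
  "cell_avg J f w n x = (\<Sum>i<n. indicator (J n i) x * (real n * (LINT t:J n i|lebesgue. f t * w n t)))"

text \<open>The shape condition is there for differentiation of integrals, which needs intervals.
  The two-piece cell reaches both ends of \<open>{0..<1}\<close>, so as the mesh shrinks it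
  eventually misses any fixed interior point.\<close>

locale cell_partition =
  fixes J :: "nat \<Rightarrow> nat \<Rightarrow> real set" and \<epsilon> :: "nat \<Rightarrow> real"
  assumes J_sets [measurable]: "\<And>n i. J n i \<in> sets borel"
    and J_disj: "\<And>n. n \<ge> 1 \<Longrightarrow> disjoint_family_on (J n) {..<n}"
    and J_union: "\<And>n. n \<ge> 1 \<Longrightarrow> (\<Union>i<n. J n i) = {0..<1}"
    and J_shape: "\<And>n i. n \<ge> 1 \<Longrightarrow> i < n \<Longrightarrow> (\<exists>a b. J n i = {a..<b}) \<or>
        (\<exists>c d. 0 \<le> c \<and> c \<le> d \<and> d < 1 \<and> J n i = {0..<c} \<union> {d..<1})"
    and \<epsilon>: "\<epsilon> \<longlonglongrightarrow> 0"
    and mesh: "\<forall>\<^sub>F n in sequentially. \<forall>i<n. \<bar>real n * measure lebesgue (J n i) - 1\<bar> \<le> \<epsilon> n"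
begin

lemma J_subset: "n \<ge> 1 \<Longrightarrow> i < n \<Longrightarrow> J n i \<subseteq> {0..<1}"
  using J_union by blast

lemma J_lmeasurable: "n \<ge> 1 \<Longrightarrow> i < n \<Longrightarrow> J n i \<in> lmeasurable"
  using J_subset[of n i] J_sets[of n i] by (intro bounded_set_imp_lmeasurable bounded_subset[OF bounded_closed_interval[of 0 1]]) auto

lemma cell_avg_eq:
  assumes "n \<ge> 1" "i < n" "x \<in> J n i"
  shows "cell_avg J f w n x = real n * (LINT t:J n i|lebesgue. f t * w n t)"
proof -
  have "x \<notin> J n j" if "j < n" "j \<noteq> i" for j
    using J_disj[OF assms(1)] assms that unfolding disjoint_family_on_def by blast
  then have "cell_avg J f w n x = (\<Sum>j<n. if j = i then real n * (LINT t:J n i|lebesgue. f t * w n t) else 0)"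
    unfolding cell_avg_def using assms(3) by (intro sum.cong) auto
  then show ?thesis using assms(2) by simp
qed

lemma cell_avg_outside:
  assumes "x \<notin> {0..<1}"
  shows "cell_avg J f w n x = 0"
proof (cases "n \<ge> 1")
  case True
  then have "x \<notin> J n i" if "i < n" for i using J_subset[OF True that] assms by blast
  then show ?thesis unfolding cell_avg_def by (intro sum.neutral) auto
qed (auto simp: cell_avg_def)

lemma integrable_cell_avg: "integrable lebesgue (cell_avg J f w n)"
  unfolding cell_avg_def[abs_def]
proof (intro Bochner_Integration.integrable_sum integrable_mult_left)
  fix i assume "i \<in> {..<n}"
  then have "J n i \<in> lmeasurable" using J_lmeasurable[of n i] by auto
  then show "integrable lebesgue (indicat_real (J n i))"
    by (simp add: fmeasurable_def integrable_indicator_iff)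
qed

lemma integral_cell_avg:
  "(LINT x|lebesgue. cell_avg J f w n x) =
     (\<Sum>i<n. real n * measure lebesgue (J n i) * (LINT t:J n i|lebesgue. f t * w n t))"
proof -
  have "J n i \<in> lmeasurable" if "i < n" for i using J_lmeasurable[of n i] that by auto
  then have "integrable lebesgue (indicat_real (J n i))" if "i < n" for i
    using that by (simp add: fmeasurable_def integrable_indicator_iff)
  then show ?thesis
    unfolding cell_avg_def by (subst Bochner_Integration.integral_sum) (auto simp: mult_ac intro!: sum.cong)
qed

lemma set_integral_cells:
  fixes f :: "real \<Rightarrow> real"
  assumes "n \<ge> 1" "set_integrable lebesgue {0..<1} f"
  shows "(LINT t:{0..<1}|lebesgue. f t) = (\<Sum>i<n. LINT t:J n i|lebesgue. f t)"
proof -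
  have *: "set_integrable lebesgue (J n i) f" if "i < n" for i
    using assms(2) by (rule set_integrable_subset) (use J_subset[OF assms(1) that] in auto)
  have "(LINT t:(\<Union>i\<in>{..<n}. J n i)|lebesgue. f t) = (\<Sum>i\<in>{..<n}. LINT t:J n i|lebesgue. f t)"
    by (rule set_integral_finite_Union) (use J_disj[OF assms(1)] * in auto)
  then show ?thesis by (simp add: J_union[OF assms(1)])
qed

text \<open>On the cell \<open>J n i\<close> that contains \<open>x\<close> the error splits into
  \<open>n\<close> times the integral of \<open>(f t - f x) * w n t\<close>, small at a Lebesgue
  point as the weights are bounded, \<open>f x\<close> times the error of the mean of the weight,
  and \<open>f x\<close> times the mesh error.\<close>

lemma cell_avg_tendsto_AE:
  assumes f: "f absolutely_integrable_on {0..1}"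
    and w: "\<And>n. w n \<in> borel_measurable borel" "\<And>n t. \<bar>w n t\<bar> \<le> C"
    and \<delta>: "\<delta> \<longlonglongrightarrow> 0"
    and wJ: "\<forall>\<^sub>F n in sequentially. \<forall>i<n. \<bar>real n * (LINT t:J n i|lebesgue. w n t - 1)\<bar> \<le> \<delta> n"
  shows "AE x in lebesgue. x \<in> {0<..<1} \<longrightarrow> (\<lambda>n. cell_avg J f w n x) \<longlonglongrightarrow> f x"
  using AE_lebesgue_point[OF f]
proof eventually_elim
  case (elim x)
  show ?case
  proof
    assume x: "x \<in> {0<..<1}"
    have C: "C \<ge> 0" using w(2)[of 0 0] by linarith
    have bound: "\<forall>\<^sub>F n in sequentially. \<bar>cell_avg J f w n x - f x\<bar> \<le> 2 * C * e + \<bar>f x\<bar> * (\<delta> n + \<epsilon> n)" if "e > 0" for e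
    proof -
      obtain d where d: "d > 0" "\<And>u v. u \<le> x \<Longrightarrow> x \<le> v \<Longrightarrow> u < v \<Longrightarrow> v - u < d \<Longrightarrow> integral {u..v} (\<lambda>t. \<bar>f t - f x\<bar>) \<le> e * (v - u)"
        using elim x \<open>e > 0\<close> by blast
      have lim2: "(\<lambda>n. 2 / real n) \<longlonglongrightarrow> 0" by real_asymp
      \<comment> \<open>Once \<open>\<epsilon> n < 1\<close>, cells have measure at most
        \<open>2 / real n\<close>. Being below \<open>d\<close> makes the Lebesgue point estimate
        applicable; being below \<open>x\<close> and \<open>1 - x\<close> excludes the two-piece
        cell.\<close>
      have "\<forall>\<^sub>F n in sequentially. 2 / real n < min d (min x (1 - x))"
        by (rule order_tendstoD(2)[OF lim2]) (use d x in simp)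
      moreover have "\<forall>\<^sub>F n in sequentially. \<epsilon> n < 1" using order_tendstoD(2)[OF \<epsilon>] by auto
      moreover have "\<forall>\<^sub>F n in sequentially. n \<ge> (1::nat)" by (rule eventually_ge_at_top)
      ultimately show ?thesis using mesh wJ
      proof eventually_elim
        case (elim n)
        then have n: "n \<ge> 1" by simp
        have "x \<in> (\<Union>i<n. J n i)" unfolding J_union[OF n] using x by simp
        then obtain i where i: "i < n" "x \<in> J n i" by blast
        define m where "m = measure lebesgue (J n i)"
        have m: "\<bar>real n * m - 1\<bar> \<le> \<epsilon> n" using elim i by (auto simp: m_def)
        then have nm: "real n * m \<le> 2" using elim by linarith
        then have m2: "m \<le> 2 / real n" using n by (simp add: field_simps)
        have "\<exists>a b. J n i = {a..<b}"
        proof (rule ccontr)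
          assume "\<not> ?thesis"
          then obtain c d where cd: "0 \<le> c" "c \<le> d" "d < 1" "J n i = {0..<c} \<union> {d..<1}"
            using J_shape[OF n i(1)] by blast
          have "m = c + (1 - d)"
            unfolding m_def cd(4) by (subst measure_Union) (use cd in auto)
          then have "c \<le> 2 / real n" "1 - d \<le> 2 / real n" using m2 cd by auto
          then show False using i(2) elim unfolding cd(4) by auto
        qed
        then obtain a b where J: "J n i = {a..<b}" by blast
        have ab: "a \<le> x" "x < b" using i J by auto
        have m_eq: "m = b - a" using ab by (simp add: m_def J)
        have "{a..<b} \<subseteq> {0..<1}" using J_subset[OF n i(1)] J by simp
        then have ab01: "0 \<le> a" "b \<le> 1" using ab by auto
        have fJ: "set_integrable lebesgue {a..<b} f"
          using f by (rule set_integrable_subset) (use ab01 in auto)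
        have cJ: "set_integrable lebesgue {a..<b} (\<lambda>t. c)" for c :: real
          by (rule absolutely_integrable_on_const) (rule bounded_set_imp_lmeasurable, auto)
        have fxJ: "set_integrable lebesgue {a..<b} (\<lambda>t. f t - f x)"
          by (intro set_integral_diff fJ cJ)
        have wi: "set_integrable lebesgue {a..<b} (w n)"
          using set_integrable_mult_bounded[OF cJ[of 1] w(1)[of n] w(2)] by simp
        have split: "(LINT t:{a..<b}|lebesgue. f t * w n t) =
            (LINT t:{a..<b}|lebesgue. (f t - f x) * w n t) + f x * (LINT t:{a..<b}|lebesgue. w n t - 1) + f x * m"
        proof -
          have "(LINT t:{a..<b}|lebesgue. f t * w n t) = (LINT t:{a..<b}|lebesgue. (f t - f x) * w n t + f x * (w n t - 1) + f x)"
            by (simp add: algebra_simps)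
          also have "\<dots> = (LINT t:{a..<b}|lebesgue. (f t - f x) * w n t) + (LINT t:{a..<b}|lebesgue. f x * (w n t - 1)) + (LINT t:{a..<b}|lebesgue. f x)"
            using set_integrable_mult_bounded[OF fxJ w(1)[of n] w(2)] wi cJ
            by (subst set_integral_add; (intro set_integral_add set_integrable_mult_right set_integral_diff)?)+ auto
          also have "(LINT t:{a..<b}|lebesgue. f x) = f x * m"
            using ab by (simp add: m_eq set_lebesgue_integral_def)
          finally show ?thesis by simp
        qed
        have "\<bar>LINT t:{a..<b}|lebesgue. (f t - f x) * w n t\<bar> \<le> C * (LINT t:{a..<b}|lebesgue. \<bar>f t - f x\<bar>)"
          by (rule abs_set_integral_mult_le[OF fxJ w])
        also have "(LINT t:{a..<b}|lebesgue. \<bar>f t - f x\<bar>) = integral {a..b} (\<lambda>t. \<bar>f t - f x\<bar>)"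
        proof -
          have "(LINT t:{a..<b}|lebesgue. \<bar>f t - f x\<bar>) = integral {a..<b} (\<lambda>t. \<bar>f t - f x\<bar>)"
            by (rule set_lebesgue_integral_eq_integral(2)) (intro set_integrable_abs fxJ)
          also have "\<dots> = integral {a..b} (\<lambda>t. \<bar>f t - f x\<bar>)"
            by (rule integral_spike_set; rule negligible_subset[of "{b}"]) auto
          finally show ?thesis .
        qed
        also have "C * \<dots> \<le> C * (e * (b - a))"
          using d(2)[of a b] ab m2 elim C m_eq by (intro mult_left_mono) auto
        finally have I1: "\<bar>LINT t:{a..<b}|lebesgue. (f t - f x) * w n t\<bar> \<le> C * (e * m)" by (simp add: m_eq)
        have I1': "\<bar>real n * (LINT t:{a..<b}|lebesgue. (f t - f x) * w n t)\<bar> \<le> 2 * C * e"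
        proof -
          have "\<bar>real n * (LINT t:{a..<b}|lebesgue. (f t - f x) * w n t)\<bar> \<le> real n * (C * (e * m))"
            using I1 by (simp add: abs_mult mult_left_mono)
          also have "\<dots> = C * e * (real n * m)" by simp
          also have "\<dots> \<le> C * e * 2" using nm C \<open>e > 0\<close> by (intro mult_left_mono) auto
          finally show ?thesis by simp
        qed
        have I2: "\<bar>f x * (real n * (LINT t:{a..<b}|lebesgue. w n t - 1))\<bar> \<le> \<bar>f x\<bar> * \<delta> n"
          unfolding abs_mult[of "f x"] using elim i J by (intro mult_left_mono) auto
        have I3: "\<bar>f x * (real n * m - 1)\<bar> \<le> \<bar>f x\<bar> * \<epsilon> n"
          unfolding abs_mult[of "f x"] using m by (intro mult_left_mono) auto
        have "cell_avg J f w n x - f x = real n * (LINT t:{a..<b}|lebesgue. (f t - f x) * w n t) +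
            f x * (real n * (LINT t:{a..<b}|lebesgue. w n t - 1)) + f x * (real n * m - 1)"
          unfolding cell_avg_eq[OF n i] J split by (simp add: algebra_simps)
        then show ?case using I1' I2 I3 by (simp add: distrib_left)
      qed
    qed
    show "(\<lambda>n. cell_avg J f w n x) \<longlonglongrightarrow> f x"
      unfolding tendsto_iff dist_real_def
    proof (intro allI impI)
      fix \<eta> :: real assume \<eta>: "\<eta> > 0"
      define e where "e = \<eta> / (4 * (C + 1))"
      have e: "e > 0" "2 * C * e < \<eta> / 2" using \<eta> C by (auto simp: e_def field_simps)
      have "(\<lambda>n. \<bar>f x\<bar> * (\<delta> n + \<epsilon> n)) \<longlonglongrightarrow> \<bar>f x\<bar> * (0 + 0)"
        by (intro tendsto_intros \<delta> \<epsilon>)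
      then have "\<forall>\<^sub>F n in sequentially. \<bar>f x\<bar> * (\<delta> n + \<epsilon> n) < \<eta> / 2"
        by (rule order_tendstoD(2)) (use \<eta> in simp)
      with bound[OF e(1)] show "\<forall>\<^sub>F n in sequentially. \<bar>cell_avg J f w n x - f x\<bar> < \<eta>"
        by eventually_elim (use e in linarith)
    qed
  qed
qed

lemma AE_extend_indicator:
  assumes "AE x in lebesgue. x \<in> {0<..<1} \<longrightarrow> (\<lambda>n. cell_avg J f w n x) \<longlonglongrightarrow> f x"
  shows "AE x in lebesgue. (\<lambda>n. cell_avg J f w n x) \<longlonglongrightarrow> indicator {0..<1} x * f x"
proof -
  have "AE x in lebesgue. x \<noteq> (0::real)" by (rule AE_lborel_singleton[THEN AE_completion])
  with assms show ?thesis
  proof eventually_elim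
    case (elim x)
    then show ?case by (cases "x \<in> {0..<1}") (auto simp: cell_avg_outside)
  qed
qed

text \<open>For the unweighted averages of a nonnegative function the integrals converge by
  the choice of the mesh, so that Scheffe's lemma applies.\<close>

lemma cell_avg_abs_tendsto_L1:
  assumes f: "f absolutely_integrable_on {0..1}"
  shows "(\<lambda>n. LINT x|lebesgue. \<bar>cell_avg J (\<lambda>t. \<bar>f t\<bar>) (\<lambda>_ _. 1) n x - indicator {0..<1} x * \<bar>f x\<bar>\<bar>) \<longlonglongrightarrow> 0"
proof -
  define g where "g t = \<bar>f t\<bar>" for t
  define A where "A = cell_avg J g (\<lambda>_ _. 1)"
  have f01: "set_integrable lebesgue {0..<1} f" using f by (rule set_integrable_subset) auto
  have g: "g absolutely_integrable_on {0..1}" unfolding g_def using f by (rule set_integrable_abs)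
  have g01: "set_integrable lebesgue {0..<1} g" unfolding g_def using f01 by (rule set_integrable_abs)
  then have g0: "integrable lebesgue (\<lambda>x. indicator {0..<1} x * g x)" by (simp add: set_integrable_def)
  have gJ0: "(LINT t:J n i|lebesgue. g t) \<ge> 0" for n i
    unfolding set_lebesgue_integral_def by (intro integral_nonneg_AE AE_I2) (auto simp: g_def)
  have A0: "A n x \<ge> 0" for n x
    unfolding A_def cell_avg_def using gJ0 by (intro sum_nonneg mult_nonneg_nonneg) auto
  define G where "G = (LINT t:{0..<1}|lebesgue. g t)"
  have G0: "G \<ge> 0" unfolding G_def set_lebesgue_integral_def by (intro integral_nonneg_AE AE_I2) (auto simp: g_def)
  have AE: "AE x in lebesgue. (\<lambda>n. A n x) \<longlonglongrightarrow> indicator {0..<1} x * g x"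
    unfolding A_def
    by (intro AE_extend_indicator cell_avg_tendsto_AE[OF g, where C = 1 and \<delta> = "\<lambda>_. 0"]) auto
  have "(\<lambda>n. \<integral>\<^sup>+ x. norm (A n x - indicator {0..<1} x * g x) \<partial>lebesgue) \<longlonglongrightarrow> 0"
  proof (rule Scheffe_lemma1[OF _ g0 AE])
    show "integrable lebesgue (A n)" for n unfolding A_def by (rule integrable_cell_avg)
    have nf: "(\<integral>\<^sup>+ x. norm (indicator {0..<1} x * g x) \<partial>lebesgue) = ennreal G"
    proof -
      have "(\<integral>\<^sup>+ x. norm (indicator {0..<1} x * g x) \<partial>lebesgue) = (\<integral>\<^sup>+ x. ennreal (indicator {0..<1} x * g x) \<partial>lebesgue)"
        by (intro nn_integral_cong) (simp add: g_def abs_mult)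
      also have "\<dots> = ennreal (LINT x|lebesgue. indicator {0..<1} x * g x)"
        by (rule nn_integral_eq_integral[OF g0]) (auto simp: g_def)
      finally show ?thesis by (simp add: G_def set_lebesgue_integral_def)
    qed
    have "\<forall>\<^sub>F n in sequentially. (\<integral>\<^sup>+ x. norm (A n x) \<partial>lebesgue) \<le> ennreal ((1 + \<epsilon> n) * G)"
      using mesh eventually_ge_at_top[of 1]
    proof eventually_elim
      case (elim n)
      have "(\<integral>\<^sup>+ x. norm (A n x) \<partial>lebesgue) = (\<integral>\<^sup>+ x. ennreal (A n x) \<partial>lebesgue)"
        using A0 by (intro nn_integral_cong) simp
      also have "\<dots> = ennreal (LINT x|lebesgue. A n x)"
        by (rule nn_integral_eq_integral) (use A0 integrable_cell_avg in \<open>auto simp: A_def\<close>)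
      also have "(LINT x|lebesgue. A n x) = (\<Sum>i<n. real n * measure lebesgue (J n i) * (LINT t:J n i|lebesgue. g t))"
        unfolding A_def integral_cell_avg by simp
      also have "\<dots> \<le> (\<Sum>i<n. (1 + \<epsilon> n) * (LINT t:J n i|lebesgue. g t))"
        using elim(1) gJ0 by (intro sum_mono mult_right_mono) (auto simp: abs_le_iff)
      also have "\<dots> = (1 + \<epsilon> n) * G"
        unfolding G_def set_integral_cells[OF elim(2) g01] by (simp add: sum_distrib_left)
      finally show ?case by (simp add: ennreal_leI)
    qed
    then have "limsup (\<lambda>n. \<integral>\<^sup>+ x. norm (A n x) \<partial>lebesgue) \<le> limsup (\<lambda>n. ennreal ((1 + \<epsilon> n) * G))"
      by (rule Limsup_mono)
    also have "\<dots> = ennreal ((1 + 0) * G)"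
      by (intro lim_imp_Limsup tendsto_ennrealI tendsto_intros \<epsilon>) simp
    finally show "limsup (\<lambda>n. \<integral>\<^sup>+ x. norm (A n x) \<partial>lebesgue) \<le> (\<integral>\<^sup>+ x. norm (indicator {0..<1} x * g x) \<partial>lebesgue)"
      unfolding nf by simp
  qed
  moreover have "(\<integral>\<^sup>+ x. norm (A n x - indicator {0..<1} x * g x) \<partial>lebesgue) =
      ennreal (LINT x|lebesgue. \<bar>A n x - indicator {0..<1} x * g x\<bar>)" for n
    unfolding real_norm_def
    by (rule nn_integral_eq_integral) (auto simp: A_def intro!: integrable_abs Bochner_Integration.integrable_diff integrable_cell_avg g0)
  ultimately have "(\<lambda>n. ennreal (LINT x|lebesgue. \<bar>A n x - indicator {0..<1} x * g x\<bar>)) \<longlonglongrightarrow> 0" by simp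
  then have "(\<lambda>n. LINT x|lebesgue. \<bar>A n x - indicator {0..<1} x * g x\<bar>) \<longlonglongrightarrow> 0"
    by (subst (asm) ennreal_tendsto_0_iff) (auto intro!: integral_nonneg_AE)
  then show ?thesis by (simp add: A_def g_def[abs_def])
qed

text \<open>Splitting \<open>\<bar>T - f\<bar>\<close> at the level \<open>(C + 1) \<bar>f\<bar>\<close>: the lower part is dominated, and the excess
  is at most \<open>C\<close> times the error of the unweighted averages of \<open>\<bar>f\<bar>\<close>.\<close>

lemma cell_avg_tendsto_L1:
  assumes f: "f absolutely_integrable_on {0..1}"
    and w: "\<And>n. w n \<in> borel_measurable borel" "\<And>n t. \<bar>w n t\<bar> \<le> C"
    and AE: "AE x in lebesgue. x \<in> {0<..<1} \<longrightarrow> (\<lambda>n. cell_avg J f w n x) \<longlonglongrightarrow> f x"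
  shows "(\<lambda>n. LINT x|lebesgue. \<bar>cell_avg J f w n x - indicator {0..<1} x * f x\<bar>) \<longlonglongrightarrow> 0"
proof -
  define A where "A = cell_avg J (\<lambda>t. \<bar>f t\<bar>) (\<lambda>_ _. 1)"
  define T where "T = cell_avg J f w"
  define f0 where "f0 x = indicator {0..<1} x * f x" for x :: real
  define h where "h n x = min \<bar>T n x - f0 x\<bar> ((C + 1) * \<bar>f0 x\<bar>)" for n x
  have C: "C \<ge> 0" using w(2)[of 0 0] by linarith
  have f01: "set_integrable lebesgue {0..<1} f" using f by (rule set_integrable_subset) auto
  then have f0: "integrable lebesgue f0" by (simp add: f0_def[abs_def] set_integrable_def)
  have Ti: "integrable lebesgue (T n)" for n unfolding T_def by (rule integrable_cell_avg)
  have Ai: "integrable lebesgue (A n)" for n unfolding A_def by (rule integrable_cell_avg)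
  have [measurable]: "f0 \<in> borel_measurable lebesgue" "\<And>n. T n \<in> borel_measurable lebesgue"
    using f0 Ti by auto
  have TA: "\<bar>T n x\<bar> \<le> C * A n x" for n x
  proof (cases "x \<in> {0..<1} \<and> n \<ge> 1")
    case True
    then have n: "n \<ge> 1" by simp
    have "x \<in> (\<Union>i<n. J n i)" unfolding J_union[OF n] using True by simp
    then obtain i where i: "i < n" "x \<in> J n i" by blast
    have "set_integrable lebesgue (J n i) f"
      using f01 by (rule set_integrable_subset) (use J_subset[OF n i(1)] in auto)
    from abs_set_integral_mult_le[OF this w(1)[of n] w(2)]
    have "real n * \<bar>LINT t:J n i|lebesgue. f t * w n t\<bar> \<le> real n * (C * (LINT t:J n i|lebesgue. \<bar>f t\<bar>))"
      by (intro mult_left_mono) auto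
    then show ?thesis unfolding T_def A_def cell_avg_eq[OF n i] by (simp add: abs_mult mult_ac)
  next
    case False
    then show ?thesis using cell_avg_outside by (auto simp: T_def A_def) (auto simp: cell_avg_def)
  qed
  have le: "\<bar>T n x - f0 x\<bar> \<le> h n x + C * \<bar>A n x - \<bar>f0 x\<bar>\<bar>" for n x
  proof (cases "\<bar>T n x - f0 x\<bar> \<le> (C + 1) * \<bar>f0 x\<bar>")
    case True
    then show ?thesis using C by (simp add: h_def)
  next
    case False
    have "C * A n x - C * \<bar>f0 x\<bar> \<le> C * \<bar>A n x - \<bar>f0 x\<bar>\<bar>"
      using C by (simp add: mult_left_mono flip: right_diff_distrib)
    moreover have "\<bar>T n x - f0 x\<bar> \<le> C * A n x + \<bar>f0 x\<bar>" using TA[of n x] by linarith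
    ultimately show ?thesis using False by (simp add: h_def min_def distrib_right)
  qed
  have hb: "0 \<le> h n x" "h n x \<le> \<bar>T n x - f0 x\<bar>" "h n x \<le> (C + 1) * \<bar>f0 x\<bar>" for n x
    using C by (simp_all add: h_def)
  have hlim: "(\<lambda>n. LINT x|lebesgue. h n x) \<longlonglongrightarrow> (LINT x|(lebesgue :: real measure). 0)"
  proof (rule integral_dominated_convergence)
    show "integrable lebesgue (\<lambda>x. (C + 1) * \<bar>f0 x\<bar>)" using f0 by (intro integrable_mult_right integrable_abs)
    show "h n \<in> borel_measurable lebesgue" for n unfolding h_def[abs_def] by measurable
    show "AE x in lebesgue. norm (h n x) \<le> (C + 1) * \<bar>f0 x\<bar>" for n
      by (intro AE_I2) (simp add: hb)
    show "AE x in lebesgue. (\<lambda>n. h n x) \<longlonglongrightarrow> 0"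
      using AE_extend_indicator[OF AE]
    proof eventually_elim
      case (elim x)
      then have "(\<lambda>n. \<bar>T n x - f0 x\<bar>) \<longlonglongrightarrow> \<bar>f0 x - f0 x\<bar>"
        unfolding T_def f0_def by (intro tendsto_intros)
      then have lim: "(\<lambda>n. \<bar>T n x - f0 x\<bar>) \<longlonglongrightarrow> 0" by simp
      show ?case
        by (rule Lim_null_comparison[OF _ lim], intro always_eventually allI)
          (simp add: hb)
    qed
  qed simp
  have hi: "integrable lebesgue (h n)" for n
  proof (rule Bochner_Integration.integrable_bound)
    show "integrable lebesgue (\<lambda>x. (C + 1) * \<bar>f0 x\<bar>)" using f0 by (intro integrable_mult_right integrable_abs)
    show "h n \<in> borel_measurable lebesgue" unfolding h_def[abs_def] by measurable
    show "AE x in lebesgue. norm (h n x) \<le> norm ((C + 1) * \<bar>f0 x\<bar>)"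
      using C by (intro AE_I2) (simp add: hb abs_mult)
  qed
  have Af: "integrable lebesgue (\<lambda>x. C * \<bar>A n x - \<bar>f0 x\<bar>\<bar>)" for n
    using Ai f0 by (intro integrable_mult_right integrable_abs Bochner_Integration.integrable_diff)
  have "(\<lambda>n. LINT x|lebesgue. \<bar>A n x - \<bar>f0 x\<bar>\<bar>) \<longlonglongrightarrow> 0"
    using cell_avg_abs_tendsto_L1[OF f] by (simp add: A_def f0_def abs_mult)
  from tendsto_add[OF hlim tendsto_mult_left[OF this, of C]]
  have "(\<lambda>n. (LINT x|lebesgue. h n x) + C * (LINT x|lebesgue. \<bar>A n x - \<bar>f0 x\<bar>\<bar>)) \<longlonglongrightarrow> 0" by simp
  then have "(\<lambda>n. LINT x|lebesgue. \<bar>T n x - f0 x\<bar>) \<longlonglongrightarrow> 0"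
  proof (rule Lim_null_comparison[rotated], intro always_eventually allI)
    fix n
    have "(LINT x|lebesgue. \<bar>T n x - f0 x\<bar>) \<le> (LINT x|lebesgue. h n x + C * \<bar>A n x - \<bar>f0 x\<bar>\<bar>)"
      by (intro integral_mono le integrable_abs Bochner_Integration.integrable_diff Bochner_Integration.integrable_add hi Af Ti f0)
    also have "\<dots> = (LINT x|lebesgue. h n x) + C * (LINT x|lebesgue. \<bar>A n x - \<bar>f0 x\<bar>\<bar>)"
      by (subst Bochner_Integration.integral_add[OF hi Af]) simp
    finally show "norm (LINT x|lebesgue. \<bar>T n x - f0 x\<bar>) \<le> (LINT x|lebesgue. h n x) + C * (LINT x|lebesgue. \<bar>A n x - \<bar>f0 x\<bar>\<bar>)"
      by simp
  qed
  then show ?thesis by (simp add: T_def f0_def)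
qed

text \<open>Convergence in the mean gives convergence of the integrals of the averages. These differ
  from the weighted integrals only by the factors \<open>real n * measure lebesgue (J n i)\<close>,
  and replacing the factors by 1 costs at most \<open>\<epsilon> n * C\<close> times the integral of
  \<open>\<bar>f\<bar>\<close>.\<close>

lemma weighted_integral_tendsto:
  assumes f: "f absolutely_integrable_on {0..1}"
    and w: "\<And>n. w n \<in> borel_measurable borel" "\<And>n t. \<bar>w n t\<bar> \<le> C"
    and L1: "(\<lambda>n. LINT x|lebesgue. \<bar>cell_avg J f w n x - indicator {0..<1} x * f x\<bar>) \<longlonglongrightarrow> 0"
  shows "(\<lambda>n. LINT t:{0..<1}|lebesgue. f t * w n t) \<longlonglongrightarrow> (LINT t:{0..<1}|lebesgue. f t)"
proof -
  have f01: "set_integrable lebesgue {0..<1} f" using f by (rule set_integrable_subset) auto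
  then have f0: "integrable lebesgue (\<lambda>x. indicator {0..<1} x * f x)" by (simp add: set_integrable_def)
  define G where "G = (LINT t:{0..<1}|lebesgue. \<bar>f t\<bar>)"
  define I where "I n = (LINT x|lebesgue. \<bar>cell_avg J f w n x - indicator {0..<1} x * f x\<bar>)" for n
  have "(\<lambda>n. (LINT t:{0..<1}|lebesgue. f t * w n t) - (LINT t:{0..<1}|lebesgue. f t)) \<longlonglongrightarrow> 0"
  proof (rule Lim_null_comparison)
    show "(\<lambda>n. I n + \<epsilon> n * (C * G)) \<longlonglongrightarrow> 0"
      using tendsto_add[OF L1 tendsto_mult_right[OF \<epsilon>, of "C * G"]] by (simp add: I_def)
    show "\<forall>\<^sub>F n in sequentially. norm ((LINT t:{0..<1}|lebesgue. f t * w n t) - (LINT t:{0..<1}|lebesgue. f t)) \<le> I n + \<epsilon> n * (C * G)"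
      using mesh eventually_ge_at_top[of 1]
    proof eventually_elim
      case (elim n)
      have fw: "set_integrable lebesgue {0..<1} (\<lambda>t. f t * w n t)"
        by (rule set_integrable_mult_bounded[OF f01 w])
      have fJ: "set_integrable lebesgue (J n i) f" if "i < n" for i
        using f01 by (rule set_integrable_subset) (use J_subset[OF elim(2) that] in auto)
      have "\<bar>(LINT x|lebesgue. cell_avg J f w n x) - (LINT t:{0..<1}|lebesgue. f t)\<bar> =
          \<bar>LINT x|lebesgue. cell_avg J f w n x - indicator {0..<1} x * f x\<bar>"
        unfolding set_lebesgue_integral_def using f0
        by (subst Bochner_Integration.integral_diff[OF integrable_cell_avg]) auto
      also have "\<dots> \<le> I n"
        unfolding I_def by (rule integral_abs_bound)
      finally have 1: "\<bar>(LINT x|lebesgue. cell_avg J f w n x) - (LINT t:{0..<1}|lebesgue. f t)\<bar> \<le> I n" .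
      have "(LINT x|lebesgue. cell_avg J f w n x) - (LINT t:{0..<1}|lebesgue. f t * w n t) =
          (\<Sum>i<n. (real n * measure lebesgue (J n i) - 1) * (LINT t:J n i|lebesgue. f t * w n t))"
        unfolding integral_cell_avg set_integral_cells[OF elim(2) fw]
        by (simp add: sum_subtractf left_diff_distrib)
      also have "\<bar>\<dots>\<bar> \<le> (\<Sum>i<n. \<epsilon> n * (C * (LINT t:J n i|lebesgue. \<bar>f t\<bar>)))"
      proof (rule order_trans[OF sum_abs], rule sum_mono)
        fix i assume "i \<in> {..<n}"
        then have i: "i < n" by simp
        have e0: "\<epsilon> n \<ge> 0" using elim(1) i abs_ge_zero order_trans by blast
        show "\<bar>(real n * measure lebesgue (J n i) - 1) * (LINT t:J n i|lebesgue. f t * w n t)\<bar> \<le> \<epsilon> n * (C * (LINT t:J n i|lebesgue. \<bar>f t\<bar>))"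
          unfolding abs_mult using elim(1) i e0
          by (intro mult_mono abs_set_integral_mult_le[OF fJ[OF i] w]) auto
      qed
      also have "\<dots> = \<epsilon> n * (C * G)"
        unfolding G_def set_integral_cells[OF elim(2) set_integrable_abs[OF f01]] by (simp add: sum_distrib_left)
      finally have 2: "\<bar>(LINT x|lebesgue. cell_avg J f w n x) - (LINT t:{0..<1}|lebesgue. f t * w n t)\<bar> \<le> \<epsilon> n * (C * G)" .
      show ?case using 1 2 unfolding real_norm_def by linarith
    qed
  qed
  then show ?thesis by (rule LIM_zero_cancel)
qed

end

section \<open>Asymptotics of eigenvalues and nodal lengths\<close>

lemma pi_hat_pos: "p > 1 \<Longrightarrow> pi_hat p > 0"
proof -
  assume p: "p > 1"
  then have "0 < pi / p" "pi / p < pi" by (auto simp: field_simps)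
  then have "sin (pi / p) > 0" by (rule sin_gt_zero)
  then show ?thesis using p by (simp add: pi_hat_def)
qed

context rot
begin

abbreviation "cell \<equiv> nodal_cell n y"

definition "Q = (LINT t:{0..<1}|lebesgue. \<bar>q t\<bar>)"

lemma q01: "set_integrable lebesgue {0..<1} q"
  using q_int by (rule set_integrable_subset) auto

lemma q_cell: "i < n \<Longrightarrow> set_integrable lebesgue (cell i) q"
  by (rule set_integrable_subset[OF q01]) (use cell_subset in auto)

lemma const_cell: "i < n \<Longrightarrow> set_integrable lebesgue (cell i) (\<lambda>_. c::real)"
  by (rule absolutely_integrable_on_const)
    (use cell_subset[of i] in \<open>auto intro!: bounded_set_imp_lmeasurable bounded_subset[OF bounded_closed_interval[of 0 1]]\<close>)

lemma sum_cells:
  fixes f :: "real \<Rightarrow> real"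
  assumes "set_integrable lebesgue {0..<1} f"
  shows "(\<Sum>i<n. LINT t:cell i|lebesgue. f t) = (LINT t:{0..<1}|lebesgue. f t)"
proof -
  have *: "set_integrable lebesgue (cell i) f" if "i < n" for i
    using assms by (rule set_integrable_subset) (use cell_subset[OF that] in auto)
  have "(LINT t:(\<Union>i\<in>{..<n}. cell i)|lebesgue. f t) = (\<Sum>i\<in>{..<n}. LINT t:cell i|lebesgue. f t)"
    by (rule set_integral_finite_Union) (use cell_disjoint * in auto)
  then show ?thesis by (simp add: cell_union)
qed

lemma integral_abs_q_cell_le:
  assumes "i < n"
  shows "(LINT t:cell i|lebesgue. \<bar>q t\<bar>) \<le> Q"
proof -
  have "(LINT t:cell i|lebesgue. \<bar>q t\<bar>) \<le> (\<Sum>i<n. LINT t:cell i|lebesgue. \<bar>q t\<bar>)"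
    using assms by (intro member_le_sum)
      (auto simp: set_lebesgue_integral_def intro!: integral_nonneg_AE)
  also have "\<dots> = Q" unfolding Q_def by (rule sum_cells[OF set_integrable_abs[OF q01]])
  finally show ?thesis .
qed

lemma measure_cell: "i < n \<Longrightarrow> (LINT t:cell i|lebesgue. c) = c * measure lebesgue (cell i)" for c :: real
  by (simp add: set_lebesgue_integral_def)

lemma sum_measure_cells: "(\<Sum>i<n. measure lebesgue (cell i)) = 1"
proof -
  have "set_integrable lebesgue {0..<1::real} (\<lambda>_. 1::real)"
    by (rule absolutely_integrable_on_const) (rule bounded_set_imp_lmeasurable, auto)
  from sum_cells[OF this] show ?thesis
    using measure_cell[where c = 1] by (simp add: set_lebesgue_integral_def)
qed

lemma eigenvalue_le_imp:
  assumes \<mu>: "\<mu> > 0" and l: "l \<le> \<mu>"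
  shows "real n * (pi_hat p * \<mu> powr (- 1 / p)) \<le> 1 + Q / \<mu>"
proof -
  have "pi_hat p * \<mu> powr (- 1 / p) \<le> measure lebesgue (cell i) + (LINT t:cell i|lebesgue. \<bar>q t\<bar>) / \<mu>" if i: "i < n" for i
  proof -
    have "pi_hat p * \<mu> powr (- 1 / p) = (LINT t:cell i|lebesgue. 1 + (l - \<mu> - q t) / \<mu> * W \<mu> t)"
      using cell_integral_arctan(2)[OF \<mu> i] by simp
    also have "\<dots> \<le> (LINT t:cell i|lebesgue. 1 + \<bar>q t\<bar> / \<mu>)"
    proof (rule set_integral_mono[OF cell_integral_arctan(1)[OF \<mu> i]])
      show "set_integrable lebesgue (cell i) (\<lambda>t. 1 + \<bar>q t\<bar> / \<mu>)"
        using q_cell[OF i] const_cell[OF i] by (intro set_integral_add set_integrable_divide set_integrable_abs)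
      fix t
      have W: "0 \<le> W \<mu> t" "W \<mu> t \<le> 1" using W_bounds[OF \<mu>] by auto
      have "(l - \<mu> - q t) / \<mu> * W \<mu> t \<le> \<bar>q t\<bar> / \<mu> * W \<mu> t"
        using l \<mu> W by (intro mult_right_mono divide_right_mono) auto
      also have "\<dots> \<le> \<bar>q t\<bar> / \<mu> * 1" using W \<mu> by (intro mult_left_mono) auto
      finally show "1 + (l - \<mu> - q t) / \<mu> * W \<mu> t \<le> 1 + \<bar>q t\<bar> / \<mu>" by simp
    qed
    also have "\<dots> = measure lebesgue (cell i) + (LINT t:cell i|lebesgue. \<bar>q t\<bar>) / \<mu>"
      using q_cell[OF i] const_cell[OF i] measure_cell[OF i, of 1]
      by (subst set_integral_add) (auto intro!: set_integrable_divide set_integrable_abs)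
    finally show ?thesis .
  qed
  then have "(\<Sum>i<n. pi_hat p * \<mu> powr (- 1 / p)) \<le> (\<Sum>i<n. measure lebesgue (cell i) + (LINT t:cell i|lebesgue. \<bar>q t\<bar>) / \<mu>)"
    by (intro sum_mono) auto
  also have "\<dots> = 1 + Q / \<mu>"
    unfolding Q_def sum.distrib sum_measure_cells sum_divide_distrib[symmetric]
      sum_cells[OF set_integrable_abs[OF q01]] ..
  finally show ?thesis by simp
qed

lemma nodal_length_eq:
  assumes l: "l > 0" and i: "i < n"
  shows "measure lebesgue (cell i) = pi_hat p * l powr (- 1 / p) + (LINT t:cell i|lebesgue. q t * W l t) / l"
proof -
  have qW: "set_integrable lebesgue (cell i) (\<lambda>t. q t * W l t)"
    using W_bounds[OF l] by (intro set_integrable_mult_bounded[OF q_cell[OF i], where C = 1] borel_measurable_W) auto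
  have "pi_hat p * l powr (- 1 / p) = (LINT t:cell i|lebesgue. 1 - q t * W l t / l)"
    using cell_integral_arctan(2)[OF l i] by simp
  also have "\<dots> = measure lebesgue (cell i) - (LINT t:cell i|lebesgue. q t * W l t) / l"
    using qW const_cell[OF i] measure_cell[OF i, of 1]
    by (subst set_integral_diff) (auto intro!: set_integrable_divide)
  finally show ?thesis by simp
qed

definition "IW = (LINT t:{0..<1}|lebesgue. q t * W l t)"

lemma abs_integral_qW_le:
  assumes "l > 0"
  shows "\<bar>IW\<bar> \<le> Q" and "i < n \<Longrightarrow> \<bar>LINT t:cell i|lebesgue. q t * W l t\<bar> \<le> Q"
proof -
  have W: "\<bar>W l t\<bar> \<le> 1" for t using W_bounds[OF assms, of t] by simp
  show "\<bar>IW\<bar> \<le> Q"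
    using abs_set_integral_mult_le[OF q01 borel_measurable_W W] by (simp add: IW_def Q_def)
  show "\<bar>LINT t:cell i|lebesgue. q t * W l t\<bar> \<le> Q" if "i < n"
    using abs_set_integral_mult_le[OF q_cell[OF that] borel_measurable_W W] integral_abs_q_cell_le[OF that] by simp
qed

text \<open>The cells fill a period, so their lengths add up to 1. This is an implicit equation for
  the eigenvalue, from which its leading asymptotics is read off.\<close>

lemma sum_nodal_lengths:
  assumes l: "l > 0"
  shows "real n * (pi_hat p * l powr (- 1 / p)) = 1 - IW / l"
proof -
  have "set_integrable lebesgue {0..<1} (\<lambda>t. q t * W l t)"
    using W_bounds[OF l] by (intro set_integrable_mult_bounded[OF q01, where C = 1] borel_measurable_W) auto
  from sum_cells[OF this] have "(\<Sum>i<n. (LINT t:cell i|lebesgue. q t * W l t) / l) = IW / l"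
    by (simp add: IW_def flip: sum_divide_distrib)
  moreover have "(\<Sum>i<n. measure lebesgue (cell i)) = (\<Sum>i<n. pi_hat p * l powr (- 1 / p) + (LINT t:cell i|lebesgue. q t * W l t) / l)"
    by (intro sum.cong nodal_length_eq[OF l]) auto
  then have "1 = (\<Sum>i<n. pi_hat p * l powr (- 1 / p) + (LINT t:cell i|lebesgue. q t * W l t) / l)"
    unfolding sum_measure_cells .
  ultimately show ?thesis by (simp add: sum.distrib)
qed

text \<open>The unknown term with \<open>l powr (- 1 / p)\<close> occurs in the length of every cell
  and in their sum, and is eliminated exactly; no finer expansion of the eigenvalue is
  required.\<close>

lemma scaled_nodal_length:
  assumes l: "l > 0" and i: "i < n"
  shows "real n * measure lebesgue (cell i) - 1 = (real n * (LINT t:cell i|lebesgue. q t * W l t) - IW) / l"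
  unfolding nodal_length_eq[OF l i] using sum_nodal_lengths[OF l]
  by (simp add: algebra_simps diff_divide_distrib)

lemma mesh_bound:
  assumes l: "l > 0" and i: "i < n"
  shows "\<bar>real n * measure lebesgue (cell i) - 1\<bar> \<le> (real n + 1) * Q / l"
proof -
  have "\<bar>real n * (LINT t:cell i|lebesgue. q t * W l t) - IW\<bar> \<le> real n * \<bar>LINT t:cell i|lebesgue. q t * W l t\<bar> + \<bar>IW\<bar>"
    using abs_triangle_ineq4[of "real n * (LINT t:cell i|lebesgue. q t * W l t)" IW] by (simp add: abs_mult)
  also have "\<dots> \<le> real n * Q + Q"
    using abs_integral_qW_le[OF l] i by (intro add_mono mult_left_mono) auto
  finally show ?thesis
    unfolding scaled_nodal_length[OF l i] using l by (simp add: distrib_right divide_right_mono)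
qed

text \<open>Rearranging the cutoff identity expresses the left side as the integral of
  \<open>q * W * (p * W - 1)\<close> divided by \<open>l\<close>, and the factor of \<open>q\<close>
  is at most \<open>p\<close> in absolute value. The bound survives multiplication by
  \<open>n\<close> in the limit.\<close>

lemma weight_bound:
  assumes l: "l > 0" and i: "i < n"
  shows "\<bar>LINT t:cell i|lebesgue. p * W l t - 1\<bar> \<le> p * Q / l"
proof -
  define v where "v t = W l t * (p * W l t - 1)" for t
  have W: "0 \<le> W l t" "W l t \<le> 1" for t using W_bounds[OF l] by auto
  have v: "\<bar>v t\<bar> \<le> p" for t
  proof -
    have "p * W l t \<le> p * 1" "0 \<le> p * W l t"
      using W[of t] p by (intro mult_left_mono mult_nonneg_nonneg; simp)+
    then have "\<bar>p * W l t - 1\<bar> \<le> p" using p by linarith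
    then have "\<bar>W l t\<bar> * \<bar>p * W l t - 1\<bar> \<le> 1 * p" using W[of t] by (intro mult_mono) auto
    then show ?thesis by (simp add: v_def abs_mult)
  qed
  have vm: "v \<in> borel_measurable borel" unfolding v_def[abs_def] by measurable
  have qv: "set_integrable lebesgue (cell i) (\<lambda>t. q t * v t)"
    by (rule set_integrable_mult_bounded[OF q_cell[OF i] vm v])
  have W1: "set_integrable lebesgue (cell i) (\<lambda>t. p * W l t - 1)"
    using set_integrable_mult_bounded[OF const_cell[OF i, of p] borel_measurable_W, of l 1] W const_cell[OF i]
    by (intro set_integral_diff) auto
  have "0 = (LINT t:cell i|lebesgue. (p * W l t - 1) * (1 - q t * W l t / l))"
    using cell_integral_cutoff(2)[OF l i] by simp
  also have "\<dots> = (LINT t:cell i|lebesgue. (p * W l t - 1) - q t * v t / l)"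
    by (rule arg_cong[where f = "set_lebesgue_integral lebesgue (cell i)"]) (auto simp: v_def algebra_simps)
  also have "\<dots> = (LINT t:cell i|lebesgue. p * W l t - 1) - (LINT t:cell i|lebesgue. q t * v t) / l"
    using qv W1 by (subst set_integral_diff) (auto intro!: set_integrable_divide)
  finally have "(LINT t:cell i|lebesgue. p * W l t - 1) = (LINT t:cell i|lebesgue. q t * v t) / l" by simp
  moreover have "\<bar>LINT t:cell i|lebesgue. q t * v t\<bar> \<le> p * Q"
  proof -
    have "\<bar>LINT t:cell i|lebesgue. q t * v t\<bar> \<le> p * (LINT t:cell i|lebesgue. \<bar>q t\<bar>)"
      by (rule abs_set_integral_mult_le[OF q_cell[OF i] vm v])
    also have "\<dots> \<le> p * Q" using p by (intro mult_left_mono integral_abs_q_cell_le i) auto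
    finally show ?thesis .
  qed
  ultimately show ?thesis using l by (simp add: abs_divide divide_right_mono)
qed

lemma nodal_F_cell:
  assumes "i < n" "x \<in> cell i"
  shows "nodal_F p q n y x = p * (real n * pi_hat p) powr p * (real n * measure lebesgue (cell i) - 1)
     + (LINT t:{0..1}|lebesgue. q t)"
  by (simp add: nodal_F_def nodal_length_cell[OF assms])

lemma cell_lmeasurable: "i < n \<Longrightarrow> cell i \<in> lmeasurable"
  using cell_subset[of i] by (auto intro!: bounded_set_imp_lmeasurable bounded_subset[OF bounded_closed_interval[of 0 1]])

lemma nodal_F_integrable: "nodal_F p q n y absolutely_integrable_on {0<..<1}"
proof -
  define c where "c i = p * (real n * pi_hat p) powr p * (real n * measure lebesgue (cell i) - 1)
     + (LINT t:{0..1}|lebesgue. q t)" for i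
  have "nodal_F p q n y x = (\<Sum>i<n. indicator (cell i) x * c i)" if x: "x \<in> {0<..<1}" for x
  proof -
    have "x \<in> (\<Union>i<n. cell i)" unfolding cell_union using x by simp
    then obtain i where i: "i < n" "x \<in> cell i" by blast
    have "x \<notin> cell j" if "j < n" "j \<noteq> i" for j
      using cell_disjoint i that unfolding disjoint_family_on_def by blast
    then have "(\<Sum>j<n. indicator (cell j) x * c j) = (\<Sum>j<n. if j = i then c i else 0)"
      using i by (intro sum.cong) auto
    then show ?thesis using i nodal_F_cell[OF i] by (simp add: c_def)
  qed
  moreover have "integrable lebesgue (\<lambda>x. \<Sum>i<n. indicator (cell i) x * c i)"
  proof (intro Bochner_Integration.integrable_sum integrable_mult_left)
    fix i assume "i \<in> {..<n}"
    then show "integrable lebesgue (indicat_real (cell i))"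
      using cell_lmeasurable[of i] by (simp add: fmeasurable_def integrable_indicator_iff)
  qed
  then have "set_integrable lebesgue {0<..<1} (\<lambda>x. \<Sum>i<n. indicator (cell i) x * c i)"
    unfolding set_integrable_def by (rule integrable_mult_indicator[rotated]) simp
  ultimately show ?thesis
    using set_integrable_cong[of lebesgue lebesgue "{0<..<1}" "{0<..<1}" "nodal_F p q n y" "\<lambda>x. \<Sum>i<n. indicator (cell i) x * c i"] by simp
qed

end

text \<open>The whole sequence is treated at once, since both kinds of boundary conditions lead to
  the same identities; the two cases of the theorem are subsequences.\<close>

lemma nodal_F_converges:
  fixes p :: real and q :: "real \<Rightarrow> real" and lam :: "nat \<Rightarrow> real" and y :: "nat \<Rightarrow> real \<Rightarrow> real"
  assumes p: "p > 1" and q: "q absolutely_integrable_on {0<..<1}"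
    and y: "\<And>n. n \<ge> 1 \<Longrightarrow> rot_eigenfunction p q n (lam n) (y n)"
  shows "conv_ae01 (\<lambda>n. nodal_F p q n (y n)) q \<and> conv_L1_01 (\<lambda>n. nodal_F p q n (y n)) q"
proof -
  have neg: "negligible {x \<in> {0..1} - {0<..<1}. q x \<noteq> 0}" "negligible {x \<in> {0<..<1} - {0..1}. q x \<noteq> 0}"
    by (rule negligible_subset[of "{0, 1::real}"]; auto)+
  have q01: "q absolutely_integrable_on {0..1}"
    using q absolutely_integrable_spike_set_eq[OF neg] by simp
  have rot: "rot p q n (lam n) (y n)" if "n \<ge> 1" for n
    using p that y[OF that] q01 by unfold_locales
  define Q where "Q = (LINT t:{0..<1}|lebesgue. \<bar>q t\<bar>)"
  have Q_eq: "rot.Q q = Q" using rot.Q_def[OF rot[OF order_refl]] by (simp add: Q_def)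
  define Iq where "Iq = (LINT t:{0..1}|lebesgue. q t)"
  have Iq_eq: "Iq = (LINT t:{0..<1}|lebesgue. q t)"
  proof -
    have 1: "set_integrable lebesgue {0..<1} q" using q01 by (rule set_integrable_subset) auto
    have "integral {0..<1} q = integral {0..1} q"
      by (rule integral_spike_set; rule negligible_subset[of "{1::real}"]) auto
    then show ?thesis
      unfolding Iq_def by (simp add: set_lebesgue_integral_eq_integral(2)[OF q01] set_lebesgue_integral_eq_integral(2)[OF 1])
  qed
  have lam_ge: "\<forall>\<^sub>F n in sequentially. lam n > \<mu>" if \<mu>: "\<mu> > 0" for \<mu>
  proof -
    define k where "k = pi_hat p * \<mu> powr (- 1 / p)"
    have k: "k > 0" using pi_hat_pos[OF p] \<mu> by (simp add: k_def)
    obtain N :: nat where N: "1 + Q / \<mu> < real N * k" using reals_Archimedean3[OF k] by blast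
    have "lam n > \<mu>" if n: "n \<ge> max N 1" for n
    proof (rule ccontr)
      assume "\<not> ?thesis"
      then have "real n * k \<le> 1 + Q / \<mu>"
        using rot.eigenvalue_le_imp[OF rot \<mu>, of n] n Q_eq by (simp add: k_def)
      moreover have "real N * k \<le> real n * k" using n k by (intro mult_right_mono) auto
      ultimately show False using N by simp
    qed
    then show ?thesis unfolding eventually_sequentially by blast
  qed
  have lam_top: "filterlim lam at_top sequentially"
    unfolding filterlim_at_top_dense
  proof
    fix Z
    have "\<forall>\<^sub>F n in sequentially. lam n > max Z 1" by (rule lam_ge) simp
    then show "\<forall>\<^sub>F n in sequentially. Z < lam n" by eventually_elim simp
  qed
  have lam_pos: "\<forall>\<^sub>F n in sequentially. lam n > 0 \<and> n \<ge> 1"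
    using lam_ge[OF zero_less_one] eventually_ge_at_top[of 1] by eventually_elim auto
  \<comment> \<open>The default 0 covers \<open>n = 0\<close> and the finitely many nonpositive
    eigenvalues, so that the bound by \<open>Q\<close> holds for every \<open>n\<close>.\<close>
  define IW where "IW n = (if lam n > 0 \<and> n \<ge> 1 then rot.IW p q (lam n) (y n) else 0)" for n
  define r where "r n = real n * (pi_hat p * lam n powr (- 1 / p))" for n
  have r_eq: "\<forall>\<^sub>F n in sequentially. 1 - IW n / lam n = r n"
    using lam_pos
  proof eventually_elim
    case (elim n)
    then show ?case using rot.sum_nodal_lengths[OF rot, of n] by (simp add: IW_def r_def)
  qed
  have Q0: "Q \<ge> 0" unfolding Q_def set_lebesgue_integral_def by (intro integral_nonneg_AE AE_I2) auto
  have IW_le: "\<bar>IW n\<bar> \<le> Q" for n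
    using rot.abs_integral_qW_le(1)[OF rot, of n] Q_eq Q0 by (auto simp: IW_def)
  have inv: "(\<lambda>n. c / lam n) \<longlonglongrightarrow> 0" for c
    using lam_top by (intro tendsto_divide_0[OF tendsto_const] filterlim_at_top_imp_at_infinity)
  have "(\<lambda>n. IW n / lam n) \<longlonglongrightarrow> 0"
  proof (rule Lim_null_comparison[OF _ inv[of Q]])
    show "\<forall>\<^sub>F n in sequentially. norm (IW n / lam n) \<le> Q / lam n"
      using lam_pos by eventually_elim (use IW_le in \<open>simp add: abs_divide divide_right_mono\<close>)
  qed
  then have "(\<lambda>n. 1 - IW n / lam n) \<longlonglongrightarrow> 1 - 0" by (intro tendsto_intros)
  then have r1: "r \<longlonglongrightarrow> 1" using Lim_transform_eventually[OF _ r_eq] by simp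
  \<comment> \<open>\<open>n / lam n\<close> is \<open>r n / pi_hat p\<close> times a power of
    \<open>lam n\<close> with exponent \<open>1 / p - 1 < 0\<close>. This one rate makes both error
    sequences below vanish.\<close>
  have n_lam: "(\<lambda>n. real n / lam n) \<longlonglongrightarrow> 0"
  proof -
    have "((\<lambda>n. lam n powr (1 / p - 1)) \<longlongrightarrow> 0) sequentially"
      using p by (intro tendsto_neg_powr lam_top) (auto simp: field_simps)
    then have "(\<lambda>n. r n * lam n powr (1 / p - 1) / pi_hat p) \<longlonglongrightarrow> 1 * 0 / pi_hat p"
      using pi_hat_pos[OF p] by (intro tendsto_intros r1) auto
    moreover have "\<forall>\<^sub>F n in sequentially. r n * lam n powr (1 / p - 1) / pi_hat p = real n / lam n"
      using lam_pos
    proof eventually_elim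
      case (elim n)
      have "lam n powr (- 1 / p) * lam n powr (1 / p - 1) = lam n powr (- 1 / p + (1 / p - 1))"
        by (rule powr_add[symmetric])
      also have "\<dots> = 1 / lam n" using elim by (simp add: powr_minus_divide)
      finally show ?case using pi_hat_pos[OF p] by (simp add: r_def mult.assoc)
    qed
    ultimately show ?thesis using Lim_transform_eventually by fastforce
  qed
  define c where "c n = (real n * pi_hat p) powr p / lam n" for n
  have c1: "c \<longlonglongrightarrow> 1"
  proof -
    have "(\<lambda>n. r n powr p) \<longlonglongrightarrow> 1 powr p" by (intro tendsto_powr r1 tendsto_const) simp
    moreover have "\<forall>\<^sub>F n in sequentially. r n powr p = c n"
      using lam_pos
    proof eventually_elim
      case (elim n)
      have "r n powr p = (real n * pi_hat p) powr p * (lam n powr (- 1 / p)) powr p"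
        using pi_hat_pos[OF p] by (simp add: r_def powr_mult[symmetric] mult.assoc)
      also have "(lam n powr (- 1 / p)) powr p = 1 / lam n"
        unfolding powr_powr using elim p by (simp add: powr_minus_divide)
      finally show ?case by (simp add: c_def)
    qed
    ultimately show ?thesis using Lim_transform_eventually by fastforce
  qed
  define J where "J n i = nodal_cell n (y n) i" for n i
  define w where "w n t = (if lam n > 0 \<and> n \<ge> 1 then p * rot.W p (y n) (lam n) t else 0)" for n t
  have wm: "w n \<in> borel_measurable borel" for n
  proof (cases "lam n > 0 \<and> n \<ge> 1")
    case True
    then have "rot.W p (y n) (lam n) \<in> borel_measurable borel"
      using rot.borel_measurable_W[OF rot] by blast
    then show ?thesis using True by (simp add: w_def[abs_def])
  next
    case False
    then have "w n = (\<lambda>_. 0)" by (auto simp: w_def)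
    then show ?thesis by simp
  qed
  have wb: "\<bar>w n t\<bar> \<le> p" for n t
  proof (cases "lam n > 0 \<and> n \<ge> 1")
    case True
    then have "0 \<le> rot.W p (y n) (lam n) t" "rot.W p (y n) (lam n) t \<le> 1"
      using rot.W_bounds[OF rot] by auto
    then show ?thesis using True p by (simp add: w_def abs_mult)
  qed (use p in \<open>auto simp: w_def\<close>)
  \<comment> \<open>The bounds of \<open>mesh_bound\<close> and, multiplied by \<open>n\<close>, of
    \<open>weight_bound\<close>.\<close>
  define \<epsilon> where "\<epsilon> n = (real n + 1) * Q / lam n" for n
  define \<delta> where "\<delta> n = real n * (p * Q / lam n)" for n
  have \<epsilon>: "\<epsilon> \<longlonglongrightarrow> 0"
    using tendsto_add[OF tendsto_mult_right[OF n_lam, of Q] inv[of Q]]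
    by (simp add: \<epsilon>_def[abs_def] distrib_right add_divide_distrib)
  have \<delta>: "\<delta> \<longlonglongrightarrow> 0"
    using tendsto_mult_right[OF n_lam, of "p * Q"] by (simp add: \<delta>_def[abs_def])
  interpret cell_partition J \<epsilon>
  proof
    show "J n i \<in> sets borel" for n i
      by (auto simp: J_def nodal_cell_def Let_def)
    fix n :: nat assume n: "n \<ge> 1"
    interpret rot p q n "lam n" "y n" by (rule rot[OF n])
    show "disjoint_family_on (J n) {..<n}" unfolding J_def by (rule cell_disjoint)
    show "(\<Union>i<n. J n i) = {0..<1}" unfolding J_def by (rule cell_union)
    fix i assume i: "i < n"
    show "(\<exists>a b. J n i = {a..<b}) \<or> (\<exists>c d. 0 \<le> c \<and> c \<le> d \<and> d < 1 \<and> J n i = {0..<c} \<union> {d..<1})"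
    proof (cases "i + 1 < n")
      case False
      have "0 \<le> s ! 0 \<and> s ! 0 \<le> s ! (n - 1) \<and> s ! (n - 1) < 1"
        using s_zero[of 0] s_zero[of "n - 1"] s_le[of 0 "n - 1"] n by auto
      moreover have "J n i = {0..<s ! 0} \<union> {s ! (n - 1)..<1}" using False by (simp add: J_def cell_eq)
      ultimately show ?thesis by blast
    qed (auto simp: J_def cell_eq)
  next
    show "\<epsilon> \<longlonglongrightarrow> 0" by (rule \<epsilon>)
    show "\<forall>\<^sub>F n in sequentially. \<forall>i<n. \<bar>real n * measure lebesgue (J n i) - 1\<bar> \<le> \<epsilon> n"
      using lam_pos
    proof eventually_elim
      case (elim n)
      then show ?case using rot.mesh_bound[OF rot, of n] Q_eq unfolding J_def \<epsilon>_def by simp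
    qed
  qed
  have wJ: "\<forall>\<^sub>F n in sequentially. \<forall>i<n. \<bar>real n * (LINT t:J n i|lebesgue. w n t - 1)\<bar> \<le> \<delta> n"
    using lam_pos
  proof eventually_elim
    case (elim n)
    then have n: "n \<ge> 1" and l: "lam n > 0" by auto
    have "\<bar>LINT t:J n i|lebesgue. w n t - 1\<bar> \<le> p * Q / lam n" if "i < n" for i
      using rot.weight_bound[OF rot[OF n] l that] Q_eq elim by (simp add: J_def w_def)
    then have "real n * \<bar>LINT t:J n i|lebesgue. w n t - 1\<bar> \<le> \<delta> n" if "i < n" for i
      unfolding \<delta>_def using that by (intro mult_left_mono) auto
    then show ?case by (simp add: abs_mult)
  qed
  define T where "T = cell_avg J q w"
  have T_AE: "AE x in lebesgue. x \<in> {0<..<1} \<longrightarrow> (\<lambda>n. T n x) \<longlonglongrightarrow> q x"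
    unfolding T_def by (rule cell_avg_tendsto_AE[OF q01 wm wb \<delta> wJ])
  have T_L1: "(\<lambda>n. LINT x|lebesgue. \<bar>T n x - indicator {0..<1} x * q x\<bar>) \<longlonglongrightarrow> 0"
    unfolding T_def by (rule cell_avg_tendsto_L1[OF q01 wm wb T_AE[unfolded T_def]])
  define I where "I n = (LINT t:{0..<1}|lebesgue. q t * w n t)" for n
  have I_lim: "I \<longlonglongrightarrow> Iq"
    using weighted_integral_tendsto[OF q01 wm wb T_L1[unfolded T_def]] by (simp add: I_def[abs_def] Iq_eq)
  have F_eq: "\<forall>\<^sub>F n in sequentially. \<forall>x\<in>{0<..<1}. nodal_F p q n (y n) x = c n * (T n x - I n) + Iq"
    using lam_pos
  proof eventually_elim
    case (elim n)
    then have n: "n \<ge> 1" and l: "lam n > 0" by auto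
    interpret R: rot p q n "lam n" "y n" by (rule rot[OF n])
    have w_eq: "w n t = p * R.W (lam n) t" for t using elim by (simp add: w_def)
    have I_eq: "I n = p * R.IW"
      unfolding I_def R.IW_def w_eq by (simp add: mult.left_commute)
    show ?case
    proof
      fix x :: real assume "x \<in> {0<..<1}"
      then have "x \<in> (\<Union>i<n. nodal_cell n (y n) i)" unfolding R.cell_union by simp
      then obtain i where i: "i < n" "x \<in> nodal_cell n (y n) i" by blast
      have "T n x = real n * (LINT t:J n i|lebesgue. q t * w n t)"
        unfolding T_def by (rule cell_avg_eq[OF n i(1)]) (use i in \<open>simp add: J_def\<close>)
      also have "\<dots> = p * (real n * (LINT t:nodal_cell n (y n) i|lebesgue. q t * R.W (lam n) t))"
        unfolding w_eq J_def by (simp add: mult.left_commute)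
      finally have T_eq: "T n x = p * (real n * (LINT t:nodal_cell n (y n) i|lebesgue. q t * R.W (lam n) t))" .
      show "nodal_F p q n (y n) x = c n * (T n x - I n) + Iq"
        unfolding R.nodal_F_cell[OF i] R.scaled_nodal_length[OF l i(1)] T_eq I_eq c_def Iq_def
        by (simp add: algebra_simps diff_divide_distrib)
    qed
  qed
  have AE: "conv_ae01 (\<lambda>n. nodal_F p q n (y n)) q"
    unfolding conv_ae01_def using T_AE
  proof eventually_elim
    case (elim x)
    show ?case
    proof
      assume x: "x \<in> {0<..<1}"
      have "(\<lambda>n. c n * (T n x - I n) + Iq) \<longlonglongrightarrow> 1 * (q x - Iq) + Iq"
        using elim x by (intro tendsto_intros c1 I_lim) auto
      moreover have "\<forall>\<^sub>F n in sequentially. c n * (T n x - I n) + Iq = nodal_F p q n (y n) x"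
        using F_eq by eventually_elim (use x in simp)
      ultimately show "(\<lambda>n. nodal_F p q n (y n) x) \<longlonglongrightarrow> q x"
        using Lim_transform_eventually by fastforce
    qed
  qed
  have F_int: "nodal_F p q n (y n) absolutely_integrable_on {0<..<1}" for n
  proof (cases "n \<ge> 1")
    case True
    then show ?thesis using rot.nodal_F_integrable[OF rot] by blast
  next
    \<comment> \<open>Integrability is demanded at index 0 as well; there the factor
      \<open>(real n * pi_hat p) powr p\<close> is 0 and \<open>nodal_F\<close> is constant.\<close>
    case False
    then have "nodal_F p q n (y n) = (\<lambda>_. Iq)" by (auto simp: nodal_F_def Iq_def)
    then show ?thesis by (simp add: absolutely_integrable_on_const)
  qed
  define q0 where "q0 x = indicator {0..<1} x * q x" for x :: real
  have q0i: "integrable lebesgue q0"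
  proof -
    have "set_integrable lebesgue {0..<1} q" using q01 by (rule set_integrable_subset) auto
    then show ?thesis by (simp add: set_integrable_def q0_def[abs_def])
  qed
  \<comment> \<open>On the unit interval
    \<open>F - q = c n * (T n - q) + (c n - 1) * q + (Iq - c n * I n)\<close>; \<open>B n\<close>
    bounds the integrals of the three terms, the last of which vanishes in the limit because
    \<open>I\<close> tends to \<open>Iq\<close>.\<close>
  define B where "B n = \<bar>c n\<bar> * (LINT x|lebesgue. \<bar>T n x - q0 x\<bar>) + \<bar>c n - 1\<bar> * (LINT x|lebesgue. \<bar>q0 x\<bar>) + \<bar>Iq - c n * I n\<bar>" for n
  have "B \<longlonglongrightarrow> \<bar>1\<bar> * 0 + \<bar>1 - 1\<bar> * (LINT x|lebesgue. \<bar>q0 x\<bar>) + \<bar>Iq - 1 * Iq\<bar>"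
    unfolding B_def using T_L1 by (intro tendsto_intros c1 I_lim) (simp add: q0_def)
  then have B0: "B \<longlonglongrightarrow> 0" by simp
  have L1: "(\<lambda>n. LINT x:{0<..<1}|lebesgue. \<bar>nodal_F p q n (y n) x - q x\<bar>) \<longlonglongrightarrow> 0"
  proof (rule Lim_null_comparison[OF _ B0])
    show "\<forall>\<^sub>F n in sequentially. norm (LINT x:{0<..<1}|lebesgue. \<bar>nodal_F p q n (y n) x - q x\<bar>) \<le> B n"
      using F_eq
    proof eventually_elim
      case (elim n)
      let ?F = "nodal_F p q n (y n)"
      have Ti: "integrable lebesgue (T n)" unfolding T_def by (rule integrable_cell_avg)
      have i1: "integrable lebesgue (\<lambda>x. \<bar>c n\<bar> * \<bar>T n x - q0 x\<bar>)"
        using Ti q0i by (intro integrable_mult_right integrable_abs Bochner_Integration.integrable_diff)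
      have i2: "integrable lebesgue (\<lambda>x. \<bar>c n - 1\<bar> * \<bar>q0 x\<bar>)"
        using q0i by (intro integrable_mult_right integrable_abs)
      have i3: "integrable lebesgue (\<lambda>x::real. \<bar>Iq - c n * I n\<bar> * indicat_real {0<..<1} x)"
        by (intro integrable_mult_right) (simp add: integrable_indicator_iff)
      have "(LINT x:{0<..<1}|lebesgue. \<bar>?F x - q x\<bar>) \<le>
          (LINT x|lebesgue. \<bar>c n\<bar> * \<bar>T n x - q0 x\<bar> + \<bar>c n - 1\<bar> * \<bar>q0 x\<bar> + \<bar>Iq - c n * I n\<bar> * indicat_real {0<..<1} x)"
        unfolding set_lebesgue_integral_def
      proof (rule integral_mono)
        show "integrable lebesgue (\<lambda>x. indicat_real {0<..<1} x *\<^sub>R \<bar>?F x - q x\<bar>)"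
          using set_integrable_abs[OF set_integral_diff(1)[OF F_int[of n] q]] by (simp add: set_integrable_def)
        show "integrable lebesgue (\<lambda>x. \<bar>c n\<bar> * \<bar>T n x - q0 x\<bar> + \<bar>c n - 1\<bar> * \<bar>q0 x\<bar> + \<bar>Iq - c n * I n\<bar> * indicat_real {0<..<1} x)"
          by (intro Bochner_Integration.integrable_add i1 i2 i3)
        fix x :: real
        show "indicat_real {0<..<1} x *\<^sub>R \<bar>?F x - q x\<bar> \<le> \<bar>c n\<bar> * \<bar>T n x - q0 x\<bar> + \<bar>c n - 1\<bar> * \<bar>q0 x\<bar> + \<bar>Iq - c n * I n\<bar> * indicat_real {0<..<1} x"
        proof (cases "x \<in> {0<..<1}")
          case True
          then have q0x: "q0 x = q x" by (simp add: q0_def)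
          have "?F x - q x = c n * (T n x - q x) + (c n - 1) * q x + (Iq - c n * I n)"
            using elim True by (simp add: algebra_simps)
          then have "\<bar>?F x - q x\<bar> \<le> \<bar>c n * (T n x - q x)\<bar> + \<bar>(c n - 1) * q x\<bar> + \<bar>Iq - c n * I n\<bar>" by linarith
          then show ?thesis using True by (simp add: abs_mult q0x)
        qed simp
      qed
      also have "\<dots> = B n"
        using i1 i2 i3 by (simp add: B_def)
      finally have "(LINT x:{0<..<1}|lebesgue. \<bar>?F x - q x\<bar>) \<le> B n" .
      moreover have "(LINT x:{0<..<1}|lebesgue. \<bar>?F x - q x\<bar>) \<ge> 0"
        unfolding set_lebesgue_integral_def by (intro integral_nonneg_AE AE_I2) auto
      ultimately show ?case by simp
    qed
  qed
  show ?thesis using AE L1 F_int q by (simp add: conv_L1_01_def)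
qed

section \<open>Even and odd subsequences\<close>

lemma conv_ae01_subseq:
  assumes "conv_ae01 f g" "strict_mono r"
  shows "conv_ae01 (\<lambda>n. f (r n)) g"
  using assms(1) unfolding conv_ae01_def
  by eventually_elim (use LIMSEQ_subseq_LIMSEQ[OF _ assms(2)] in \<open>auto simp: o_def\<close>)

lemma conv_L1_01_subseq:
  assumes "conv_L1_01 f g" "strict_mono r"
  shows "conv_L1_01 (\<lambda>n. f (r n)) g"
  using assms(1) LIMSEQ_subseq_LIMSEQ[OF _ assms(2)] unfolding conv_L1_01_def by (fastforce simp: o_def)

theorem theorem1p2:
  fixes p :: real and q :: "real \<Rightarrow> real"
    and lam :: "nat \<Rightarrow> real" and y :: "nat \<Rightarrow> real \<Rightarrow> real"
  assumes "p > 1"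
    and "\<forall>x. q (x + 1) = q x"
    and "q absolutely_integrable_on {0<..<1}"
    and "\<forall>n\<ge>1. is_lower_rot_eigenvalue p q n (lam n) \<or> is_upper_rot_eigenvalue p q n (lam n)"
    and "\<forall>n\<ge>1. rot_eigenfunction p q n (lam n) (y n)"
  shows "conv_ae01 (\<lambda>n. nodal_F p q (2 * n) (y (2 * n))) q \<and>
         conv_L1_01 (\<lambda>n. nodal_F p q (2 * n) (y (2 * n))) q \<and>
         conv_ae01 (\<lambda>n. nodal_F p q (2 * n - 1) (y (2 * n - 1))) q \<and>
         conv_L1_01 (\<lambda>n. nodal_F p q (2 * n - 1) (y (2 * n - 1))) q"
proof -
  have F: "conv_ae01 (\<lambda>n. nodal_F p q n (y n)) q" "conv_L1_01 (\<lambda>n. nodal_F p q n (y n)) q"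
    using nodal_F_converges[of p q lam y] assms by auto
  \<comment> \<open>Truncated subtraction sends 0 to 0 and 1 to 1, so the odd index map is strictly
    increasing from the start.\<close>
  have even: "strict_mono (\<lambda>n::nat. 2 * n)" and odd: "strict_mono (\<lambda>n::nat. 2 * n - 1)"
    by (auto intro!: strict_monoI)
  show ?thesis
    using conv_ae01_subseq[OF F(1) even] conv_L1_01_subseq[OF F(2) even]
      conv_ae01_subseq[OF F(1) odd] conv_L1_01_subseq[OF F(2) odd] by blast
qed

end
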